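(* Let $\alpha>0$ and let $\phi(z)=e^{-\alpha^2 z^2/2}\phi_1(z)$ where $\phi_1\in\mathcal{LP}_1$. If $r\ge 0$ and $f\in\mathcal{LP}^{\alpha^2/2}(r)$, then $\phi(D)f\in\mathcal{LP}\big(\sqrt{r^2-\alpha^2}\big)$ (where $\mathcal{LP}(\sqrt{r^2-\alpha^2})$ means $\mathcal{LP}$ if $r^2-\alpha^2<0$). Therefore $\phi(D)$ is a complex zero strip decreasing operator.
   Context: A real entire function is an entire function taking real values on the real line. For $r\ge 0$ let $S(r)=\{z\in\mathbb{C}: -r\le \operatorname{Im} z\le r\}$, and let $\mathcal{LP}(r)$ be the class of real entire functions with a product representation $$c z^m e^{a z-b z^2}\prod_k\Big(1-\frac{z}{\alpha_k}\Big)e^{z/\alpha_k},$$ where $c,a,b$ are real, $b\ge 0$, $m$ is a nonnegative integer, $(\alpha_k)$ is a finite (possibly empty) or infinite sequence of nonzero complex numbers in $S(r)$, and $\sum_k|\alpha_k|^{-2}<\infty$ (since the function is real, nonreal zeros occur in complex conjugate pairs; $c=0$ is allowed, so the zero function belongs to the class). $\mathcal{LP}_1(r)$ is the subclass with $b=0$. Put $\mathcal{LP}=\mathcal{LP}(0)$ (the Laguerre-Pólya class) and $\mathcal{LP}_1=\mathcal{LP}_1(0)$. If $r<0$ or $r$ is imaginary, $\mathcal{LP}(r)$ means $\mathcal{LP}$ and $S(r)$ means $\mathbb{R}$. For $\gamma_1\ge 0$ and $r\ge 0$, $\mathcal{LP}^{\gamma_1}(r)$ is the class of functions $f(z)=e^{-\gamma_2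 z^2}f_1(z)$ with $f_1\in\mathcal{LP}_1(r)$, $\gamma_2\ge 0$ and $\gamma_1\gamma_2<1/4$. Let $\phi(z)=e^{-\gamma_1 z^2}\phi_1(z)=\sum_{k\ge 0}a_k z^k\in\mathcal{LP}$ with $\gamma_1\ge 0$, $\phi_1\in\mathcal{LP}_1$. For $f\in\mathcal{LP}^{\gamma_1}(r)$ define $\phi(D)f(z)=\sum_{k\ge 0}a_k f^{(k)}(z)$, where $D$ is differentiation; it is a known fact (Levin) that this series converges uniformly on compact subsets of $\mathbb{C}$ and that $\phi(D)f\in\mathcal{LP}(r)$. The operator $\phi(D)$ is called a complex zero strip decreasing operator (CZSDO) if for each $r>0$ there exists $r_1$ with $0\le r_1<r$ such that $\phi(D)f\in\mathcal{LP}(r_1)$ for all $f\in\mathcal{LP}^{\gamma_1}(r)$. *)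

theory Defs
  imports "HOL-Complex_Analysis.Complex_Analysis"
begin

definition real_entire :: "(complex \<Rightarrow> complex) \<Rightarrow> bool" where
  "real_entire f \<longleftrightarrow> f holomorphic_on UNIV \<and> (\<forall>x\<in>\<real>. f x \<in> \<real>)"

(* A negative width gives the real line.  Since the real function sqrt is odd, sqrt x < 0
   for x < 0, so strip (sqrt x) is also the real line when the square root is imaginary. *)
definition strip :: "real \<Rightarrow> complex set" where
  "strip r = (if r < 0 then \<real> else {z. - r \<le> Im z \<and> Im z \<le> r})"

(* The zeros other than 0 are the family of all (alpha k) with k in I; the set I is finite
   (possibly empty) or infinite, and indices outside I contribute the factor 1.  The summability
   condition makes the infinite product converge for every z. *)
definition LP_rep :: "real \<Rightarrow> real \<Rightarrow> (complex \<Rightarrow> complex) \<Rightarrow> bool" where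
  "LP_rep b r f \<longleftrightarrow>
     real_entire f \<and>
     (\<exists>(c::real) (a::real) (m::nat) (I::nat set) (\<alpha>::nat \<Rightarrow> complex).
        (\<forall>k\<in>I. \<alpha> k \<noteq> 0 \<and> \<alpha> k \<in> strip r) \<and>
        (\<lambda>k. 1 / (cmod (\<alpha> k))\<^sup>2) summable_on I \<and>
        (\<forall>z. f z = of_real c * z ^ m * exp (of_real a * z - of_real b * z\<^sup>2) *
               (\<Prod>k. if k \<in> I then (1 - z / \<alpha> k) * exp (z / \<alpha> k) else 1)))"

definition LP :: "real \<Rightarrow> (complex \<Rightarrow> complex) set" where
  "LP r = {f. \<exists>b\<ge>0. LP_rep b r f}"

definition LP1 :: "real \<Rightarrow> (complex \<Rightarrow> complex) set" where
  "LP1 r = {f. LP_rep 0 r f}"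

(* The class written LP with superscript gamma1 and argument r. *)
definition LP_sup :: "real \<Rightarrow> real \<Rightarrow> (complex \<Rightarrow> complex) set" where
  "LP_sup \<gamma>\<^sub>1 r =
     {f. \<exists>\<gamma>\<^sub>2 f\<^sub>1. f\<^sub>1 \<in> LP1 r \<and> \<gamma>\<^sub>2 \<ge> 0 \<and> \<gamma>\<^sub>1 * \<gamma>\<^sub>2 < 1 / 4 \<and>
           f = (\<lambda>z. exp (- of_real \<gamma>\<^sub>2 * z\<^sup>2) * f\<^sub>1 z)}"

(* The operator phi(D), with the Taylor coefficients of phi at 0 as coefficients. *)
definition op_D :: "(complex \<Rightarrow> complex) \<Rightarrow> (complex \<Rightarrow> complex) \<Rightarrow> complex \<Rightarrow> complex" where
  "op_D \<phi> f z = (\<Sum>k. (deriv ^^ k) \<phi> 0 / fact k * (deriv ^^ k) f z)"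

(* gamma1 is a parameter because it determines the domain of phi(D); it is determined by phi
   unless phi = 0. *)
definition CZSDO :: "real \<Rightarrow> (complex \<Rightarrow> complex) \<Rightarrow> bool" where
  "CZSDO \<gamma>\<^sub>1 \<phi> \<longleftrightarrow>
     \<gamma>\<^sub>1 \<ge> 0 \<and> (\<exists>\<phi>\<^sub>1\<in>LP1 0. \<phi> = (\<lambda>z. exp (- of_real \<gamma>\<^sub>1 * z\<^sup>2) * \<phi>\<^sub>1 z)) \<and>
     (\<forall>r>0. \<exists>r\<^sub>1. 0 \<le> r\<^sub>1 \<and> r\<^sub>1 < r \<and> (\<forall>f\<in>LP_sup \<gamma>\<^sub>1 r. op_D \<phi> f \<in> LP r\<^sub>1))"

end

theory Submission
  imports Defs "HOL-Computational_Algebra.Fundamental_Theorem_Algebra"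
begin

text \<open>
  De Bruijn's argument: if a real polynomial \<open>p\<close> has its zeros in the strip of half-width \<open>r\<close>, then
  \<open>(p (z + i l) + p (z - i l)) / 2\<close>, that is \<open>cos (l D) p\<close>, has its zeros in the strip of half-width \<open>sqrt (r\<^sup>2 - l\<^sup>2)\<close>,
  because the two moduli differ outside it. Iterating \<open>n\<close> times with \<open>l = \<alpha> / sqrt n\<close> gives half-width
  \<open>sqrt (r\<^sup>2 - \<alpha>\<^sup>2)\<close>, and \<open>cos (\<alpha> z / sqrt n) ^ n\<close> tends to \<open>exp (- \<alpha>\<^sup>2 z\<^sup>2 / 2)\<close>. The factors of the partial products of
  \<open>\<phi>\<^sub>1\<close> act as translations and as operators \<open>p - b p'\<close> with real \<open>b\<close>, which preserve every strip.

  To pass to the limit, \<open>f\<close> is approximated by real polynomials with zeros in the strip, with Gaussian bounds that make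
  the series for \<open>\<phi>(D) f\<close> converge dominatedly. The limit lies in the class by an elementary version of the theorem of
  Laguerre and Polya: moving up the imaginary axis above the strip bounds the sum of \<open>|a|\<^sup>-\<^sup>2\<close> over the zeros \<open>a\<close> uniformly, so
  the zeros converge along a subsequence, the genus 2 products converge dominatedly, and the defect in the limit of
  the sums of \<open>a\<^sup>-\<^sup>2\<close> is the coefficient of the Gaussian factor.
\<close>

section \<open>Infinite products of Weierstrass factors\<close>

text \<open>All limits are pointwise, backed by bounds uniform in the approximation index; Cauchy
  integrals carry them over to derivatives. The operator series is dominated when the Gaussian types
  \<beta> of the symbol and \<delta> of the argument satisfy 4 \<beta> \<delta> < 1, so approximants
  may exceed the types of their limits only by an arbitrarily small \<epsilon>. Hence the sharp
  constant in |cos z| <= exp (|z|^2 / 2). In the closure of the class there are two obstacles: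
  approximating zeros may tend to 0, which makes the sums of |a|^-2 unbounded, and for nonreal zeros
  a^-2 need not be positive. The remedy for the former is to measure distances from a point i Y1
  above the strip and to split off the finitely many small zeros; for the latter, that |Im (1/a)| <=
  r |a|^-2 in the strip. Listed by size, the reciprocals of the zeros are only O(1 / sqrt k), so
  cubes but not squares have a summable majorant: this dictates genus 2. The sums of 1/a are not
  controlled by these estimates; their limit is read off from the limit function at two
  points.\<close>

lemma norm_prod_minus_one_le_exp:
  fixes u :: "nat \<Rightarrow> complex"
  shows "norm ((\<Prod>k\<in>A. 1 + u k) - 1) \<le> exp (\<Sum>k\<in>A. norm (u k)) - 1"
proof -
  have "norm ((\<Prod>k\<in>A. 1 + u k) - 1) \<le> (\<Prod>k\<in>A. 1 + norm (u k)) - 1"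
    by (rule norm_prod_minus1_le_prod_minus1)
  also have "(\<Prod>k\<in>A. 1 + norm (u k)) \<le> exp (\<Sum>k\<in>A. norm (u k))"
    by (cases "finite A") (auto simp: exp_sum intro!: prod_mono)
  finally show ?thesis by simp
qed

lemma norm_prod_le_exp:
  fixes u :: "nat \<Rightarrow> complex"
  shows "norm (\<Prod>k\<in>A. 1 + u k) \<le> exp (\<Sum>k\<in>A. norm (u k))"
proof -
  have "norm (\<Prod>k\<in>A. 1 + u k) \<le> norm ((\<Prod>k\<in>A. 1 + u k) - 1) + 1"
    by (metis add.commute diff_add_cancel norm_one norm_triangle_ineq)
  with norm_prod_minus_one_le_exp[of u A] show ?thesis by linarith
qed

lemma convergent_prod_of_summable:
  fixes u :: "nat \<Rightarrow> complex"
  assumes "\<And>k. norm (u k) \<le> M k" "summable M"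
  shows "convergent_prod (\<lambda>k. 1 + u k)"
proof -
  have "summable (\<lambda>k. norm (u k))"
    by (rule summable_comparison_test'[OF assms(2)]) (use assms(1) in auto)
  then have "abs_convergent_prod (\<lambda>k. 1 + u k)"
    by (simp add: abs_convergent_prod_conv_summable)
  then show ?thesis
    by (rule abs_convergent_prod_imp_convergent_prod)
qed

text \<open>Tannery's theorem for products. A block of factors differs from 1 by at most exp (sum of
  \<open>M\<close> over the block) - 1, uniformly in \<open>n\<close>, so the partial products
  converge uniformly in \<open>n\<close> and the two limits may be interchanged.\<close>

lemma tendsto_prodinf_dominated:
  fixes u :: "nat \<Rightarrow> nat \<Rightarrow> complex"
  assumes lim: "\<And>k. (\<lambda>n. u n k) \<longlonglongrightarrow> v k"
    and bound: "\<And>n k. norm (u n k) \<le> M k" and M: "summable M"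
  shows "(\<lambda>n. \<Prod>k. 1 + u n k) \<longlonglongrightarrow> (\<Prod>k. 1 + v k)"
proof -
  have M0: "M k \<ge> 0" for k
    using bound[of 0 k] norm_ge_zero order_trans by blast
  have sumle: "(\<Sum>k\<in>A. norm (u n k)) \<le> (\<Sum>k\<in>A. M k)" for n A
    by (intro sum_mono bound)
  have conv: "convergent_prod (\<lambda>k. 1 + u n k)" for n
    using convergent_prod_of_summable[OF bound M] .
  have vb: "norm (v k) \<le> M k" for k
    by (rule LIMSEQ_le_const2[OF tendsto_norm[OF lim]]) (use bound in auto)
  have conv': "convergent_prod (\<lambda>k. 1 + v k)"
    using convergent_prod_of_summable[OF vb M] .
  have part: "(\<lambda>N. \<Prod>k<N. 1 + w k) \<longlonglongrightarrow> prodinf (\<lambda>k. 1 + w k)"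
    if "convergent_prod (\<lambda>k. 1 + w k)" for w :: "nat \<Rightarrow> complex"
    using that convergent_prod_has_prod_iff has_prod_imp_tendsto' by blast
  have "uniformly_convergent_on UNIV (\<lambda>N n. \<Prod>k<N. 1 + u n k)"
  proof (rule uniformly_convergent_prod_Cauchy)
    fix n :: nat and m
    have "norm (\<Prod>k<m. 1 + u n k) \<le> exp (\<Sum>k<m. norm (u n k))"
      by (rule norm_prod_le_exp)
    also have "\<dots> \<le> exp (suminf M)"
      using sumle[of n "{..<m}"] sum_le_suminf[OF M, of "{..<m}"] M0 by auto
    finally show "norm (\<Prod>k<m. 1 + u n k) \<le> exp (suminf M)" .
  next
    fix e :: real assume e: "e > 0"
    have "ln (1 + e) > 0" using e by simp
    from M[unfolded summable_Cauchy, rule_format, OF this]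
    obtain N where N: "\<And>m n. m \<ge> N \<Longrightarrow> norm (sum M {m..<n}) < ln (1 + e)" by blast
    show "\<exists>N. \<forall>n\<in>UNIV. \<forall>m\<ge>N. \<forall>l\<ge>m. dist (\<Prod>k=m..l. 1 + u n k) 1 < e"
    proof (intro exI ballI allI impI)
      fix n m l assume "m \<ge> N"
      have "dist (\<Prod>k=m..l. 1 + u n k) 1 \<le> exp (\<Sum>k=m..l. norm (u n k)) - 1"
        unfolding dist_norm by (rule norm_prod_minus_one_le_exp)
      also have "\<dots> \<le> exp (sum M {m..<Suc l}) - 1"
        using sumle[of n "{m..l}"] by (simp add: atLeastLessThanSuc_atLeastAtMost)
      also have "\<dots> < exp (ln (1 + e)) - 1"
        using N[OF \<open>m \<ge> N\<close>, of "Suc l"] by auto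
      finally show "dist (\<Prod>k=m..l. 1 + u n k) 1 < e" using e by simp
    qed
  qed
  then obtain h where h: "uniform_limit UNIV (\<lambda>N n. \<Prod>k<N. 1 + u n k) h sequentially"
    by (auto simp: uniformly_convergent_on_def)
  have "h n = (\<Prod>k. 1 + u n k)" for n
    using tendsto_uniform_limitI[OF h, of n] part[OF conv[of n]] LIMSEQ_unique by blast
  then have "uniform_limit UNIV (\<lambda>N n. \<Prod>k<N. 1 + u n k) (\<lambda>n. \<Prod>k. 1 + u n k) sequentially"
    using h by (metis (no_types, lifting) ext)
  then show ?thesis
    by (intro swap_uniform_limit'[OF _ part[OF conv'], where S = UNIV])
       (auto intro!: always_eventually tendsto_intros lim)
qed

lemma weierstrass_factor_one: "weierstrass_factor 1 z = (1 - z) * exp z"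
  by (simp add: weierstrass_factor_def)

lemma weierstrass_factor_two: "weierstrass_factor 2 z = (1 - z) * exp (z + z\<^sup>2 / 2)"
  by (simp add: weierstrass_factor_def numeral_2_eq_2)

text \<open>For |z| > 1/2 the power on the right is bounded below, so the maximum over the compact
  disc, scaled by 2^(p+1), extends the estimate valid for |z| <= 1/2. This covers the factors with
  large argument as well, as domination over all indices requires.\<close>

lemma weierstrass_factor_bound_on_disc:
  obtains C where "C > 0"
    "\<And>z. norm z \<le> R \<Longrightarrow> norm (weierstrass_factor p z - 1) \<le> C * norm z ^ Suc p"
proof -
  have "compact ((\<lambda>z. weierstrass_factor p z - 1) ` cball 0 R)"
    by (intro compact_continuous_image continuous_intros compact_cball)
  then have "bounded ((\<lambda>z. weierstrass_factor p z - 1) ` cball 0 R)"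
    by (rule compact_imp_bounded)
  then obtain B where "B > 0" and B: "\<And>z. norm z \<le> R \<Longrightarrow> norm (weierstrass_factor p z - 1) \<le> B"
    unfolding bounded_pos by auto
  show ?thesis
  proof (rule that[of "3 + B * 2 ^ Suc p"])
    fix z :: complex assume z: "norm z \<le> R"
    show "norm (weierstrass_factor p z - 1) \<le> (3 + B * 2 ^ Suc p) * norm z ^ Suc p"
    proof (cases "norm z \<le> 1 / 2")
      case True
      then have "norm (weierstrass_factor p z - 1) \<le> 3 * norm z ^ Suc p"
        by (rule weierstrass_factor_bound)
      moreover have "0 \<le> B * 2 ^ Suc p * norm z ^ Suc p"
        using \<open>B > 0\<close> by (intro mult_nonneg_nonneg) auto
      ultimately show ?thesis unfolding distrib_right by linarith
    next
      case False
      then have "1 ^ Suc p \<le> (2 * norm z) ^ Suc p"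
        by (intro power_mono) auto
      then have "1 \<le> 2 ^ Suc p * norm z ^ Suc p"
        by (simp only: power_mult_distrib power_one)
      then have "B \<le> B * (2 ^ Suc p * norm z ^ Suc p)"
        using \<open>B > 0\<close> by simp
      moreover have "0 \<le> 3 * norm z ^ Suc p"
        by simp
      ultimately show ?thesis unfolding distrib_right mult.assoc using B[OF z] by linarith
    qed
  qed (use \<open>B > 0\<close> in \<open>simp add: add_pos_nonneg\<close>)
qed

text \<open>In |1 - z|^2 = 1 + (|z|^2 - 2 Re z) <= exp (|z|^2 - 2 Re z) the linear term is cancelled
  exactly by the exponential factor. The bound is global and purely quadratic, so small reciprocal
  zeros contribute a small Gaussian type.\<close>

lemma norm_weierstrass_factor_one_le: "norm (weierstrass_factor 1 z) \<le> exp ((norm z)\<^sup>2 / 2)"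
proof -
  have "(norm (1 - z))\<^sup>2 = 1 + ((norm z)\<^sup>2 - 2 * Re z)"
    by (simp add: cmod_power2 power2_diff)
  also have "\<dots> \<le> exp ((norm z)\<^sup>2 - 2 * Re z)"
    by (rule exp_ge_add_one_self)
  also have "\<dots> = (exp ((norm z)\<^sup>2 / 2 - Re z))\<^sup>2"
    by (simp flip: exp_double)
  finally have "norm (1 - z) \<le> exp ((norm z)\<^sup>2 / 2 - Re z)"
    by (rule power2_le_imp_le) simp
  then have "norm (1 - z) * exp (Re z) \<le> exp ((norm z)\<^sup>2 / 2 - Re z) * exp (Re z)"
    by (rule mult_right_mono) simp
  then show ?thesis
    by (simp only: weierstrass_factor_one norm_mult norm_exp_eq_Re flip: exp_add) simp
qed

text \<open>Order 1 instead of 2: applied to a finite initial block of factors, which then adds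
  nothing to the Gaussian type.\<close>

lemma norm_weierstrass_factor_one_le_linear: "norm (weierstrass_factor 1 z) \<le> exp (2 * norm z)"
proof -
  have "norm (1 - z) \<le> 1 + norm z"
    by (metis norm_one norm_triangle_ineq4)
  also have "\<dots> \<le> exp (norm z)"
    by (rule exp_ge_add_one_self)
  finally have "norm (1 - z) \<le> exp (norm z)" .
  moreover have "norm (exp z) \<le> exp (norm z)"
    by (rule norm_exp)
  ultimately have "norm (1 - z) * norm (exp z) \<le> exp (norm z) * exp (norm z)"
    by (intro mult_mono) auto
  then show ?thesis
    by (simp only: weierstrass_factor_one norm_mult flip: exp_add) simp
qed

lemma prodinf_weierstrass_tendsto:
  fixes \<beta> :: "nat \<Rightarrow> nat \<Rightarrow> complex"
  assumes lim: "\<And>k. (\<lambda>n. \<beta> n k) \<longlonglongrightarrow> \<gamma> k"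
    and bound: "\<And>n k. norm (\<beta> n k) \<le> B k" and B: "summable (\<lambda>k. B k ^ Suc p)"
    and R: "\<And>k. B k \<le> R"
  shows "(\<lambda>n. \<Prod>k. weierstrass_factor p (\<beta> n k)) \<longlonglongrightarrow> (\<Prod>k. weierstrass_factor p (\<gamma> k))"
proof -
  obtain C where C: "C > 0"
    "\<And>z. norm z \<le> R \<Longrightarrow> norm (weierstrass_factor p z - 1) \<le> C * norm z ^ Suc p"
    using weierstrass_factor_bound_on_disc by blast
  have "(\<lambda>n. \<Prod>k. 1 + (weierstrass_factor p (\<beta> n k) - 1)) \<longlonglongrightarrow> (\<Prod>k. 1 + (weierstrass_factor p (\<gamma> k) - 1))"
  proof (rule tendsto_prodinf_dominated)
    have "isCont (weierstrass_factor p) z" for z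
      using weierstrass_factor_continuous_on[of UNIV "\<lambda>z. z" p] continuous_on_eq_continuous_at
      by auto
    then show "(\<lambda>n. weierstrass_factor p (\<beta> n k) - 1) \<longlonglongrightarrow> weierstrass_factor p (\<gamma> k) - 1" for k
      by (intro tendsto_intros isCont_tendsto_compose[OF _ lim])
    show "summable (\<lambda>k. C * B k ^ Suc p)"
      by (rule summable_mult[OF B])
    show "norm (weierstrass_factor p (\<beta> n k) - 1) \<le> C * B k ^ Suc p" for n k
    proof -
      have "norm (weierstrass_factor p (\<beta> n k) - 1) \<le> C * norm (\<beta> n k) ^ Suc p"
        using bound[of n k] R[of k] by (intro C) linarith
      also have "\<dots> \<le> C * B k ^ Suc p"
        using C(1) bound by (intro mult_left_mono power_mono) auto
      finally show ?thesis .
    qed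
  qed
  then show ?thesis by simp
qed

lemma convergent_prod_weierstrass:
  fixes \<beta> :: "nat \<Rightarrow> complex"
  assumes "summable (\<lambda>k. norm (\<beta> k) ^ Suc p)"
  shows "convergent_prod (\<lambda>k. weierstrass_factor p (\<beta> k))"
proof -
  have "(\<lambda>k. norm (\<beta> k) ^ Suc p) \<longlonglongrightarrow> 0"
    by (rule summable_LIMSEQ_zero[OF assms])
  then have "eventually (\<lambda>k. norm (\<beta> k) ^ Suc p < (1/2) ^ Suc p) sequentially"
    by (rule order_tendstoD) simp
  then have "eventually (\<lambda>k. norm (norm (weierstrass_factor p (\<beta> k) - 1)) \<le> 3 * norm (\<beta> k) ^ Suc p) sequentially"
  proof eventually_elim
    case (elim k)
    then have "norm (\<beta> k) < 1/2"
      by (rule power_less_imp_less_base) simp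
    then show ?case using weierstrass_factor_bound[of "\<beta> k" p] by simp
  qed
  then have "summable (\<lambda>k. norm (weierstrass_factor p (\<beta> k) - 1))"
    by (rule summable_comparison_test_ev[OF _ summable_mult[OF assms]])
  then have "abs_convergent_prod (\<lambda>k. weierstrass_factor p (\<beta> k))"
    by (simp add: abs_convergent_prod_conv_summable)
  then show ?thesis
    by (rule abs_convergent_prod_imp_convergent_prod)
qed

section \<open>Operators on real polynomials with zeros in a strip\<close>

definition real_strip_poly :: "real \<Rightarrow> complex poly \<Rightarrow> bool" where
  "real_strip_poly r p \<longleftrightarrow>
     (\<forall>n. coeff p n \<in> \<real>) \<and> (p \<noteq> 0 \<longrightarrow> (\<forall>z. poly p z = 0 \<longrightarrow> \<bar>Im z\<bar> \<le> r))"

lemma real_coeffs_iff_poly_cnj: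
  "(\<forall>n. coeff p n \<in> \<real>) \<longleftrightarrow> (\<forall>z. poly p (cnj z) = cnj (poly p z))"
proof
  assume "\<forall>z. poly p (cnj z) = cnj (poly p z)"
  then have "poly (map_poly cnj p) z = poly p z" for z
    by (metis complex_cnj_cnj poly_map_poly_cnj)
  then have "map_poly cnj p = p"
    using poly_eq_poly_eq_iff by blast
  then have "cnj (coeff p n) = coeff p n" for n
    by (metis coeff_map_poly complex_cnj_zero)
  then show "\<forall>n. coeff p n \<in> \<real>"
    by (simp add: Reals_cnj_iff)
qed (simp add: poly_cnj_real)

lemma poly_proots_decompose:
  fixes p :: "complex poly"
  shows "poly p z = lead_coeff p * (\<Prod>a\<in>#proots p. z - a)"
proof -
  have "poly p z = poly (smult (lead_coeff p) (\<Prod>x\<in>#proots p. [:-x, 1:])) z"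
    by (simp only: complex_poly_decompose_multiset)
  then show ?thesis by (simp add: poly_prod_mset)
qed

text \<open>Conjugating the factorisation of \<open>p\<close> gives a factorisation of the same
  polynomial, so the zeros agree with multiplicity.\<close>

lemma proots_cnj:
  fixes p :: "complex poly"
  assumes real: "\<forall>n. coeff p n \<in> \<real>"
  shows "image_mset cnj (proots p) = proots p"
proof (cases "p = 0")
  case False
  define q where "q = smult (lead_coeff p) (\<Prod>x\<in>#proots p. [:-cnj x, 1:])"
  have cnjprod: "cnj (\<Prod>a\<in>#A. z - a) = (\<Prod>a\<in>#A. cnj z - cnj a)" for A and z
    by (induction A) auto
  have "poly q z = poly p z" for z
  proof -
    have "poly p z = cnj (poly p (cnj z))"
      using real by (simp add: poly_cnj_real)
    also have "\<dots> = cnj (lead_coeff p) * (\<Prod>a\<in>#proots p. z - cnj a)"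
      by (subst poly_proots_decompose) (simp add: cnjprod)
    also have "cnj (lead_coeff p) = lead_coeff p"
      using real by (simp add: Reals_cnj_iff)
    also have "lead_coeff p * (\<Prod>a\<in>#proots p. z - cnj a) = poly q z"
      by (simp add: q_def poly_prod_mset)
    finally show ?thesis ..
  qed
  then have "q = p" using poly_eq_poly_eq_iff by blast
  have lin: "[:c, 1:] \<noteq> 0" for c :: complex by simp
  have "proots (\<Prod>x\<in>#A. [:-cnj x, 1:]) = image_mset cnj A" for A
  proof (induction A)
    case (add x A)
    have "(\<Prod>x\<in>#A. [:-cnj x, 1:]) \<noteq> 0"
      by (auto simp: prod_mset_zero_iff)
    with add show ?case
      by (simp add: proots_mult[OF lin] del: mult_pCons_left)
  qed simp
  then show ?thesis
    using \<open>q = p\<close> False by (metis q_def proots_smult leading_coeff_0_iff)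
qed simp

lemma poly_pderiv_proots:
  fixes p :: "complex poly"
  assumes "poly p z \<noteq> 0"
  shows "poly (pderiv p) z = poly p z * (\<Sum>a\<in>#proots p. 1 / (z - a))"
proof -
  have *: "poly (pderiv (\<Prod>x\<in>#A. [:-x, 1:])) z = poly (\<Prod>x\<in>#A. [:-x, 1:]) z * (\<Sum>a\<in>#A. 1 / (z - a))"
    if "\<forall>a\<in>#A. z \<noteq> a" for A
    using that
  proof (induction A)
    case (add x A)
    then show ?case
      by (simp add: pderiv_mult pderiv_pCons field_simps del: mult_pCons_left)
  qed simp
  have "\<forall>a\<in>#proots p. z \<noteq> a"
    using assms by (cases "p = 0") auto
  from *[OF this] show ?thesis
    by (subst (1 2) complex_poly_decompose_multiset[of p, symmetric]) (simp add: pderiv_smult)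
qed

lemma sum_mset_strict_neg:
  fixes g :: "'a \<Rightarrow> real"
  assumes "A \<noteq> {#}" "\<And>a. a \<in># A \<Longrightarrow> g a < 0"
  shows "(\<Sum>a\<in>#A. g a) < 0"
  using assms
proof (induction A)
  case (add x A)
  then show ?case by (cases "A = {#}") force+
qed simp

text \<open>The Gauss-Lucas argument: above the strip every 1 / (z - w) with w a zero has negative
  imaginary part, hence so has p'/p, and a + b p'/p with real coefficients and b nonzero cannot
  vanish. Conjugation covers the lower side.\<close>

lemma real_strip_poly_pderiv:
  assumes p: "real_strip_poly r p" and ab: "a \<in> \<real>" "b \<in> \<real>"
  shows "real_strip_poly r (smult a p + smult b (pderiv p))"
proof -
  define q where "q = smult a p + smult b (pderiv p)"
  have real: "\<forall>n. coeff p n \<in> \<real>" using p by (simp add: real_strip_poly_def)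
  have realq: "\<forall>n. coeff q n \<in> \<real>"
    using real ab by (auto simp: q_def coeff_pderiv intro!: Reals_add Reals_mult)
  have upper: "Im z \<le> r" if "q \<noteq> 0" "poly q z = 0" for z
  proof (rule ccontr)
    assume "\<not> Im z \<le> r"
    have "p \<noteq> 0" using that(1) by (auto simp: q_def)
    then have strip: "\<bar>Im w\<bar> \<le> r" if "poly p w = 0" for w
      using p that by (auto simp: real_strip_poly_def)
    have nz: "poly p z \<noteq> 0"
      using strip[of z] \<open>\<not> Im z \<le> r\<close> by auto
    define S where "S = (\<Sum>a\<in>#proots p. 1 / (z - a))"
    have "poly p z * (a + b * S) = 0"
      using that(2) poly_pderiv_proots[OF nz] by (simp add: q_def S_def algebra_simps)
    then have "a + b * S = 0" using nz by simp
    then have "Im (a + b * S) = 0" by simp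
    then have "Re b * Im S = 0"
      using ab by (simp add: complex_is_Real_iff)
    have "Im S = (\<Sum>a\<in>#proots p. Im (1 / (z - a)))"
    proof -
      have "Im (\<Sum>a\<in>#A. 1 / (z - a)) = (\<Sum>a\<in>#A. Im (1 / (z - a)))" for A
        by (induction A) simp_all
      then show ?thesis by (simp only: S_def)
    qed
    show False
    \<comment> \<open>The sum over the zeros is strictly negative only if there is a zero. In the
      degenerate cases \<open>a = 0\<close> follows, and \<open>q\<close> is the excluded zero
      polynomial.\<close>
    proof (cases "b = 0 \<or> proots p = {#}")
      case True
      then have "b * S = 0" unfolding S_def by force
      then have "a = 0" using \<open>a + b * S = 0\<close> by auto
      show False
      proof (cases "b = 0")
        case True then show ?thesis using \<open>a = 0\<close> that(1) by (simp add: q_def)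
      next
        case False
        then have "degree p = 0" using True by (metis size_proots_complex size_empty)
        then have "pderiv p = 0" by (simp add: pderiv_eq_0_iff)
        then show ?thesis using \<open>a = 0\<close> that(1) by (simp add: q_def)
      qed
    next
      case False
      have "Im (1 / (z - a)) < 0" if "a \<in># proots p" for a
      proof -
        have "poly p a = 0" using that \<open>p \<noteq> 0\<close> by simp
        with strip[of a] \<open>\<not> Im z \<le> r\<close> have "Im (z - a) > 0" by auto
        then have "(Re (z - a))\<^sup>2 + (Im (z - a))\<^sup>2 > 0"
          by (smt (verit) zero_less_power2 zero_le_power2)
        then show ?thesis
          using \<open>Im (z - a) > 0\<close> by (simp only: Im_divide one_complex.simps) (simp add: divide_neg_pos)
      qed
      with False have "(\<Sum>a\<in>#proots p. Im (1 / (z - a))) < 0"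
        by (intro sum_mset_strict_neg) auto
      with \<open>Re b * Im S = 0\<close> \<open>Im S = _\<close> have "Re b = 0" by auto
      with ab False show False by (auto simp: complex_is_Real_iff complex_eq_iff)
    qed
  qed
  have "\<bar>Im z\<bar> \<le> r" if "q \<noteq> 0" "poly q z = 0" for z
  proof -
    have "poly q (cnj z) = 0" using realq that(2) by (simp add: real_coeffs_iff_poly_cnj)
    then show ?thesis using upper[of z] upper[of "cnj z"] that by auto
  qed
  with realq show ?thesis by (simp add: real_strip_poly_def flip: q_def)
qed

lemma real_strip_poly_smult:
  "real_strip_poly r p \<Longrightarrow> a \<in> \<real> \<Longrightarrow> real_strip_poly r (smult a p)"
  using real_strip_poly_pderiv[of r p a 0] by simp

lemma real_strip_poly_translate:
  assumes "real_strip_poly r p"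
  shows "real_strip_poly r (pcompose p [:of_real b, 1:])"
proof -
  have "\<forall>n. coeff (pcompose p [:of_real b, 1:]) n \<in> \<real>"
    unfolding real_coeffs_iff_poly_cnj
  proof
    fix z
    have "of_real b + cnj z = cnj (of_real b + z)" by simp
    then show "poly (pcompose p [:of_real b, 1:]) (cnj z) = cnj (poly (pcompose p [:of_real b, 1:]) z)"
      using assms by (simp add: real_strip_poly_def real_coeffs_iff_poly_cnj poly_pcompose del: complex_cnj_add)
  qed
  moreover have "\<bar>Im z\<bar> \<le> r" if "pcompose p [:of_real b, 1:] \<noteq> 0" "poly (pcompose p [:of_real b, 1:]) z = 0" for z
  proof -
    have "p \<noteq> 0" using that(1) by auto
    moreover have "poly p (of_real b + z) = 0" using that(2) by (simp add: poly_pcompose)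
    ultimately have "\<bar>Im (of_real b + z)\<bar> \<le> r" using assms unfolding real_strip_poly_def by blast
    then show ?thesis by simp
  qed
  ultimately show ?thesis by (auto simp: real_strip_poly_def)
qed

lemma prod_mset_strict_mono:
  fixes f g :: "'a \<Rightarrow> real"
  assumes "A \<noteq> {#}" "\<And>a. a \<in># A \<Longrightarrow> 0 \<le> f a \<and> f a < g a"
  shows "0 \<le> (\<Prod>a\<in>#A. f a) \<and> (\<Prod>a\<in>#A. f a) < (\<Prod>a\<in>#A. g a)"
  using assms
proof (induction A)
  case (add x A)
  then show ?case
    by (cases "A = {#}") (force intro!: mult_strict_mono mult_nonneg_nonneg)+
qed simp

text \<open>
  A zero $a$ and its conjugate are treated together: with $z = x + iy$, $a = s + it$, the difference of the squares of the
  two products below is $8 y l ((x-s)^2 + y^2 + l^2 - t^2)$.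
\<close>
lemma shift_factor_less:
  fixes a z :: complex
  assumes "Im z > 0" "l > 0" "(Im z)\<^sup>2 > r\<^sup>2 - l\<^sup>2" "\<bar>Im a\<bar> \<le> r"
  shows "norm (z - \<i> * of_real l - a) * norm (cnj z + \<i> * of_real l - a)
       < norm (z + \<i> * of_real l - a) * norm (cnj z - \<i> * of_real l - a)"
proof (rule power2_less_imp_less)
  define x y s t where "x = Re z" and "y = Im z" and "s = Re a" and "t = Im a"
  have "t\<^sup>2 \<le> r\<^sup>2"
    using assms(4) unfolding t_def by (rule power2_le_iff_abs_le[THEN iffD2, rotated]) (use assms(4) in auto)
  then have "8 * y * l * ((x - s)\<^sup>2 + y\<^sup>2 + l\<^sup>2 - t\<^sup>2) > 0"
    using assms zero_le_power2[of "x - s"] unfolding y_def by (intro mult_pos_pos) linarith+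
  moreover have "((x - s)\<^sup>2 + (y + l - t)\<^sup>2) * ((x - s)\<^sup>2 + (- y - l - t)\<^sup>2)
      - ((x - s)\<^sup>2 + (y - l - t)\<^sup>2) * ((x - s)\<^sup>2 + (- y + l - t)\<^sup>2)
      = 8 * y * l * ((x - s)\<^sup>2 + y\<^sup>2 + l\<^sup>2 - t\<^sup>2)"
    by algebra
  ultimately have "((x - s)\<^sup>2 + (y - l - t)\<^sup>2) * ((x - s)\<^sup>2 + (- y + l - t)\<^sup>2)
      < ((x - s)\<^sup>2 + (y + l - t)\<^sup>2) * ((x - s)\<^sup>2 + (- y - l - t)\<^sup>2)" by linarith
  then show "(norm (z - \<i> * of_real l - a) * norm (cnj z + \<i> * of_real l - a))\<^sup>2
      < (norm (z + \<i> * of_real l - a) * norm (cnj z - \<i> * of_real l - a))\<^sup>2"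
    by (simp add: power_mult_distrib cmod_power2 x_def y_def s_def t_def)
qed simp

definition shift_mean :: "real \<Rightarrow> complex poly \<Rightarrow> complex poly" where
  "shift_mean l p = smult (1/2) (pcompose p [:\<i> * of_real l, 1:] + pcompose p [:- \<i> * of_real l, 1:])"

lemma poly_shift_mean:
  "poly (shift_mean l p) z = (poly p (z + \<i> * of_real l) + poly p (z - \<i> * of_real l)) / 2"
  by (simp add: shift_mean_def poly_pcompose add.commute)

text \<open>At a zero of the mean, p (z + i l) and p (z - i l) are opposite, hence of equal modulus.
  The contradiction cannot be reached zero by zero, since a zero close to z + i l reverses the
  inequality of its own factors. By reality |p w|^2 = |p w| |p (cnj w)|, and in this product each
  zero is measured from both w and \<open>cnj w\<close>, which makes every factor
  comparable.\<close>

lemma real_strip_poly_shift_mean: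
  assumes p: "real_strip_poly r p" and l: "l > 0" and r: "r \<ge> 0"
  shows "real_strip_poly (sqrt (max 0 (r\<^sup>2 - l\<^sup>2))) (shift_mean l p)"
proof -
  have real: "\<forall>n. coeff p n \<in> \<real>" using p by (simp add: real_strip_poly_def)
  note cnj = real[unfolded real_coeffs_iff_poly_cnj, rule_format]
  have realq: "\<forall>n. coeff (shift_mean l p) n \<in> \<real>"
    unfolding real_coeffs_iff_poly_cnj
  proof
    fix z
    have "cnj z + \<i> * of_real l = cnj (z - \<i> * of_real l)" "cnj z - \<i> * of_real l = cnj (z + \<i> * of_real l)"
      by simp_all
    then show "poly (shift_mean l p) (cnj z) = cnj (poly (shift_mean l p) z)"
      by (simp only: poly_shift_mean cnj) (simp add: add.commute)
  qed
  have upper: "Im z \<le> sqrt (max 0 (r\<^sup>2 - l\<^sup>2))" if "shift_mean l p \<noteq> 0" "poly (shift_mean l p) z = 0" for z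
  proof (rule ccontr)
    assume *: "\<not> Im z \<le> sqrt (max 0 (r\<^sup>2 - l\<^sup>2))"
    then have z: "Im z > 0" by (smt (verit) max.cobounded1 real_sqrt_ge_0_iff)
    have "(sqrt (max 0 (r\<^sup>2 - l\<^sup>2)))\<^sup>2 < (Im z)\<^sup>2"
      using * by (intro power_strict_mono) auto
    then have z2: "(Im z)\<^sup>2 > r\<^sup>2 - l\<^sup>2" by simp
    have "p \<noteq> 0" using that(1) by (auto simp: shift_mean_def)
    define L where "L = lead_coeff p"
    have "L \<noteq> 0" using \<open>p \<noteq> 0\<close> by (simp add: L_def)
    show False
    \<comment> \<open>Strictness of the product inequality needs at least one zero; a constant is
      its own mean.\<close>
    proof (cases "proots p = {#}")
      case True
      then have "poly p w = L" for w
        using poly_proots_decompose[of p w] by (simp add: L_def)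
      then show False using that(2) \<open>L \<noteq> 0\<close> by (simp add: poly_shift_mean)
    next
      case False
      have nrm: "norm (poly p w) = norm L * (\<Prod>a\<in>#proots p. norm (w - a))" for w
      proof -
        have "norm (\<Prod>a\<in>#A. w - a) = (\<Prod>a\<in>#A. norm (w - a))" for A
          by (induction A) (auto simp: norm_mult)
        then show ?thesis by (subst poly_proots_decompose) (simp add: norm_mult L_def)
      qed
      have pm: "(\<Prod>a\<in>#A. u a) * (\<Prod>a\<in>#A. v a) = (\<Prod>a\<in>#A. u a * v a)" for A and u v :: "complex \<Rightarrow> real"
        by (simp add: prod_mset.distrib)
      have strip: "\<bar>Im a\<bar> \<le> r" if "a \<in># proots p" for a
        using that p \<open>p \<noteq> 0\<close> by (auto simp: real_strip_poly_def)
      have less: "(\<Prod>a\<in>#proots p. norm (z - \<i> * of_real l - a) * norm (cnj z + \<i> * of_real l - a))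
          < (\<Prod>a\<in>#proots p. norm (z + \<i> * of_real l - a) * norm (cnj z - \<i> * of_real l - a))"
        by (intro prod_mset_strict_mono[THEN conjunct2] False conjI shift_factor_less[OF z l z2] strip) auto
      have conjs: "cnj z + \<i> * of_real l = cnj (z - \<i> * of_real l)" "cnj z - \<i> * of_real l = cnj (z + \<i> * of_real l)"
        by simp_all
      have "norm (poly p (z - \<i> * of_real l)) * norm (poly p (cnj z + \<i> * of_real l))
          < norm (poly p (z + \<i> * of_real l)) * norm (poly p (cnj z - \<i> * of_real l))"
      proof -
        have "norm L * norm L > 0" using \<open>L \<noteq> 0\<close> by simp
        from mult_strict_left_mono[OF less this] show ?thesis
          by (simp only: nrm) (simp add: mult_ac flip: pm)
      qed
      then have "(norm (poly p (z - \<i> * of_real l)))\<^sup>2 < (norm (poly p (z + \<i> * of_real l)))\<^sup>2"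
        unfolding conjs cnj complex_mod_cnj by (simp add: power2_eq_square)
      moreover have "poly p (z - \<i> * of_real l) = - poly p (z + \<i> * of_real l)"
        using that(2) by (simp add: poly_shift_mean add_eq_0_iff)
      ultimately show False by simp
    qed
  qed
  have "\<bar>Im z\<bar> \<le> sqrt (max 0 (r\<^sup>2 - l\<^sup>2))" if "shift_mean l p \<noteq> 0" "poly (shift_mean l p) z = 0" for z
  proof -
    have "poly (shift_mean l p) (cnj z) = 0"
      using realq that(2) by (simp add: real_coeffs_iff_poly_cnj)
    then show ?thesis using upper[of z] upper[of "cnj z"] that by auto
  qed
  with realq show ?thesis by (simp add: real_strip_poly_def)
qed

text \<open>The square of the width drops by l^2 in each step, and clipping at 0 may be postponed to
  the end because max 0 (max 0 x - l^2) = max 0 (x - l^2).\<close>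

lemma real_strip_poly_shift_mean_funpow:
  assumes p: "real_strip_poly r p" and l: "l > 0" and r: "r \<ge> 0"
  shows "real_strip_poly (sqrt (max 0 (r\<^sup>2 - of_nat n * l\<^sup>2))) ((shift_mean l ^^ n) p)"
proof (induction n)
  case 0
  then show ?case using p r by simp
next
  case (Suc n)
  define \<rho> where "\<rho> = sqrt (max 0 (r\<^sup>2 - of_nat n * l\<^sup>2))"
  have "\<rho> \<ge> 0" by (simp add: \<rho>_def)
  have "\<rho>\<^sup>2 = max 0 (r\<^sup>2 - of_nat n * l\<^sup>2)"
    by (simp add: \<rho>_def)
  moreover have "of_nat (Suc n) * l\<^sup>2 = of_nat n * l\<^sup>2 + l\<^sup>2" "l\<^sup>2 \<ge> 0"
    by (simp_all add: distrib_right)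
  ultimately have "max 0 (\<rho>\<^sup>2 - l\<^sup>2) = max 0 (r\<^sup>2 - of_nat (Suc n) * l\<^sup>2)"
    by linarith
  with real_strip_poly_shift_mean[OF Suc.IH l] \<open>\<rho> \<ge> 0\<close> show ?case by (simp add: \<rho>_def)
qed

section \<open>Power series in the derivative acting on polynomials\<close>

definition fps_op :: "complex fps \<Rightarrow> complex poly \<Rightarrow> complex poly" where
  "fps_op A p = (\<Sum>k\<le>degree p. smult (fps_nth A k) ((pderiv ^^ k) p))"

lemma higher_pderiv_eq_0: "degree p < k \<Longrightarrow> (pderiv ^^ k) (p :: complex poly) = 0"
proof (induction k)
  case (Suc k)
  have "degree ((pderiv ^^ k) p) = 0" using Suc.prems by (simp add: degree_higher_pderiv)
  then show ?case by (simp add: pderiv_eq_0_iff)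
qed simp

lemma fps_op_eq_sum:
  assumes "degree p \<le> N"
  shows "fps_op A p = (\<Sum>k\<le>N. smult (fps_nth A k) ((pderiv ^^ k) p))"
  unfolding fps_op_def using assms
  by (intro sum.mono_neutral_left) (auto simp: higher_pderiv_eq_0)

lemma degree_fps_op_le: "degree (fps_op A p) \<le> degree p"
  unfolding fps_op_def by (intro degree_sum_le) (auto simp: degree_higher_pderiv intro: order_trans[OF degree_smult_le])

lemma smult_sum_right: "smult c (sum f A) = (\<Sum>i\<in>A. smult c (f i))"
  by (induction A rule: infinite_finite_induct) (simp_all add: smult_add_right)

text \<open>Multiplying symbols composes operators, since D^j D^k = D^(j+k). The double sum over a
  square reduces to the triangle j + k <= N, as derivatives of order above the degree vanish, and
  the triangle is regrouped into Cauchy products.\<close>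

lemma fps_op_mult: "fps_op (A * B) p = fps_op A (fps_op B p)"
proof -
  define N where "N = degree p"
  define D where "D = (\<lambda>k. (pderiv ^^ k) p)"
  have D0: "D k = 0" if "k > N" for k
    using that by (simp add: D_def N_def higher_pderiv_eq_0)
  have "fps_op A (fps_op B p) = (\<Sum>j\<le>N. smult (fps_nth A j) ((pderiv ^^ j) (fps_op B p)))"
    by (rule fps_op_eq_sum) (simp add: N_def degree_fps_op_le)
  also have "\<dots> = (\<Sum>j\<le>N. \<Sum>k\<le>N. smult (fps_nth A j * fps_nth B k) (D (j + k)))"
    by (simp add: fps_op_eq_sum[of p N] N_def higher_pderiv_sum higher_pderiv_smult D_def smult_sum_right funpow_add)
  also have "\<dots> = (\<Sum>(j, k)\<in>{..N} \<times> {..N}. smult (fps_nth A j * fps_nth B k) (D (j + k)))"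
    by (simp add: sum.cartesian_product)
  also have "\<dots> = (\<Sum>(j, k)\<in>{(j, k). j + k \<le> N}. smult (fps_nth A j * fps_nth B k) (D (j + k)))"
    by (intro sum.mono_neutral_right) (auto, use D0 not_le in blast)
  also have "\<dots> = (\<Sum>n\<le>N. \<Sum>j\<le>n. smult (fps_nth A j * fps_nth B (n - j)) (D n))"
    by (subst sum.triangle_reindex_eq) simp
  also have "\<dots> = (\<Sum>n\<le>N. smult (fps_nth (A * B) n) (D n))"
    by (simp add: fps_mult_nth atMost_atLeast0 smult_sum)
  also have "\<dots> = fps_op (A * B) p"
    by (simp add: fps_op_def N_def D_def)
  finally show ?thesis ..
qed

lemma fps_op_add: "fps_op (A + B) p = fps_op A p + fps_op B p"
  by (simp add: fps_op_def smult_add_left sum.distrib)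

lemma fps_op_const: "fps_op (fps_const c) p = smult c p"
proof -
  have "fps_op (fps_const c) p = (\<Sum>k\<in>{0}. smult (fps_nth (fps_const c) k) ((pderiv ^^ k) p))"
    unfolding fps_op_def by (intro sum.mono_neutral_right) auto
  then show ?thesis by simp
qed

lemma fps_op_X: "fps_op fps_X p = pderiv p"
proof -
  have "fps_op fps_X p = (\<Sum>k\<le>Suc (degree p). smult (fps_nth fps_X k) ((pderiv ^^ k) p))"
    by (rule fps_op_eq_sum) simp
  also have "\<dots> = (\<Sum>k\<in>{1}. smult (fps_nth fps_X k) ((pderiv ^^ k) p))"
    by (intro sum.mono_neutral_right) (auto simp: fps_X_def)
  finally show ?thesis by simp
qed

lemma higher_deriv_poly: "(deriv ^^ k) (poly p) = poly ((pderiv ^^ k) (p :: complex poly))"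
proof (induction k)
  case (Suc k)
  have "deriv (poly q) = poly (pderiv q)" for q :: "complex poly"
    by (rule ext, rule DERIV_imp_deriv, rule poly_DERIV)
  with Suc show ?case by simp
qed simp

lemma op_D_poly:
  assumes "\<phi> has_fps_expansion A"
  shows "op_D \<phi> (poly p) z = poly (fps_op A p) z"
proof -
  have "op_D \<phi> (poly p) z = (\<Sum>k. fps_nth A k * poly ((pderiv ^^ k) p) z)"
    by (simp add: op_D_def fps_nth_fps_expansion[OF assms] higher_deriv_poly)
  also have "\<dots> = (\<Sum>k\<le>degree p. fps_nth A k * poly ((pderiv ^^ k) p) z)"
    by (rule suminf_finite) (auto simp: higher_pderiv_eq_0)
  finally show ?thesis by (simp add: fps_op_def poly_sum)
qed

text \<open>Taylor's formula: exp (c D) is translation by \<open>c\<close>. This covers real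
  translations and, with imaginary \<open>c\<close>, the two halves of the cosine.\<close>

lemma fps_op_exp: "fps_op (fps_exp c) p = pcompose p [:c, 1:]"
proof -
  have "poly (fps_op (fps_exp c) p) z = poly (pcompose p [:c, 1:]) z" for z
  proof -
    have "poly p holomorphic_on ball z (norm c + 1)"
      by (intro holomorphic_intros)
    then have "(\<lambda>n. (deriv ^^ n) (poly p) z / fact n * (z + c - z) ^ n) sums poly p (z + c)"
      by (rule holomorphic_power_series) (simp add: dist_norm)
    then have "poly p (z + c) = (\<Sum>n. poly ((pderiv ^^ n) p) z / fact n * c ^ n)"
      by (simp add: sums_iff higher_deriv_poly)
    also have "\<dots> = (\<Sum>n\<le>degree p. poly ((pderiv ^^ n) p) z / fact n * c ^ n)"
      by (rule suminf_finite) (auto simp: higher_pderiv_eq_0)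
    finally show ?thesis by (simp add: fps_op_def poly_sum poly_pcompose add.commute mult_ac)
  qed
  then show ?thesis using poly_eq_poly_eq_iff by blast
qed

definition fps_shift_mean :: "real \<Rightarrow> complex fps" where
  "fps_shift_mean l = fps_const (1/2) * (fps_exp (\<i> * of_real l) + fps_exp (- \<i> * of_real l))"

lemma fps_op_shift_mean: "fps_op (fps_shift_mean l ^ n) p = (shift_mean l ^^ n) p"
proof (induction n)
  case 0
  then show ?case using fps_op_const[of 1] by simp
next
  case (Suc n)
  have "fps_op (fps_shift_mean l) q = shift_mean l q" for q
    by (simp add: fps_shift_mean_def fps_op_mult fps_op_add fps_op_const fps_op_exp shift_mean_def)
  with Suc show ?case by (simp add: fps_op_mult)
qed

text \<open>A partial product of a function in \<open>LP1\<close>, written with reciprocal zeros and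
  with all exponential factors merged into the single exp (b z), so that each factor is the symbol
  of an elementary operator.\<close>

definition lp1_approx :: "real \<Rightarrow> nat \<Rightarrow> real \<Rightarrow> nat set \<Rightarrow> (nat \<Rightarrow> complex) \<Rightarrow> complex \<Rightarrow> complex" where
  "lp1_approx c m b F \<beta> z = of_real c * z ^ m * exp (of_real b * z) * (\<Prod>k\<in>F. 1 - \<beta> k * z)"

lemma op_D_approx_poly:
  assumes p: "real_strip_poly r p" and l: "l > 0" and r: "r \<ge> 0" and F: "finite F" "\<And>k. k \<in> F \<Longrightarrow> \<beta> k \<in> \<real>"
  obtains q where "real_strip_poly (sqrt (max 0 (r\<^sup>2 - of_nat n * l\<^sup>2))) q"
    "op_D (\<lambda>z. cos (of_real l * z) ^ n * lp1_approx c m b F \<beta> z) (poly p) = poly q"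
proof -
  define P where "P = (\<Prod>k\<in>F. 1 - fps_const (\<beta> k) * fps_X)"
  \<comment> \<open>The cosines stand leftmost and so act last, on a polynomial already known to
    have its zeros in the strip of half-width \<open>r\<close>.\<close>
  define A where "A = fps_shift_mean l ^ n * (fps_const (of_real c) * fps_X ^ m * fps_exp (of_real b) * P)"
  have 1: "real_strip_poly r (fps_op P p)"
    unfolding P_def using F
  proof (induction F rule: finite_induct)
    case empty
    then show ?case using fps_op_const[of 1] p by simp
  next
    case (insert k F)
    have eq: "1 - fps_const (\<beta> k) * fps_X = fps_const 1 + fps_const (- \<beta> k) * fps_X"
      by (simp flip: fps_const_neg)
    have "real_strip_poly r (smult 1 (fps_op (\<Prod>k\<in>F. 1 - fps_const (\<beta> k) * fps_X) p)
        + smult (- \<beta> k) (pderiv (fps_op (\<Prod>k\<in>F. 1 - fps_const (\<beta> k) * fps_X) p)))"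
      using insert by (intro real_strip_poly_pderiv) auto
    then show ?case
      using insert.hyps by (simp only: prod.insert[OF insert.hyps] eq fps_op_mult fps_op_add fps_op_const fps_op_X)
  qed
  have 2: "real_strip_poly r (fps_op (fps_exp (of_real b)) (fps_op P p))"
    unfolding fps_op_exp by (rule real_strip_poly_translate[OF 1])
  have 3: "real_strip_poly r (fps_op (fps_X ^ m) q)" if "real_strip_poly r q" for q
  proof (induction m)
    case 0
    then show ?case using fps_op_const[of 1] that by simp
  next
    case (Suc m)
    then show ?case
      using real_strip_poly_pderiv[of r "fps_op (fps_X ^ m) q" 0 1] by (simp add: fps_op_mult fps_op_X)
  qed
  have 4: "real_strip_poly r (fps_op (fps_const (of_real c) * fps_X ^ m * fps_exp (of_real b) * P) p)"
    by (simp add: fps_op_mult fps_op_const real_strip_poly_smult 3[OF 2])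
  have 5: "real_strip_poly (sqrt (max 0 (r\<^sup>2 - of_nat n * l\<^sup>2))) (fps_op A p)"
    unfolding A_def fps_op_mult[of "fps_shift_mean l ^ n"] fps_op_shift_mean
    by (rule real_strip_poly_shift_mean_funpow[OF 4 l r])
  have cosexp: "(\<lambda>z. cos (of_real l * z)) = (\<lambda>z. (1/2) * (exp ((\<i> * of_real l) * z) + exp ((- \<i> * of_real l) * z)))"
    by (simp add: fun_eq_iff cos_exp_eq mult_ac)
  have cos: "(\<lambda>z. cos (of_real l * z)) has_fps_expansion fps_shift_mean l"
    unfolding fps_shift_mean_def cosexp by (intro fps_expansion_intros)
  have prod: "(\<lambda>z. \<Prod>k\<in>F. 1 - \<beta> k * z) has_fps_expansion P"
    unfolding P_def using F(1)
    by (induction F rule: finite_induct) (auto intro!: fps_expansion_intros)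
  have "(\<lambda>z. cos (of_real l * z) ^ n * lp1_approx c m b F \<beta> z) has_fps_expansion A"
    unfolding A_def lp1_approx_def by (intro fps_expansion_intros cos prod)
  from op_D_poly[OF this] have "op_D (\<lambda>z. cos (of_real l * z) ^ n * lp1_approx c m b F \<beta> z) (poly p) = poly (fps_op A p)"
    by blast
  with 5 show ?thesis by (rule that)
qed

section \<open>Limits of real polynomials with zeros in a strip\<close>

lemma strip_eq: "strip r = {z. \<bar>Im z\<bar> \<le> max 0 r}"
  by (auto simp: strip_def complex_is_Real_iff)

lemma LP_max_0: "LP (max 0 r) = LP r"
  by (simp add: LP_def LP_rep_def strip_eq)

text \<open>Reciprocals of zeros, padded by 0, replace the index set \<open>I\<close>. A zero
  escaping to infinity then becomes a limit entry 0, whose factor is 1.\<close>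

lemma LP_rep_weierstrass:
  assumes "real_entire f"
    and "\<And>k. b k \<noteq> 0 \<Longrightarrow> 1 / b k \<in> strip r"
    and "summable (\<lambda>k. (norm (b k))\<^sup>2)"
    and "\<And>z. f z = of_real c * z ^ m * exp (of_real a * z - of_real t * z\<^sup>2) * (\<Prod>k. weierstrass_factor 1 (b k * z))"
  shows "LP_rep t r f"
  unfolding LP_rep_def
proof (intro conjI exI assms(1))
  define I where "I = {k. b k \<noteq> 0}"
  show "\<forall>k\<in>I. 1 / b k \<noteq> 0 \<and> 1 / b k \<in> strip r"
    using assms(2) by (auto simp: I_def)
  have "(\<lambda>k. (norm (b k))\<^sup>2) summable_on UNIV"
    by (intro summable_nonneg_imp_summable_on assms(3)) auto
  then have "(\<lambda>k. (norm (b k))\<^sup>2) summable_on I"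
    by (rule summable_on_subset_banach) auto
  then show "(\<lambda>k. 1 / (cmod (1 / b k))\<^sup>2) summable_on I"
    by (simp add: norm_divide power_divide)
  have "(if k \<in> I then (1 - z / (1 / b k)) * exp (z / (1 / b k)) else 1) = weierstrass_factor 1 (b k * z)" for k z
    by (auto simp: I_def weierstrass_factor_one[unfolded One_nat_def] mult.commute)
  then show "\<forall>z. f z = of_real c * z ^ m * exp (of_real a * z - of_real t * z\<^sup>2) *
      (\<Prod>k. if k \<in> I then (1 - z / (1 / b k)) * exp (z / (1 / b k)) else 1)"
    using assms(4) by simp
qed

text \<open>The exponent p/2 exceeds 1 from p = 3 on. For squares the majorant is harmonic, which is
  why the limits are taken with genus 2 factors.\<close>

lemma summable_bound_power:
  fixes D :: real
  assumes "p \<ge> 3"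
  shows "summable (\<lambda>k. (D / sqrt (real (Suc k))) ^ p)"
proof -
  have "summable (\<lambda>k. 1 / real (Suc k) powr (real p / 2))"
  proof -
    have "summable (\<lambda>k. 1 / real k powr (real p / 2))"
      using assms summable_real_powr_iff[of "- (real p / 2)"] by (simp add: powr_minus_divide)
    then show ?thesis by (subst summable_Suc_iff)
  qed
  then have "summable (\<lambda>k. D ^ p * (1 / real (Suc k) powr (real p / 2)))"
    by (rule summable_mult)
  moreover have "(D / sqrt (real (Suc k))) ^ p = D ^ p * (1 / real (Suc k) powr (real p / 2))" for k
    by (simp add: power_divide powr_half_sqrt[symmetric] powr_powr flip: powr_realpow)
  ultimately show ?thesis by simp
qed

lemma weierstrass_factor_two_eq: "weierstrass_factor 2 (b * z) = weierstrass_factor 1 (b * z) * exp (z\<^sup>2 / 2 * b\<^sup>2)"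
  by (simp add: weierstrass_factor_one[unfolded One_nat_def] weierstrass_factor_two power_mult_distrib mult_ac flip: exp_add)

text \<open>The return to genus 1 once the limiting squares are known to be summable: their sum
  leaves the product as the exponent of a Gaussian.\<close>

lemma prodinf_weierstrass_two_eq:
  fixes b :: "nat \<Rightarrow> complex"
  assumes "summable (\<lambda>k. (norm (b k))\<^sup>2)" "convergent_prod (\<lambda>k. weierstrass_factor 2 (b k * z))"
  shows "(\<Prod>k. weierstrass_factor 2 (b k * z)) = exp (z\<^sup>2 / 2 * (\<Sum>k. (b k)\<^sup>2)) * (\<Prod>k. weierstrass_factor 1 (b k * z))"
proof -
  have "summable (\<lambda>k. (b k)\<^sup>2)"
    by (rule summable_norm_cancel) (use assms(1) in \<open>simp add: norm_power\<close>)
  then have S: "(\<lambda>N. \<Sum>k<N. (b k)\<^sup>2) \<longlonglongrightarrow> (\<Sum>k. (b k)\<^sup>2)"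
    by (rule summable_LIMSEQ)
  have "summable (\<lambda>k. norm (b k * z) ^ Suc 1)"
    using summable_mult2[OF assms(1), of "(norm z)\<^sup>2"] by (simp add: norm_mult power_mult_distrib numeral_2_eq_2 mult_ac)
  then have "convergent_prod (\<lambda>k. weierstrass_factor 1 (b k * z))"
    by (rule convergent_prod_weierstrass)
  then have P1: "(\<lambda>N. \<Prod>k<N. weierstrass_factor 1 (b k * z)) \<longlonglongrightarrow> (\<Prod>k. weierstrass_factor 1 (b k * z))"
    using convergent_prod_has_prod_iff has_prod_imp_tendsto' by blast
  have P2: "(\<lambda>N. \<Prod>k<N. weierstrass_factor 2 (b k * z)) \<longlonglongrightarrow> (\<Prod>k. weierstrass_factor 2 (b k * z))"
    using assms(2) convergent_prod_has_prod_iff has_prod_imp_tendsto' by blast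
  have "(\<Prod>k<N. weierstrass_factor 2 (b k * z)) = exp (z\<^sup>2 / 2 * (\<Sum>k<N. (b k)\<^sup>2)) * (\<Prod>k<N. weierstrass_factor 1 (b k * z))" for N
    by (simp only: weierstrass_factor_two_eq prod.distrib) (simp add: sum_distrib_left exp_sum mult.commute)
  then have "(\<lambda>N. \<Prod>k<N. weierstrass_factor 2 (b k * z)) \<longlonglongrightarrow> exp (z\<^sup>2 / 2 * (\<Sum>k. (b k)\<^sup>2)) * (\<Prod>k. weierstrass_factor 1 (b k * z))"
    by (simp only:) (intro tendsto_intros S P1)
  with P2 show ?thesis by (rule LIMSEQ_unique)
qed

text \<open>From Im (1/b) = - Im b / |b|^2 follows |Im b| <= r |b|^2: reciprocals of points in a
  strip are nearly real when small. So Im (b^2) is of cubic size and the negative part of Re (b^2)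
  of quartic size, and both have summable majorants.\<close>

lemma Re_Im_square_bounds:
  assumes "b \<noteq> 0 \<Longrightarrow> \<bar>Im (1 / b)\<bar> \<le> r"
  shows "Re (b\<^sup>2) + 2 * r\<^sup>2 * norm b ^ 4 \<ge> 0" "\<bar>Im (b\<^sup>2)\<bar> \<le> 2 * r * norm b ^ 3"
proof -
  have "\<bar>Im b\<bar> \<le> r * (norm b)\<^sup>2"
  proof (cases "b = 0")
    case False
    have "Im (1 / b) = - Im b / (norm b)\<^sup>2"
      by (simp add: Im_divide cmod_power2)
    with assms[OF False] show ?thesis using False by (simp add: abs_divide field_simps)
  qed simp
  then have "(Im b)\<^sup>2 \<le> (r * (norm b)\<^sup>2)\<^sup>2"
    by (simp add: abs_le_square_iff[symmetric])
  then have "(Im b)\<^sup>2 \<le> r\<^sup>2 * norm b ^ 4"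
    by (simp add: power_mult_distrib flip: power_mult)
  moreover have "Re (b\<^sup>2) = (Re b)\<^sup>2 - (Im b)\<^sup>2" by (simp add: power2_eq_square)
  moreover have "r\<^sup>2 * norm b ^ 4 \<ge> 0" by simp
  ultimately show "Re (b\<^sup>2) + 2 * r\<^sup>2 * norm b ^ 4 \<ge> 0"
    using zero_le_power2[of "Re b"] by linarith
  have "\<bar>Im (b\<^sup>2)\<bar> = 2 * (\<bar>Re b\<bar> * \<bar>Im b\<bar>)" by (simp add: power2_eq_square abs_mult)
  also have "\<bar>Re b\<bar> * \<bar>Im b\<bar> \<le> norm b * (r * (norm b)\<^sup>2)"
    using \<open>\<bar>Im b\<bar> \<le> _\<close> by (intro mult_mono abs_Re_le_cmod) auto
  finally show "\<bar>Im (b\<^sup>2)\<bar> \<le> 2 * r * norm b ^ 3" by (simp add: power3_eq_cube power2_eq_square mult_ac)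
qed

lemma tendsto_suminf_dominated:
  fixes f :: "nat \<Rightarrow> nat \<Rightarrow> 'a::{real_normed_algebra, banach}"
  assumes "\<And>k. (\<lambda>n. f n k) \<longlonglongrightarrow> g k" "\<And>n k. norm (f n k) \<le> M k" "summable M"
  shows "(\<lambda>n. \<Sum>k. f n k) \<longlonglongrightarrow> (\<Sum>k. g k)"
proof -
  have "eventually (\<lambda>(k, n). norm (f n k) \<le> M k) (sequentially \<times>\<^sub>F sequentially)"
    by (rule always_eventually) (use assms(2) in auto)
  from tannerys_theorem[where a = "\<lambda>k n. f n k" and F = sequentially, OF assms(1) this assms(3)] show ?thesis by simp
qed

text \<open>
  The second-order sums only satisfy a Fatou inequality in the limit; its defect is the coefficient of the Gaussian factor.
\<close>
lemma sum_squares_limit: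
  fixes \<beta> :: "nat \<Rightarrow> nat \<Rightarrow> complex"
  assumes lim: "\<And>k. (\<lambda>n. \<beta> n k) \<longlonglongrightarrow> b k"
    and bound: "\<And>n k. norm (\<beta> n k) \<le> D / sqrt (real (Suc k))"
    and zero: "\<And>n k. k \<ge> d n \<Longrightarrow> \<beta> n k = 0"
    and sumsq: "\<And>n. (\<Sum>k<d n. (norm (\<beta> n k))\<^sup>2) \<le> C"
    and strip: "\<And>n k. \<beta> n k \<noteq> 0 \<Longrightarrow> \<bar>Im (1 / \<beta> n k)\<bar> \<le> r"
    and real: "\<And>n. (\<Sum>k<d n. (\<beta> n k)\<^sup>2) \<in> \<real>"
    and s: "(\<lambda>n. Re (\<Sum>k<d n. (\<beta> n k)\<^sup>2)) \<longlonglongrightarrow> s" and r: "r \<ge> 0"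
  shows "summable (\<lambda>k. (norm (b k))\<^sup>2)" "(\<Sum>k. (b k)\<^sup>2) \<in> \<real>" "Re (\<Sum>k. (b k)\<^sup>2) \<le> s"
proof -
  have D: "0 \<le> D"
    using order_trans[OF norm_ge_zero bound[of 0 0]] by simp
  have powbound: "norm (\<beta> n k) ^ p \<le> (D / sqrt (real (Suc k))) ^ p" for n k p
    by (intro power_mono bound) auto
  have upto: "(\<Sum>k. h (\<beta> n k)) = (\<Sum>k<d n. h (\<beta> n k))" if "h 0 = 0" for h :: "complex \<Rightarrow> 'b::real_normed_vector" and n
    by (rule suminf_finite) (use that zero in \<open>auto simp: not_less\<close>)
  show sq: "summable (\<lambda>k. (norm (b k))\<^sup>2)"
  proof (rule summableI_nonneg_bounded)
    show "(\<Sum>k<N. (norm (b k))\<^sup>2) \<le> C" for N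
    proof (rule LIMSEQ_le_const2)
      show "(\<lambda>n. \<Sum>k<N. (norm (\<beta> n k))\<^sup>2) \<longlonglongrightarrow> (\<Sum>k<N. (norm (b k))\<^sup>2)"
        by (intro tendsto_intros lim)
      have "(\<Sum>k<N. (norm (\<beta> n k))\<^sup>2) \<le> (\<Sum>k<d n. (norm (\<beta> n k))\<^sup>2)" for n
      proof -
        have "(\<Sum>k<N. (norm (\<beta> n k))\<^sup>2) = (\<Sum>k\<in>{..<N} \<inter> {..<d n}. (norm (\<beta> n k))\<^sup>2)"
          by (intro sum.mono_neutral_right) (auto, metis linorder_not_less zero)
        also have "\<dots> \<le> (\<Sum>k<d n. (norm (\<beta> n k))\<^sup>2)"
          by (intro sum_mono2) auto
        finally show ?thesis .
      qed
      then show "\<exists>N'. \<forall>n\<ge>N'. (\<Sum>k<N. (norm (\<beta> n k))\<^sup>2) \<le> C"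
        using sumsq order_trans by blast
    qed
  qed simp
  have sb: "summable (\<lambda>k. (b k)\<^sup>2)"
    by (rule summable_norm_cancel) (use sq in \<open>simp add: norm_power\<close>)
  have bb: "norm (b k) \<le> D / sqrt (real (Suc k))" for k
    by (rule LIMSEQ_le_const2[OF tendsto_norm[OF lim]]) (use bound in auto)

  \<comment> \<open>The cubic bound dominates the imaginary parts, so their sums converge without
    loss; they vanish for each \<open>n\<close>, hence also in the limit.\<close>
  have "(\<lambda>n. \<Sum>k. Im ((\<beta> n k)\<^sup>2)) \<longlonglongrightarrow> (\<Sum>k. Im ((b k)\<^sup>2))"
  proof (rule tendsto_suminf_dominated)
    show "(\<lambda>n. Im ((\<beta> n k)\<^sup>2)) \<longlonglongrightarrow> Im ((b k)\<^sup>2)" for k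
      by (intro tendsto_intros lim)
    show "norm (Im ((\<beta> n k)\<^sup>2)) \<le> 2 * r * (D / sqrt (real (Suc k))) ^ 3" for n k
    proof -
      have "norm (Im ((\<beta> n k)\<^sup>2)) \<le> 2 * r * norm (\<beta> n k) ^ 3"
        using Re_Im_square_bounds(2)[of "\<beta> n k" r] strip by simp
      also have "\<dots> \<le> 2 * r * (D / sqrt (real (Suc k))) ^ 3"
        using r by (intro mult_left_mono powbound) auto
      finally show ?thesis .
    qed
    show "summable (\<lambda>k. 2 * r * (D / sqrt (real (Suc k))) ^ 3)"
      by (intro summable_mult summable_bound_power) simp
  qed
  moreover have "(\<Sum>k. Im ((\<beta> n k)\<^sup>2)) = 0" for n
    using upto[of "\<lambda>x. Im (x\<^sup>2)" n] real[of n] by (simp add: complex_is_Real_iff)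
  ultimately have "(\<Sum>k. Im ((b k)\<^sup>2)) = 0"
    using LIMSEQ_unique[OF _ tendsto_const] by (metis (no_types, lifting) ext)
  then show "(\<Sum>k. (b k)\<^sup>2) \<in> \<real>"
    by (simp add: complex_is_Real_iff Im_suminf[OF sb])

  have q4: "(\<lambda>n. \<Sum>k. norm (\<beta> n k) ^ 4) \<longlonglongrightarrow> (\<Sum>k. norm (b k) ^ 4)"
  proof (rule tendsto_suminf_dominated)
    show "(\<lambda>n. norm (\<beta> n k) ^ 4) \<longlonglongrightarrow> norm (b k) ^ 4" for k
      by (intro tendsto_intros lim)
    show "norm (norm (\<beta> n k) ^ 4) \<le> (D / sqrt (real (Suc k))) ^ 4" for n k
      using powbound by simp
    show "summable (\<lambda>k. (D / sqrt (real (Suc k))) ^ 4)"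
      by (rule summable_bound_power) simp
  qed
  have s4: "summable (\<lambda>k. norm (b k) ^ 4)"
  proof (rule summable_comparison_test'[OF summable_bound_power[of 4 D]])
    show "norm (norm (b k) ^ 4) \<le> (D / sqrt (real (Suc k))) ^ 4" for k
      using power_mono[OF bb norm_ge_zero, of k 4] by simp
  qed simp
  \<comment> \<open>Fatou's inequality needs nonnegative terms, and the quartic summand supplies
    them. The quartic sums themselves converge, so the correction cancels on both sides.\<close>
  define h where "h = (\<lambda>x::complex. Re (x\<^sup>2) + 2 * r\<^sup>2 * norm x ^ 4)"
  have h0: "h 0 = 0" by (simp add: h_def)
  have hnn: "h (\<beta> n k) \<ge> 0" for n k
    unfolding h_def using Re_Im_square_bounds(1)[of "\<beta> n k" r] strip by simp
  have Re_s: "summable (\<lambda>k. Re ((b k)\<^sup>2))"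
    by (rule summable_Re[OF sb])
  have "(\<Sum>k. h (b k)) \<le> s + 2 * r\<^sup>2 * (\<Sum>k. norm (b k) ^ 4)"
  proof (rule LIMSEQ_le_const2)
    have "summable (\<lambda>k. h (b k))"
      unfolding h_def by (intro summable_add Re_s summable_mult s4)
    then show "(\<lambda>K. \<Sum>k<K. h (b k)) \<longlonglongrightarrow> (\<Sum>k. h (b k))"
      by (rule summable_LIMSEQ)
    have "(\<Sum>k<K. h (b k)) \<le> s + 2 * r\<^sup>2 * (\<Sum>k. norm (b k) ^ 4)" for K
    proof (rule LIMSEQ_le)
      show "(\<lambda>n. \<Sum>k<K. h (\<beta> n k)) \<longlonglongrightarrow> (\<Sum>k<K. h (b k))"
        unfolding h_def by (intro tendsto_intros lim)
      show "(\<lambda>n. Re (\<Sum>k<d n. (\<beta> n k)\<^sup>2) + 2 * r\<^sup>2 * (\<Sum>k. norm (\<beta> n k) ^ 4)) \<longlonglongrightarrow>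
          s + 2 * r\<^sup>2 * (\<Sum>k. norm (b k) ^ 4)"
        by (intro tendsto_intros s q4)
      have "(\<Sum>k<K. h (\<beta> n k)) \<le> Re (\<Sum>k<d n. (\<beta> n k)\<^sup>2) + 2 * r\<^sup>2 * (\<Sum>k. norm (\<beta> n k) ^ 4)" for n
      proof -
        have "(\<Sum>k<K. h (\<beta> n k)) = (\<Sum>k\<in>{..<K} \<inter> {..<d n}. h (\<beta> n k))"
          by (intro sum.mono_neutral_right) (auto, metis h0 linorder_not_less zero)
        also have "\<dots> \<le> (\<Sum>k<d n. h (\<beta> n k))"
          by (intro sum_mono2) (auto simp: hnn)
        also have "\<dots> = Re (\<Sum>k<d n. (\<beta> n k)\<^sup>2) + 2 * r\<^sup>2 * (\<Sum>k<d n. norm (\<beta> n k) ^ 4)"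
          by (simp add: h_def sum.distrib sum_distrib_left)
        also have "(\<Sum>k<d n. norm (\<beta> n k) ^ 4) = (\<Sum>k. norm (\<beta> n k) ^ 4)"
          by (rule upto[symmetric]) simp
        finally show ?thesis .
      qed
      then show "\<exists>N. \<forall>n\<ge>N. (\<Sum>k<K. h (\<beta> n k)) \<le> Re (\<Sum>k<d n. (\<beta> n k)\<^sup>2) + 2 * r\<^sup>2 * (\<Sum>k. norm (\<beta> n k) ^ 4)"
        by blast
    qed
    then show "\<exists>N. \<forall>K\<ge>N. (\<Sum>k<K. h (b k)) \<le> s + 2 * r\<^sup>2 * (\<Sum>k. norm (b k) ^ 4)" by blast
  qed
  moreover have "(\<Sum>k. h (b k)) = (\<Sum>k. Re ((b k)\<^sup>2)) + 2 * r\<^sup>2 * (\<Sum>k. norm (b k) ^ 4)"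
    unfolding h_def using Re_s s4 by (subst suminf_add[symmetric]) (auto intro: summable_mult simp: suminf_mult)
  ultimately show "Re (\<Sum>k. (b k)\<^sup>2) \<le> s"
    by (simp add: Re_suminf[OF sb])
qed

text \<open>\<open>q n\<close> collects the zeros tending to 0, and \<beta> the reciprocals of the
  others. Passing to genus 2 factors costs the exponentials of the power sums \<open>a n\<close> and
  \<open>t n\<close>. All pieces but \<open>c n\<close> and \<open>a n\<close> converge, so c n exp
  (- a n z) converges wherever the limit of the other pieces is nonzero, and two such points
  determine both limits.\<close>

lemma LP_of_limit_products:
  fixes \<beta> :: "nat \<Rightarrow> nat \<Rightarrow> complex" and q :: "nat \<Rightarrow> complex \<Rightarrow> complex" and c :: "nat \<Rightarrow> complex"
  assumes F: "real_entire F" "F z0 \<noteq> 0"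
    and conv: "\<And>z. (\<lambda>n. q n z * (c n * (\<Prod>k<d n. 1 - \<beta> n k * z))) \<longlonglongrightarrow> F z"
    and q: "\<And>z. (\<lambda>n. q n z) \<longlonglongrightarrow> z ^ m"
    and c: "\<And>n. c n \<in> \<real>"
    and lim: "\<And>k. (\<lambda>n. \<beta> n k) \<longlonglongrightarrow> b k"
    and bound: "\<And>n k. norm (\<beta> n k) \<le> D / sqrt (real (Suc k))"
    and zero: "\<And>n k. k \<ge> d n \<Longrightarrow> \<beta> n k = 0"
    and sumsq: "\<And>n. (\<Sum>k<d n. (norm (\<beta> n k))\<^sup>2) \<le> C"
    and strip: "\<And>n k. \<beta> n k \<noteq> 0 \<Longrightarrow> \<bar>Im (1 / \<beta> n k)\<bar> \<le> r"
    and real1: "\<And>n. (\<Sum>k<d n. \<beta> n k) \<in> \<real>"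
    and real2: "\<And>n. (\<Sum>k<d n. (\<beta> n k)\<^sup>2) \<in> \<real>"
    and s: "(\<lambda>n. Re (\<Sum>k<d n. (\<beta> n k)\<^sup>2)) \<longlonglongrightarrow> s"
    and r: "r \<ge> 0"
  shows "F \<in> LP r"
proof -
  have D: "0 \<le> D"
    using order_trans[OF norm_ge_zero bound[of 0 0]] by simp
  have BD: "D / sqrt (real (Suc k)) \<le> D" for k
  proof -
    have "1 \<le> sqrt (real (Suc k))" by simp
    then show ?thesis using D by (simp add: divide_le_eq mult_le_cancel_left1)
  qed
  have bb: "norm (b k) \<le> D / sqrt (real (Suc k))" for k
    by (rule LIMSEQ_le_const2[OF tendsto_norm[OF lim]]) (use bound in auto)
  define a where "a = (\<lambda>n. Re (\<Sum>k<d n. \<beta> n k))"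
  define t where "t = (\<lambda>n. Re (\<Sum>k<d n. (\<beta> n k)\<^sup>2))"
  have a: "(\<Sum>k<d n. \<beta> n k) = of_real (a n)" and t: "(\<Sum>k<d n. (\<beta> n k)\<^sup>2) = of_real (t n)" for n
    using real1[of n] real2[of n] by (auto simp: a_def t_def complex_eq_iff complex_is_Real_iff)
  have tlim: "t \<longlonglongrightarrow> s" using s by (simp add: t_def)
  define V where "V = (\<lambda>z. \<Prod>k. weierstrass_factor 2 (b k * z))"
  define W where "W = (\<lambda>n z. \<Prod>k. weierstrass_factor 2 (\<beta> n k * z))"
  have conv_prod: "convergent_prod (\<lambda>k. weierstrass_factor 2 (b k * z))" for z
  proof (rule convergent_prod_weierstrass, rule summable_comparison_test')
    show "summable (\<lambda>k. (D * norm z / sqrt (real (Suc k))) ^ 3)"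
      by (rule summable_bound_power) simp
    show "norm (norm (b k * z) ^ Suc 2) \<le> (D * norm z / sqrt (real (Suc k))) ^ 3" if "k \<ge> 0" for k
    proof -
      have "norm (b k * z) \<le> D * norm z / sqrt (real (Suc k))"
        using mult_right_mono[OF bb[of k] norm_ge_zero[of z]] by (simp add: norm_mult)
      then have "norm (b k * z) ^ 3 \<le> (D * norm z / sqrt (real (Suc k))) ^ 3"
        by (rule power_mono) simp
      then show ?thesis by (simp add: eval_nat_numeral)
    qed
  qed
  have W: "(\<lambda>n. W n z) \<longlonglongrightarrow> V z" for z
    unfolding W_def V_def
  proof (rule prodinf_weierstrass_tendsto)
    show "(\<lambda>n. \<beta> n k * z) \<longlonglongrightarrow> b k * z" for k by (intro tendsto_intros lim)
    show "norm (\<beta> n k * z) \<le> D * norm z / sqrt (real (Suc k))" for n k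
      using mult_right_mono[OF bound[of n k] norm_ge_zero[of z]] by (simp add: norm_mult)
    have "summable (\<lambda>k. (D * norm z / sqrt (real (Suc k))) ^ 3)"
      by (rule summable_bound_power) simp
    then show "summable (\<lambda>k. (D * norm z / sqrt (real (Suc k))) ^ Suc 2)"
      by (simp add: eval_nat_numeral)
    show "D * norm z / sqrt (real (Suc k)) \<le> D * norm z" for k
      using mult_right_mono[OF BD[of k] norm_ge_zero[of z]] by simp
  qed
  have Weq: "W n z = (\<Prod>k<d n. 1 - \<beta> n k * z) * exp (of_real (a n) * z + of_real (t n) * z\<^sup>2 / 2)" for n z
  proof -
    have "W n z = (\<Prod>k<d n. weierstrass_factor 2 (\<beta> n k * z))"
      unfolding W_def by (rule prodinf_finite) (auto simp: zero not_less)
    also have "\<dots> = (\<Prod>k<d n. 1 - \<beta> n k * z) * exp (\<Sum>k<d n. \<beta> n k * z + (\<beta> n k * z)\<^sup>2 / 2)"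
      by (simp add: weierstrass_factor_two prod.distrib exp_sum)
    also have "(\<Sum>k<d n. \<beta> n k * z + (\<beta> n k * z)\<^sup>2 / 2) = (\<Sum>k<d n. \<beta> n k) * z + (\<Sum>k<d n. (\<beta> n k)\<^sup>2) * z\<^sup>2 / 2"
      by (simp add: sum.distrib sum_distrib_right sum_divide_distrib power_mult_distrib)
    finally show ?thesis by (simp only: a t)
  qed
  have fact: "q n z * (c n * (\<Prod>k<d n. 1 - \<beta> n k * z))
      = q n z * W n z * exp (- of_real (t n) * z\<^sup>2 / 2) * (c n * exp (- of_real (a n) * z))" for n z
  proof -
    have "exp (of_real (a n) * z + of_real (t n) * z\<^sup>2 / 2) * (exp (- of_real (t n) * z\<^sup>2 / 2) * exp (- of_real (a n) * z)) = 1"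
      by (simp flip: exp_add)
    then show ?thesis by (simp add: Weq mult_ac)
  qed
  have Vnz: "V z \<noteq> 0" if "norm z * D < 1" for z
    unfolding V_def
  proof (rule prodinf_nonzero[OF conv_prod])
    fix k
    have "norm (b k * z) \<le> D * norm z"
      using order_trans[OF bb BD, of k] by (simp add: norm_mult mult_right_mono)
    also have "\<dots> < 1" using that by (simp add: mult.commute)
    finally have "b k * z \<noteq> 1" by auto
    then show "weierstrass_factor 2 (b k * z) \<noteq> 0" by simp
  qed
  obtain e where "e > 0" and e: "\<And>z. 0 < norm z \<Longrightarrow> norm z < e \<Longrightarrow> F z \<noteq> 0"
  proof (cases "F 0 = 0")
    case True
    have hol: "F holomorphic_on UNIV" using F(1) by (simp add: real_entire_def)
    from isolated_zeros[OF hol open_UNIV connected_UNIV UNIV_I True UNIV_I F(2)]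
    obtain e where "e > 0" "\<And>z. z \<in> ball 0 e - {0} \<Longrightarrow> F z \<noteq> 0" by metis
    then show ?thesis by (intro that[of e]) auto
  next
    case False
    have "isCont F 0"
      using F(1) holomorphic_on_imp_continuous_on[of F UNIV] continuous_on_eq_continuous_at
      by (auto simp: real_entire_def)
    from continuous_at_avoid[OF this False] obtain e where "e > 0" "\<And>y. dist 0 y < e \<Longrightarrow> F y \<noteq> 0" by auto
    then show ?thesis by (intro that[of e]) auto
  qed
  \<comment> \<open>Both \<open>x\<close> and \<open>2 * x\<close> must lie in the punctured disc
    where \<open>F\<close> has no zero and in the disc |z| D < 1, where all |b k z| < 1 and so
    \<open>V\<close> has no zero.\<close>
  define x where "x = min (e / 4) (1 / (4 * (D + 1)))"
  have x: "x > 0" "2 * x < e" "2 * x * D < 1"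
  proof -
    show "x > 0" "2 * x < e" using \<open>e > 0\<close> D by (auto simp: x_def min_def)
    have "x \<le> 1 / (4 * (D + 1))" by (simp add: x_def)
    then have "x * (4 * (D + 1)) \<le> 1" using D by (simp add: field_simps)
    moreover have "x * D \<ge> 0" using D \<open>x > 0\<close> by simp
    ultimately show "2 * x * D < 1" using \<open>x > 0\<close> by (simp add: distrib_left)
  qed
  define H where "H = (\<lambda>z. F z / (z ^ m * V z * exp (- of_real s * z\<^sup>2 / 2)))"
  have ca: "(\<lambda>n. c n * exp (- of_real (a n) * z)) \<longlonglongrightarrow> H z" and Hnz: "H z \<noteq> 0"
    if "z \<noteq> 0" "norm z < e" "norm z * D < 1" for z
  proof -
    note V = Vnz[OF that(3)]
    show "H z \<noteq> 0" using V that e[of z] by (simp add: H_def)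
    define G where "G = (\<lambda>n. q n z * W n z * exp (- of_real (t n) * z\<^sup>2 / 2))"
    have G: "G \<longlonglongrightarrow> z ^ m * V z * exp (- of_real s * z\<^sup>2 / 2)"
      unfolding G_def by (intro tendsto_intros q W tlim) simp
    have Gnz: "z ^ m * V z * exp (- of_real s * z\<^sup>2 / 2) \<noteq> 0" using V that(1) by simp
    have "(\<lambda>n. G n * (c n * exp (- of_real (a n) * z))) \<longlonglongrightarrow> F z"
      using conv[of z] by (simp add: fact G_def)
    from tendsto_divide[OF this G Gnz]
    have "(\<lambda>n. G n * (c n * exp (- of_real (a n) * z)) / G n) \<longlonglongrightarrow> H z" by (simp add: H_def)
    moreover have "eventually (\<lambda>n. G n \<noteq> 0) sequentially"
      by (rule tendsto_imp_eventually_ne[OF G Gnz])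
    then have "eventually (\<lambda>n. G n * (c n * exp (- of_real (a n) * z)) / G n = c n * exp (- of_real (a n) * z)) sequentially"
      by eventually_elim simp
    ultimately show "(\<lambda>n. c n * exp (- of_real (a n) * z)) \<longlonglongrightarrow> H z"
      by (rule Lim_transform_eventually)
  qed
  have small: "norm (of_real x :: complex) < e" "norm (of_real x :: complex) * D < 1"
    "norm (of_real (2 * x) :: complex) < e" "norm (of_real (2 * x) :: complex) * D < 1"
  proof -
    have "x * D \<ge> 0" using x(1) D by simp
    then show "norm (of_real x :: complex) < e" "norm (of_real x :: complex) * D < 1"
      "norm (of_real (2 * x) :: complex) < e" "norm (of_real (2 * x) :: complex) * D < 1"
      using x by (simp_all add: norm_mult)
  qed
  have ca1: "(\<lambda>n. c n * exp (- of_real (a n) * of_real x)) \<longlonglongrightarrow> H (of_real x)" "H (of_real x) \<noteq> 0"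
    and ca2: "(\<lambda>n. c n * exp (- of_real (a n) * of_real (2 * x))) \<longlonglongrightarrow> H (of_real (2 * x))" "H (of_real (2 * x)) \<noteq> 0"
    using ca[of "of_real x"] Hnz[of "of_real x"] ca[of "of_real (2 * x)"] Hnz[of "of_real (2 * x)"] small x(1) by auto
  \<comment> \<open>The quotient of the values at \<open>2 * x\<close> and \<open>x\<close>
    eliminates \<open>c n\<close> and leaves exp (- a n x). Its limit is nonzero, so the logarithm
    yields the limit of \<open>a n\<close>.\<close>
  define A where "A = norm (H (of_real (2 * x)) / H (of_real x))"
  have "A > 0" using ca1 ca2 by (simp add: A_def)
  have "(\<lambda>n. norm (c n * exp (- of_real (a n) * of_real (2 * x)) / (c n * exp (- of_real (a n) * of_real x)))) \<longlonglongrightarrow> A"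
    unfolding A_def by (intro tendsto_intros ca1 ca2)
  moreover have "eventually (\<lambda>n. c n * exp (- of_real (a n) * of_real x) \<noteq> 0) sequentially"
    by (rule tendsto_imp_eventually_ne[OF ca1])
  then have "eventually (\<lambda>n. norm (c n * exp (- of_real (a n) * of_real (2 * x)) / (c n * exp (- of_real (a n) * of_real x)))
      = exp (- a n * x)) sequentially"
  proof eventually_elim
    case (elim n)
    have "exp (- of_real (a n) * of_real (2 * x)) = exp (- of_real (a n) * of_real x) * exp (- of_real (a n) * of_real x :: complex)"
      by (simp add: mult_ac flip: exp_add)
    then show ?case using elim by (simp add: norm_mult)
  qed
  ultimately have "(\<lambda>n. exp (- a n * x)) \<longlonglongrightarrow> A"
    by (rule Lim_transform_eventually)
  from tendsto_ln[OF this] \<open>A > 0\<close> have "(\<lambda>n. - a n * x) \<longlonglongrightarrow> ln A" by simp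
  from tendsto_mult_right[OF this, of "- 1 / x"] have alim: "a \<longlonglongrightarrow> - ln A / x"
    using x(1) by simp
  define a' where "a' = - ln A / x"
  define c' where "c' = H (of_real x) * exp (of_real a' * of_real x)"
  have "(\<lambda>n. c n * exp (- of_real (a n) * of_real x) * exp (of_real (a n) * of_real x)) \<longlonglongrightarrow> c'"
    unfolding c'_def by (intro tendsto_intros ca1) (use alim in \<open>simp add: a'_def\<close>)
  then have clim: "c \<longlonglongrightarrow> c'"
    by (simp add: mult.assoc flip: exp_add)
  then have "c' \<in> \<real>"
    by (rule closed_sequentially[OF closed_complex_Reals _, rotated]) (rule c)
  then have c': "c' = of_real (Re c')" by simp
  have Feq: "F z = z ^ m * V z * exp (- of_real s * z\<^sup>2 / 2) * (c' * exp (- of_real a' * z))" for z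
  proof (rule LIMSEQ_unique[OF conv])
    show "(\<lambda>n. q n z * (c n * (\<Prod>k<d n. 1 - \<beta> n k * z))) \<longlonglongrightarrow>
        z ^ m * V z * exp (- of_real s * z\<^sup>2 / 2) * (c' * exp (- of_real a' * z))"
      unfolding fact by (intro tendsto_intros q W tlim clim) (use alim in \<open>simp_all add: a'_def\<close>)
  qed
  note lims = sum_squares_limit[OF lim bound zero sumsq strip real2 s r]
  \<comment> \<open>The genus 2 product contributes T / 2 to the coefficient of z^2 and the exponent
    limit contributes - s / 2. Their sum is the Gaussian exponent - (s - T) / 2, of the right sign
    because T <= s.\<close>
  define T where "T = Re (\<Sum>k. (b k)\<^sup>2)"
  have T: "(\<Sum>k. (b k)\<^sup>2) = of_real T" using lims(2) by (simp add: T_def)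
  have "T \<le> s" using lims(3) by (simp add: T_def)
  have "LP_rep ((s - T) / 2) r F"
  proof (rule LP_rep_weierstrass)
    show "1 / b k \<in> strip r" if "b k \<noteq> 0" for k
    proof -
      have "(\<lambda>n. \<bar>Im (1 / \<beta> n k)\<bar>) \<longlonglongrightarrow> \<bar>Im (1 / b k)\<bar>"
        by (intro tendsto_intros lim that)
      \<comment> \<open>Indices with \<beta> n k = 0 are harmless: 1 / 0 = 0 has imaginary part 0,
        and r >= 0.\<close>
      moreover have "\<forall>n\<ge>0. \<bar>Im (1 / \<beta> n k)\<bar> \<le> r"
        using strip r by (auto, metis abs_zero div_by_0 zero_complex.simps(2))
      ultimately have "\<bar>Im (1 / b k)\<bar> \<le> r" using LIMSEQ_le_const2 by blast
      then show ?thesis using r by (simp add: strip_eq)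
    qed
    show "F z = of_real (Re c') * z ^ m * exp (of_real (- a') * z - of_real ((s - T) / 2) * z\<^sup>2) *
        (\<Prod>k. weierstrass_factor 1 (b k * z))" for z
    proof -
      have "V z = exp (z\<^sup>2 / 2 * of_real T) * (\<Prod>k. weierstrass_factor 1 (b k * z))"
        unfolding V_def T[symmetric] by (rule prodinf_weierstrass_two_eq[OF lims(1) conv_prod])
      moreover have "exp (of_real (- a') * z - of_real ((s - T) / 2) * z\<^sup>2)
          = exp (z\<^sup>2 / 2 * of_real T) * exp (- of_real s * z\<^sup>2 / 2) * exp (- of_real a' * z)"
        by (simp add: field_simps flip: exp_add)
      ultimately show ?thesis
        unfolding Feq c'[symmetric] by (simp only: mult_ac)
    qed
  qed (use F lims in auto)
  with \<open>T \<le> s\<close> show ?thesis by (auto simp: LP_def intro!: exI[of _ "(s - T) / 2"])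
qed

section \<open>Controlling the zeros of a convergent sequence of polynomials\<close>

lemma sum_mset_nonneg_real:
  fixes g :: "'a \<Rightarrow> real"
  assumes "\<And>a. a \<in># A \<Longrightarrow> g a \<ge> 0"
  shows "(\<Sum>a\<in>#A. g a) \<ge> 0"
  using assms by (induction A) auto

lemma sum_mset_le_prod_mset:
  fixes g :: "'a \<Rightarrow> real"
  assumes "\<And>a. a \<in># A \<Longrightarrow> g a \<ge> 0"
  shows "1 + (\<Sum>a\<in>#A. g a) \<le> (\<Prod>a\<in>#A. 1 + g a)"
  using assms
proof (induction A)
  case (add x A)
  have "(\<Sum>a\<in>#A. g a) \<ge> 0"
    using add.prems by (intro sum_mset_nonneg_real) auto
  then have "1 + g x + (\<Sum>a\<in>#A. g a) \<le> (1 + g x) * (1 + (\<Sum>a\<in>#A. g a))"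
    using add.prems by (simp add: algebra_simps)
  also have "\<dots> \<le> (1 + g x) * (\<Prod>a\<in>#A. 1 + g a)"
    using add by (intro mult_left_mono) auto
  finally show ?case by simp
qed simp

lemma prod_mset_mono_real:
  fixes f g :: "'a \<Rightarrow> real"
  assumes "\<And>a. a \<in># A \<Longrightarrow> 0 \<le> f a \<and> f a \<le> g a"
  shows "0 \<le> (\<Prod>a\<in>#A. f a) \<and> (\<Prod>a\<in>#A. f a) \<le> (\<Prod>a\<in>#A. g a)"
  using assms
  by (induction A) (auto intro!: mult_mono mult_nonneg_nonneg intro: order_trans)

text \<open>
  Moving up the imaginary axis above the strip, the modulus of a polynomial grows at a rate controlled by the sum below,
  so that sum is bounded by two values of the polynomial.
\<close>
lemma sum_inverse_squares_proots_le:
  assumes p: "real_strip_poly r p" and Y: "r < Y1" "Y1 < Y2" and nz: "poly p (\<i> * of_real Y1) \<noteq> 0"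
  shows "(\<Sum>a\<in>#proots p. 1 / (norm (\<i> * of_real Y1 - a))\<^sup>2)
    \<le> ((norm (poly p (\<i> * of_real Y2)) / norm (poly p (\<i> * of_real Y1)))\<^sup>2 - 1) / ((Y2 - Y1) * (Y2 + Y1 - 2 * r))"
proof -
  \<comment> \<open>For a zero with imaginary part t, the gain |i Y2 - a|^2 - |i Y1 - a|^2 equals
    (Y2 - Y1) (Y2 + Y1 - 2 t); \<kappa> is its least value, taken at t = r.\<close>
  define \<kappa> where "\<kappa> = (Y2 - Y1) * (Y2 + Y1 - 2 * r)"
  have "\<kappa> > 0" using Y by (auto simp: \<kappa>_def)
  have "p \<noteq> 0" using nz by auto
  define L where "L = (norm (lead_coeff p))\<^sup>2"
  have "L > 0" using \<open>p \<noteq> 0\<close> by (simp add: L_def)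
  have nrm: "(norm (poly p w))\<^sup>2 = L * (\<Prod>a\<in>#proots p. (norm (w - a))\<^sup>2)" for w
  proof -
    have "(norm (\<Prod>a\<in>#A. w - a))\<^sup>2 = (\<Prod>a\<in>#A. (norm (w - a))\<^sup>2)" for A
      by (induction A) (auto simp: norm_mult power_mult_distrib)
    then show ?thesis by (subst poly_proots_decompose) (simp add: norm_mult power_mult_distrib L_def)
  qed
  have strip: "\<bar>Im a\<bar> \<le> r" if "a \<in># proots p" for a
    using that p \<open>p \<noteq> 0\<close> by (auto simp: real_strip_poly_def)
  define N where "N = (\<lambda>a. (norm (\<i> * of_real Y1 - a))\<^sup>2)"
  have Npos: "N a > 0" if "a \<in># proots p" for a
    using strip[OF that] Y by (auto simp: N_def complex_eq_iff)
  have "N a * (1 + \<kappa> * (1 / N a)) \<le> (norm (\<i> * of_real Y2 - a))\<^sup>2" if "a \<in># proots p" for a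
  proof -
    have "N a * (1 + \<kappa> * (1 / N a)) = N a + \<kappa>" using Npos[OF that] by (simp add: field_simps)
    also have "\<dots> \<le> (norm (\<i> * of_real Y2 - a))\<^sup>2"
    proof -
      have "(norm (\<i> * of_real Y2 - a))\<^sup>2 - N a - \<kappa> = 2 * (Y2 - Y1) * (r - Im a)"
        unfolding N_def \<kappa>_def cmod_power2 by (simp add: power2_eq_square algebra_simps)
      moreover have "2 * (Y2 - Y1) * (r - Im a) \<ge> 0" using strip[OF that] Y by auto
      ultimately show ?thesis by linarith
    qed
    finally show ?thesis .
  qed
  then have "(\<Prod>a\<in>#proots p. N a * (1 + \<kappa> * (1 / N a))) \<le> (\<Prod>a\<in>#proots p. (norm (\<i> * of_real Y2 - a))\<^sup>2)"
  proof (intro prod_mset_mono_real[THEN conjunct2] conjI)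
    show "0 \<le> N a * (1 + \<kappa> * (1 / N a))" if "a \<in># proots p" for a
      using Npos[OF that] \<open>\<kappa> > 0\<close> by (simp add: distrib_left)
  qed
  then have "(\<Prod>a\<in>#proots p. N a) * (\<Prod>a\<in>#proots p. 1 + \<kappa> * (1 / N a)) \<le> (\<Prod>a\<in>#proots p. (norm (\<i> * of_real Y2 - a))\<^sup>2)"
    by (simp add: prod_mset.distrib)
  moreover have "1 + \<kappa> * (\<Sum>a\<in>#proots p. 1 / N a) \<le> (\<Prod>a\<in>#proots p. 1 + \<kappa> * (1 / N a))"
    using sum_mset_le_prod_mset[of "proots p" "\<lambda>a. \<kappa> * (1 / N a)"] Npos \<open>\<kappa> > 0\<close>
    by (auto simp: sum_mset_distrib_left less_imp_le)
  moreover have "(\<Prod>a\<in>#proots p. N a) \<ge> 0"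
    using prod_mset_mono_real[of "proots p" N N] Npos by (auto simp: less_imp_le)
  ultimately have "(\<Prod>a\<in>#proots p. N a) * (1 + \<kappa> * (\<Sum>a\<in>#proots p. 1 / N a)) \<le> (\<Prod>a\<in>#proots p. (norm (\<i> * of_real Y2 - a))\<^sup>2)"
    by (meson mult_left_mono order_trans)
  then have "(norm (poly p (\<i> * of_real Y1)))\<^sup>2 * (1 + \<kappa> * (\<Sum>a\<in>#proots p. 1 / N a)) \<le> (norm (poly p (\<i> * of_real Y2)))\<^sup>2"
    unfolding nrm using \<open>L > 0\<close> by (simp add: N_def mult.assoc)
  then have "1 + \<kappa> * (\<Sum>a\<in>#proots p. 1 / N a) \<le> (norm (poly p (\<i> * of_real Y2)) / norm (poly p (\<i> * of_real Y1)))\<^sup>2"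
    using nz by (simp add: power_divide pos_le_divide_eq mult.commute)
  then show ?thesis
    unfolding \<kappa>_def[symmetric] using \<open>\<kappa> > 0\<close> by (simp add: pos_le_divide_eq N_def mult.commute[of _ \<kappa>])
qed

lemma sum_mset_eq_sum_nth: "(\<Sum>a\<in>#mset xs. g a) = (\<Sum>k<length xs. g (xs ! k))"
  for g :: "'a \<Rightarrow> 'b::comm_monoid_add"
  by (induction xs rule: rev_induct) (simp_all add: nth_append add.commute cong: sum.cong_simp)

lemma prod_mset_eq_prod_nth: "(\<Prod>a\<in>#mset xs. g a) = (\<Prod>k<length xs. g (xs ! k))"
  for g :: "'a \<Rightarrow> 'b::comm_monoid_mult"
  by (induction xs rule: rev_induct) (simp_all add: nth_append mult.commute cong: prod.cong_simp)

lemma sum_mset_cnj_real: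
  assumes "image_mset cnj A = A" "\<And>a. h (cnj a) = cnj (h a)"
  shows "(\<Sum>a\<in>#A. h a) \<in> \<real>"
proof -
  have "cnj (\<Sum>a\<in>#B. h a) = (\<Sum>a\<in>#image_mset cnj B. h a)" for B
    by (induction B) (auto simp: assms(2))
  with assms(1) show ?thesis by (metis Reals_cnj_iff)
qed

lemma prod_mset_cnj_real:
  assumes "image_mset cnj A = A" "\<And>a. h (cnj a) = cnj (h a)"
  shows "(\<Prod>a\<in>#A. h a) \<in> \<real>"
proof -
  have "cnj (\<Prod>a\<in>#B. h a) = (\<Prod>a\<in>#image_mset cnj B. h a)" for B
    by (induction B) (auto simp: assms(2))
  with assms(1) show ?thesis by (metis Reals_cnj_iff)
qed

text \<open>
  Listing the elements in order of decreasing \<open>g\<close> turns a bound on the sum of squares into a bound on each term.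
\<close>
lemma sorted_enumeration:
  fixes g :: "'a \<Rightarrow> real"
  assumes "(\<Sum>a\<in>#A. (g a)\<^sup>2) \<le> C" "\<And>a. a \<in># A \<Longrightarrow> g a \<ge> 0"
  obtains xs where "mset xs = A" "\<And>k. k < length xs \<Longrightarrow> g (xs ! k) \<le> sqrt C / sqrt (real (Suc k))"
proof -
  obtain ys where "mset ys = A" using ex_mset by blast
  define xs where "xs = sort_key (\<lambda>a. - g a) ys"
  have xs: "mset xs = A" by (simp add: xs_def \<open>mset ys = A\<close>)
  have sorted: "sorted (map (\<lambda>a. - g a) xs)" by (simp add: xs_def)
  show ?thesis
  proof (rule that[OF xs])
    fix k assume k: "k < length xs"
    have g0: "g (xs ! j) \<ge> 0" if "j < length xs" for j
      using that xs assms(2) by (metis nth_mem_mset)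
    have "g (xs ! k) \<le> g (xs ! j)" if "j \<le> k" for j
      using sorted_nth_mono[OF sorted that] k that by simp
    then have "(\<Sum>j<Suc k. (g (xs ! k))\<^sup>2) \<le> (\<Sum>j<Suc k. (g (xs ! j))\<^sup>2)"
      using g0[OF k] by (intro sum_mono power_mono) auto
    also have "\<dots> \<le> (\<Sum>j<length xs. (g (xs ! j))\<^sup>2)"
      using k by (intro sum_mono2) auto
    also have "\<dots> \<le> C" using assms(1) by (simp add: sum_mset_eq_sum_nth flip: xs)
    finally have "(g (xs ! k))\<^sup>2 \<le> C / real (Suc k)"
      by (simp add: field_simps)
    then have "sqrt ((g (xs ! k))\<^sup>2) \<le> sqrt (C / real (Suc k))"
      by (rule real_sqrt_le_mono)
    then show "g (xs ! k) \<le> sqrt C / sqrt (real (Suc k))"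
      using g0[OF k] by (simp add: real_sqrt_divide)
  qed
qed

text \<open>Tychonoff's theorem instead of a diagonal argument: the product of the discs is compact,
  and a countable product of metric spaces is metrisable, so compactness is sequential.\<close>

lemma pointwise_convergent_subsequence:
  fixes u :: "nat \<Rightarrow> nat \<Rightarrow> complex"
  assumes "\<And>n k. norm (u n k) \<le> B k"
  obtains \<sigma> v where "strict_mono (\<sigma> :: nat \<Rightarrow> nat)" "\<And>k. (\<lambda>n. u (\<sigma> n) k) \<longlonglongrightarrow> v k"
proof -
  define S where "S = PiE UNIV (\<lambda>k. cball (0::complex) (B k))"
  have "compactin (product_topology (\<lambda>_. euclidean) UNIV) S"
    unfolding S_def compactin_PiE by auto
  then have "compact S"
    by (simp add: euclidean_product_topology)
  moreover have "\<forall>n. u n \<in> S" using assms by (auto simp: S_def)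
  ultimately obtain v \<sigma> where \<sigma>: "strict_mono (\<sigma> :: nat \<Rightarrow> nat)" "(u \<circ> \<sigma>) \<longlonglongrightarrow> v"
    unfolding compact_eq_seq_compact_metric seq_compact_def by metis
  show ?thesis
  proof (rule that[OF \<sigma>(1)])
    fix k
    have "isCont (\<lambda>f :: nat \<Rightarrow> complex. f k) v"
      using continuous_on_product_coordinates[of k] continuous_on_eq_continuous_at by blast
    from isCont_tendsto_compose[OF this \<sigma>(2)] show "(\<lambda>n. u (\<sigma> n) k) \<longlonglongrightarrow> v k" by simp
  qed
qed

text \<open>The zeros are controlled as seen from i Y1, whereas the representation is centred at 0.
  The work lies in changing the centre: finitely many zeros may tend to 0 and form the factor z^m,
  and the reciprocals of all others inherit the bounds up to the constant 1 / \<delta>.\<close>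

lemma LP_closed_under_polynomial_limits:
  assumes p: "\<And>n. real_strip_poly r (p n)" and conv: "\<And>z. (\<lambda>n. poly (p n) z) \<longlonglongrightarrow> F z"
    and hol: "F holomorphic_on UNIV" and r: "r \<ge> 0"
  shows "F \<in> LP r"
proof -
  have "F x \<in> \<real>" if "x \<in> \<real>" for x
  proof (rule closed_sequentially[OF closed_complex_Reals _ conv])
    show "\<And>n. poly (p n) x \<in> \<real>"
      using p that by (metis Reals_cnj_iff real_coeffs_iff_poly_cnj real_strip_poly_def)
  qed
  with hol have F: "real_entire F" by (auto simp: real_entire_def)
  show ?thesis
  proof (cases "\<forall>z. F z = 0")
    case True
    have "LP_rep 0 r F"
      by (rule LP_rep_weierstrass[OF F, of "\<lambda>_. 0" r 0 0 0]) (use True in auto)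
    then show ?thesis by (auto simp: LP_def)
  next
    case False
    then obtain z0 where z0: "F z0 \<noteq> 0" by blast
    \<comment> \<open>\<open>F\<close> is not identically zero, so by the identity theorem it cannot
      vanish on the whole ray above the strip.\<close>
    obtain Y1 where Y1: "r < Y1" "F (\<i> * of_real Y1) \<noteq> 0"
    proof (rule ccontr)
      assume "\<not> thesis"
      with that have zero: "F (\<i> * of_real Y) = 0" if "Y > r" for Y using that by blast
      have "(\<lambda>n. \<i> * of_real (r + 1 + 1 / real (Suc n))) \<longlonglongrightarrow> \<i> * of_real (r + 1 + 0)"
        by (intro tendsto_intros LIMSEQ_Suc[OF lim_1_over_n])
      then have lp: "(\<i> * of_real (r + 1)) islimpt ((\<lambda>Y. \<i> * of_real Y) ` {r<..})"
        unfolding islimpt_sequential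
      proof (intro exI[of _ "\<lambda>n. \<i> * of_real (r + 1 + 1 / real (Suc n))"] conjI allI)
        fix n
        have "1 / real (Suc n) > 0" by simp
        then have "r + 1 + 1 / real (Suc n) > r" "r + 1 + 1 / real (Suc n) \<noteq> r + 1" by linarith+
        then show "\<i> * of_real (r + 1 + 1 / real (Suc n)) \<in> (\<lambda>Y. \<i> * of_real Y) ` {r<..} - {\<i> * of_real (r + 1)}"
          by (auto simp del: of_real_add of_real_divide)
      qed simp
      have "F z0 = 0"
        by (rule analytic_continuation[OF hol open_UNIV connected_UNIV subset_UNIV UNIV_I lp _ UNIV_I])
          (use zero in auto)
      with z0 show False by simp
    qed
    define Y2 where "Y2 = Y1 + 1"
    have Y: "r < Y1" "Y1 < Y2" using Y1 by (auto simp: Y2_def)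
    have Y1pos: "Y1 > 0" using Y r by simp
    define Q where "Q = (\<lambda>n. ((norm (poly (p n) (\<i> * of_real Y2)) / norm (poly (p n) (\<i> * of_real Y1)))\<^sup>2 - 1) / ((Y2 - Y1) * (Y2 + Y1 - 2 * r)))"
    have "Q \<longlonglongrightarrow> ((norm (F (\<i> * of_real Y2)) / norm (F (\<i> * of_real Y1)))\<^sup>2 - 1) / ((Y2 - Y1) * (Y2 + Y1 - 2 * r))"
      unfolding Q_def by (intro tendsto_intros conv) (use Y1 Y in auto)
    then have "convergent Q" by (rule convergentI)
    then have "Bseq Q" by (rule convergent_imp_Bseq)
    then obtain C where C: "C > 0" "\<And>n. norm (Q n) \<le> C" by (auto simp: Bseq_def)
    have "eventually (\<lambda>n. poly (p n) (\<i> * of_real Y1) \<noteq> 0) sequentially"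
      by (rule tendsto_imp_eventually_ne[OF conv Y1(2)])
    then obtain n0 where n0: "\<And>n. n \<ge> n0 \<Longrightarrow> poly (p n) (\<i> * of_real Y1) \<noteq> 0"
      by (auto simp: eventually_sequentially)
    define G where "G = (\<lambda>a. 1 / norm (\<i> * of_real Y1 - a))"
    have "\<exists>xs. mset xs = proots (p n) \<and> (\<forall>k<length xs. G (xs ! k) \<le> sqrt C / sqrt (real (Suc k)))
        \<and> (\<Sum>k<length xs. (G (xs ! k))\<^sup>2) \<le> C" if "n \<ge> n0" for n
    proof -
      have "(\<Sum>a\<in>#proots (p n). (G a)\<^sup>2) \<le> Q n"
        using sum_inverse_squares_proots_le[OF p Y n0[OF that]] by (simp add: G_def Q_def power_divide)
      also have "\<dots> \<le> C" using C(2)[of n] by simp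
      finally have le: "(\<Sum>a\<in>#proots (p n). (G a)\<^sup>2) \<le> C" .
      then obtain xs where xs: "mset xs = proots (p n)" "\<And>k. k < length xs \<Longrightarrow> G (xs ! k) \<le> sqrt C / sqrt (real (Suc k))"
        using sorted_enumeration[of G "proots (p n)" C] by (auto simp: G_def)
      moreover have "(\<Sum>k<length xs. (G (xs ! k))\<^sup>2) \<le> C"
        using le by (simp add: sum_mset_eq_sum_nth flip: xs(1))
      ultimately show ?thesis by blast
    qed
    then have "\<forall>n. \<exists>xs. mset xs = proots (p (n + n0)) \<and> (\<forall>k<length xs. G (xs ! k) \<le> sqrt C / sqrt (real (Suc k)))
        \<and> (\<Sum>k<length xs. (G (xs ! k))\<^sup>2) \<le> C"
      by simp
    from choice[OF this] obtain xs0 where X: "\<forall>n. mset (xs0 n) = proots (p (n + n0)) \<and>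
        (\<forall>k<length (xs0 n). G (xs0 n ! k) \<le> sqrt C / sqrt (real (Suc k))) \<and> (\<Sum>k<length (xs0 n). (G (xs0 n ! k))\<^sup>2) \<le> C"
      by (rule exE)
    note xs0 = X[THEN spec, THEN conjunct1] X[THEN spec, THEN conjunct2, THEN conjunct1, rule_format]
      X[THEN spec, THEN conjunct2, THEN conjunct2]
    \<comment> \<open>Padding by 0 beyond the degree gives all \<open>n\<close> the same index set,
      so that one subsequence can serve every index.\<close>
    define \<gamma>0 where "\<gamma>0 = (\<lambda>n k. if k < length (xs0 n) then 1 / (xs0 n ! k - \<i> * of_real Y1) else 0)"
    have \<gamma>0: "norm (\<gamma>0 n k) \<le> sqrt C / sqrt (real (Suc k))" for n k
      using xs0(2)[of k n] C by (simp add: \<gamma>0_def G_def norm_divide norm_minus_commute)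
    obtain \<sigma>1 g where \<sigma>1: "strict_mono (\<sigma>1 :: nat \<Rightarrow> nat)" and glim0: "\<And>k. (\<lambda>n. \<gamma>0 (\<sigma>1 n) k) \<longlonglongrightarrow> g k"
      by (rule pointwise_convergent_subsequence[where u = \<gamma>0, OF \<gamma>0]) (use that in blast)
    define \<gamma> where "\<gamma> = (\<lambda>n. \<gamma>0 (\<sigma>1 n))"
    define ys where "ys = (\<lambda>n. xs0 (\<sigma>1 n))"
    define P where "P = (\<lambda>n. p (\<sigma>1 n + n0))"
    define B where "B = (\<lambda>k. sqrt C / sqrt (real (Suc k)))"
    have glim: "(\<lambda>n. \<gamma> n k) \<longlonglongrightarrow> g k" for k
      using glim0 by (simp add: \<gamma>_def)
    have \<gamma>B: "norm (\<gamma> n k) \<le> B k" for n k using \<gamma>0 by (simp add: \<gamma>_def B_def)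
    have gB: "norm (g k) \<le> B k" for k
      by (rule LIMSEQ_le_const2[OF tendsto_norm[OF glim]]) (use \<gamma>B in auto)
    have ysP: "mset (ys n) = proots (P n)" for n by (simp add: ys_def P_def xs0)
    have Pnz: "P n \<noteq> 0" for n using n0[of "\<sigma>1 n + n0"] by (auto simp: P_def)
    have Pp: "real_strip_poly r (P n)" for n using p by (simp add: P_def)
    have "strict_mono (\<lambda>n. \<sigma>1 n + n0)" using \<sigma>1 by (simp add: strict_mono_def)
    from LIMSEQ_subseq_LIMSEQ[OF conv this] have Pconv: "(\<lambda>n. poly (P n) z) \<longlonglongrightarrow> F z" for z
      by (simp add: P_def o_def)
    have root: "\<bar>Im a\<bar> \<le> r" "a \<noteq> \<i> * of_real Y1" if "a \<in> set (ys n)" for a n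
    proof -
      have "poly (P n) a = 0" using that ysP[of n] Pnz[of n] by (metis set_count_proots set_mset_mset mem_Collect_eq)
      then show "\<bar>Im a\<bar> \<le> r" using Pp[of n] Pnz[of n] by (simp add: real_strip_poly_def)
      then show "a \<noteq> \<i> * of_real Y1" using Y by (auto simp: complex_eq_iff)
    qed
    have \<gamma>_eq: "\<gamma> n k = 1 / (ys n ! k - \<i> * of_real Y1)" if "k < length (ys n)" for n k
      using that by (simp add: \<gamma>_def \<gamma>0_def ys_def)
    have \<gamma>_0: "\<gamma> n k = 0" if "\<not> k < length (ys n)" for n k
      using that by (simp add: \<gamma>_def \<gamma>0_def ys_def)
    have \<gamma>sum: "(\<Sum>k<length (ys n). (norm (\<gamma> n k))\<^sup>2) \<le> C" for n
    proof -
      have "(\<Sum>k<length (ys n). (norm (\<gamma> n k))\<^sup>2) = (\<Sum>k<length (ys n). (G (ys n ! k))\<^sup>2)"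
        by (intro sum.cong) (auto simp: \<gamma>_eq G_def norm_divide norm_minus_commute)
      then show ?thesis using xs0(3)[of "\<sigma>1 n"] by (simp add: ys_def)
    qed
    \<comment> \<open>With \<gamma> = 1 / (a - i Y1), the zero is a = w / \<gamma>. So its
      reciprocal is \<gamma> / w, and the zero tends to 0 exactly when \<open>w\<close>
      does.\<close>
    define w where "w = (\<lambda>n k. 1 + \<i> * of_real Y1 * \<gamma> n k)"
    define v where "v = (\<lambda>k. 1 + \<i> * of_real Y1 * g k)"
    have wlim: "(\<lambda>n. w n k) \<longlonglongrightarrow> v k" for k
      unfolding w_def v_def by (intro tendsto_intros glim)
    have w_eq: "ys n ! k = w n k / \<gamma> n k" "\<gamma> n k \<noteq> 0" if "k < length (ys n)" for n k
    proof -
      have "ys n ! k - \<i> * of_real Y1 \<noteq> 0" using root(2)[of "ys n ! k" n] that by auto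
      then show "ys n ! k = w n k / \<gamma> n k" "\<gamma> n k \<noteq> 0"
        by (auto simp: w_def \<gamma>_eq[OF that] field_simps)
    qed
    \<comment> \<open>The positions whose zeros tend to 0. Since |\<gamma> n k| <= B k and B k tends
      to 0, \<open>w\<close> stays away from 0 for large \<open>k\<close>, so \<open>Z\<close> is
      finite; its cardinality is the multiplicity at the origin.\<close>
    define Z where "Z = {k. v k = 0}"
    have Blim: "(\<lambda>k. Y1 * B k) \<longlonglongrightarrow> 0"
    proof -
      have "(\<lambda>k. Y1 * (sqrt C * sqrt (1 / real (Suc k)))) \<longlonglongrightarrow> Y1 * (sqrt C * sqrt 0)"
        by (intro tendsto_intros LIMSEQ_Suc[OF lim_1_over_n])
      then show ?thesis by (simp add: B_def real_sqrt_divide)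
    qed
    have "eventually (\<lambda>k. Y1 * B k < 1 / 2) sequentially"
      by (rule order_tendstoD(2)[OF Blim]) simp
    then obtain K0 where K0: "\<And>k. k \<ge> K0 \<Longrightarrow> Y1 * B k < 1 / 2" by (auto simp: eventually_sequentially)
    have half: "norm (1 + \<i> * of_real Y1 * x) \<ge> 1 / 2" if "k \<ge> K0" "norm x \<le> B k" for k x
    proof -
      have "norm (\<i> * of_real Y1 * x) = Y1 * norm x" using Y1pos by (simp add: norm_mult)
      also have "\<dots> \<le> Y1 * B k" using that(2) Y1pos by simp
      finally have "norm (\<i> * of_real Y1 * x) \<le> 1 / 2" using K0[OF that(1)] by linarith
      moreover have "norm (1::complex) \<le> norm (1 + \<i> * of_real Y1 * x) + norm (\<i> * of_real Y1 * x)"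
        by (metis add_diff_cancel_right' norm_triangle_ineq4)
      ultimately show ?thesis by simp
    qed
    have Zsub: "Z \<subseteq> {..<K0}"
    proof
      fix k assume "k \<in> Z"
      then have "\<not> norm (v k) \<ge> 1 / 2" by (simp add: Z_def)
      then have "\<not> K0 \<le> k" using half[of k "g k"] gB[of k] by (auto simp: v_def)
      then show "k \<in> {..<K0}" by simp
    qed
    then have finZ: "finite Z" using finite_subset by blast
    \<comment> \<open>A common lower bound for |w| off \<open>Z\<close>: 1/2 serves all k >= K0, and
      halving the finitely many remaining limits leaves a strict inequality that holds
      eventually.\<close>
    define \<delta> where "\<delta> = Min (insert (1 / 2) ((\<lambda>k. norm (v k) / 2) ` ({..<K0} - Z)))"
    have \<delta>: "\<delta> > 0" "\<delta> \<le> 1 / 2" "\<And>k. k < K0 \<Longrightarrow> k \<notin> Z \<Longrightarrow> \<delta> < norm (v k)"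
    proof -
      show "\<delta> > 0" unfolding \<delta>_def by (subst Min_gr_iff) (auto simp: Z_def)
      show "\<delta> \<le> 1 / 2" unfolding \<delta>_def by (intro Min_le) auto
      show "\<delta> < norm (v k)" if "k < K0" "k \<notin> Z" for k
      proof -
        have "\<delta> \<le> norm (v k) / 2" unfolding \<delta>_def using that by (intro Min_le) auto
        moreover have "norm (v k) > 0" using that by (simp add: Z_def)
        ultimately show ?thesis by linarith
      qed
    qed
    \<comment> \<open>Off \<open>Z\<close> one has |a| = |w| / |\<gamma>| >= \<delta> / sqrt C,
      while zeros with index in \<open>Z\<close> eventually have smaller modulus. So membership in
      \<open>Z\<close> can be read off from the modulus of the zero alone.\<close>
    define \<eta> where "\<eta> = \<delta> / sqrt C"
    have "\<eta> > 0" using \<delta> C by (simp add: \<eta>_def)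
    have ev1: "eventually (\<lambda>n. \<forall>k\<in>{..<K0} - Z. \<delta> < norm (w n k)) sequentially"
      by (intro eventually_ball_finite ballI order_tendstoD(1)[OF tendsto_norm[OF wlim]]) (use \<delta> in auto)
    have gnz: "g k \<noteq> 0" if "k \<in> Z" for k using that by (auto simp: Z_def v_def)
    have alim: "(\<lambda>n. w n k / \<gamma> n k) \<longlonglongrightarrow> 0" if "k \<in> Z" for k
      using tendsto_divide[OF wlim[of k] glim[of k] gnz[OF that]] that by (simp add: Z_def)
    have ev2: "eventually (\<lambda>n. \<forall>k\<in>Z. norm (w n k / \<gamma> n k) < \<eta>) sequentially"
    proof (intro eventually_ball_finite finZ ballI)
      fix k assume "k \<in> Z"
      from tendsto_norm[OF alim[OF this]] show "eventually (\<lambda>n. norm (w n k / \<gamma> n k) < \<eta>) sequentially"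
        by (rule order_tendstoD(2)) (use \<open>\<eta> > 0\<close> in simp)
    qed
    have ev3: "eventually (\<lambda>n. \<forall>k\<in>Z. \<gamma> n k \<noteq> 0) sequentially"
      by (intro eventually_ball_finite finZ ballI tendsto_imp_eventually_ne[OF glim] gnz)
    from eventually_conj[OF ev1 eventually_conj[OF ev2 ev3]] obtain n1 where n1: "\<And>n. n \<ge> n1 \<Longrightarrow>
      (\<forall>k\<in>{..<K0} - Z. \<delta> < norm (w n k)) \<and> (\<forall>k\<in>Z. norm (w n k / \<gamma> n k) < \<eta>) \<and> (\<forall>k\<in>Z. \<gamma> n k \<noteq> 0)"
      by (auto simp: eventually_sequentially)
    have wge: "\<delta> \<le> norm (w n k)" if "n \<ge> n1" "k \<notin> Z" for n k
    proof (cases "k < K0")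
      case True
      with n1[OF that(1)] that(2) show ?thesis by force
    next
      case False
      with half[OF _ \<gamma>B, of k n] \<delta>(2) show ?thesis by (simp add: w_def)
    qed
    have small_iff: "norm (ys n ! k) < \<eta> \<longleftrightarrow> k \<in> Z" if "n \<ge> n1" "k < length (ys n)" for n k
    proof (cases "k \<in> Z")
      case True
      then show ?thesis using n1[OF that(1)] w_eq(1)[OF that(2)] by simp
    next
      case False
      have "B k \<le> sqrt C"
      proof -
        have "1 \<le> sqrt (real (Suc k))" by simp
        then show ?thesis using C by (simp add: B_def divide_le_eq mult_le_cancel_left1)
      qed
      then have "norm (\<gamma> n k) \<le> sqrt C" using \<gamma>B[of n k] by linarith
      then have "\<eta> * norm (\<gamma> n k) \<le> \<delta>"
        using C \<open>\<delta> > 0\<close> by (simp add: \<eta>_def divide_le_eq mult_left_mono)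
      also have "\<dots> \<le> norm (w n k)" by (rule wge[OF that(1) False])
      finally have "\<eta> \<le> norm (w n k / \<gamma> n k)"
        using w_eq(2)[OF that(2)] by (simp add: norm_divide le_divide_eq)
      then show ?thesis using False w_eq(1)[OF that(2)] by simp
    qed
    have Zlen: "k < length (ys n)" if "n \<ge> n1" "k \<in> Z" for n k
      using n1[OF that(1)] that(2) \<gamma>_0 by blast
    \<comment> \<open>The split depends on the zero and not on its position in the list. It
      therefore commutes with conjugation, which makes the power sums and the constants
      \<open>c\<close> real.\<close>
    define h where "h = (\<lambda>a::complex. if norm a < \<eta> then 0 else 1 / a)"
    define \<beta> where "\<beta> = (\<lambda>n k. if k < length (ys n) then h (ys n ! k) else 0)"
    have \<beta>_eq: "\<beta> n k = (if k \<in> Z then 0 else \<gamma> n k / w n k)" if "n \<ge> n1" for n k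
      using small_iff[OF that, of k] Zlen[OF that, of k] w_eq(1)[of k n] \<gamma>_0[of k n] by (auto simp: \<beta>_def h_def)
    have \<beta>_le: "norm (\<beta> n k) \<le> norm (\<gamma> n k) / \<delta>" if "n \<ge> n1" for n k
    proof (cases "k \<in> Z")
      case False
      then show ?thesis
        using wge[OF that False] \<delta>(1) by (simp add: \<beta>_eq[OF that] norm_divide frac_le)
    qed (use \<delta>(1) in \<open>simp add: \<beta>_eq[OF that]\<close>)
    define D where "D = sqrt C / \<delta>"
    have \<beta>D: "norm (\<beta> n k) \<le> D / sqrt (real (Suc k))" if "n \<ge> n1" for n k
    proof -
      have "norm (\<gamma> n k) / \<delta> \<le> B k / \<delta>" using \<gamma>B \<delta>(1) by (simp add: divide_right_mono)
      also have "\<dots> = D / sqrt (real (Suc k))" by (simp add: D_def B_def)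
      finally show ?thesis using \<beta>_le[OF that, of k] by linarith
    qed
    have \<beta>sum: "(\<Sum>k<length (ys n). (norm (\<beta> n k))\<^sup>2) \<le> C / \<delta>\<^sup>2" if "n \<ge> n1" for n
    proof -
      have "(\<Sum>k<length (ys n). (norm (\<beta> n k))\<^sup>2) \<le> (\<Sum>k<length (ys n). (norm (\<gamma> n k) / \<delta>)\<^sup>2)"
        by (intro sum_mono power_mono \<beta>_le[OF that]) auto
      also have "\<dots> = (\<Sum>k<length (ys n). (norm (\<gamma> n k))\<^sup>2) / \<delta>\<^sup>2"
        by (simp add: power_divide sum_divide_distrib)
      also have "\<dots> \<le> C / \<delta>\<^sup>2" by (intro divide_right_mono \<gamma>sum) simp
      finally show ?thesis .
    qed
    define b where "b = (\<lambda>k. if k \<in> Z then 0 else g k / v k)"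
    have \<beta>lim: "(\<lambda>n. \<beta> (n + n1) k) \<longlonglongrightarrow> b k" for k
    proof (cases "k \<in> Z")
      case False
      then have "(\<lambda>n. \<gamma> n k / w n k) \<longlonglongrightarrow> b k"
        unfolding b_def using False by (simp add: Z_def) (intro tendsto_intros glim wlim)
      from LIMSEQ_ignore_initial_segment[OF this, of n1] show ?thesis using False by (simp add: \<beta>_eq)
    qed (simp add: \<beta>_eq b_def)
    have conj_sym: "image_mset cnj (mset (ys n)) = mset (ys n)" for n
      using proots_cnj[of "P n"] Pp[of n] by (simp add: ysP real_strip_poly_def)
    have hcnj: "h (cnj a) = cnj (h a)" for a by (simp add: h_def)
    have \<beta>real1: "(\<Sum>k<length (ys n). \<beta> n k) \<in> \<real>" for n
      using sum_mset_cnj_real[where h = h, OF conj_sym[of n] hcnj] by (simp add: \<beta>_def sum_mset_eq_sum_nth)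
    have \<beta>real2: "(\<Sum>k<length (ys n). (\<beta> n k)\<^sup>2) \<in> \<real>" for n
      using sum_mset_cnj_real[OF conj_sym[of n], of "\<lambda>a. (h a)\<^sup>2"] by (simp add: hcnj \<beta>_def sum_mset_eq_sum_nth)
    define c where "c = (\<lambda>n. lead_coeff (P n) * (\<Prod>k<length (ys n). if norm (ys n ! k) < \<eta> then 1 else - (ys n ! k)))"
    have creal: "c n \<in> \<real>" for n
    proof -
      have "(\<Prod>k<length (ys n). if norm (ys n ! k) < \<eta> then 1 else - (ys n ! k)) \<in> \<real>"
        using prod_mset_cnj_real[OF conj_sym[of n], of "\<lambda>a. if norm a < \<eta> then 1 else - a"]
        by (simp add: prod_mset_eq_prod_nth)
      moreover have "lead_coeff (P n) \<in> \<real>" using Pp[of n] by (simp add: real_strip_poly_def)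
      ultimately show ?thesis by (simp add: c_def)
    qed
    define q where "q = (\<lambda>n z. \<Prod>k<length (ys n). if norm (ys n ! k) < \<eta> then z - ys n ! k else 1)"
    have poly_eq: "poly (P n) z = q n z * (c n * (\<Prod>k<length (ys n). 1 - \<beta> n k * z))" for n z
    proof -
      have "poly (P n) z = lead_coeff (P n) * (\<Prod>k<length (ys n). z - ys n ! k)"
        by (subst poly_proots_decompose) (simp add: prod_mset_eq_prod_nth flip: ysP)
      also have "(\<Prod>k<length (ys n). z - ys n ! k) = (\<Prod>k<length (ys n). (if norm (ys n ! k) < \<eta> then z - ys n ! k else 1) *
          ((if norm (ys n ! k) < \<eta> then 1 else - (ys n ! k)) * (1 - \<beta> n k * z)))"
      proof (intro prod.cong refl)
        fix k assume k: "k \<in> {..<length (ys n)}"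
        have "ys n ! k \<noteq> 0" if "\<not> norm (ys n ! k) < \<eta>" using that \<open>\<eta> > 0\<close> by auto
        then show "z - ys n ! k = (if norm (ys n ! k) < \<eta> then z - ys n ! k else 1) *
          ((if norm (ys n ! k) < \<eta> then 1 else - (ys n ! k)) * (1 - \<beta> n k * z))"
          using k by (auto simp: \<beta>_def h_def field_simps)
      qed
      finally show ?thesis by (simp add: prod.distrib q_def c_def mult_ac)
    qed
    have qlim: "(\<lambda>n. q (n + n1) z) \<longlonglongrightarrow> z ^ card Z" for z
    proof -
      have "q n z = (\<Prod>k\<in>Z. z - w n k / \<gamma> n k)" if "n \<ge> n1" for n
      proof -
        have "q n z = (\<Prod>k<length (ys n). if k \<in> Z then z - w n k / \<gamma> n k else 1)"
          unfolding q_def by (intro prod.cong refl) (use small_iff[OF that] w_eq(1) in auto)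
        also have "\<dots> = (\<Prod>k\<in>{..<length (ys n)} \<inter> Z. z - w n k / \<gamma> n k)"
          by (rule prod.inter_restrict[symmetric]) simp
        also have "{..<length (ys n)} \<inter> Z = Z" using Zlen[OF that] by auto
        finally show ?thesis .
      qed
      moreover have "(\<lambda>n. \<Prod>k\<in>Z. z - w (n + n1) k / \<gamma> (n + n1) k) \<longlonglongrightarrow> (\<Prod>k\<in>Z. z - 0)"
        by (intro tendsto_intros LIMSEQ_ignore_initial_segment[OF alim])
      ultimately show ?thesis by simp
    qed
    define t where "t = (\<lambda>n. Re (\<Sum>k<length (ys (n + n1)). (\<beta> (n + n1) k)\<^sup>2))"
    have "norm (t n) \<le> C / \<delta>\<^sup>2" for n
    proof -
      have "norm (t n) \<le> norm (\<Sum>k<length (ys (n + n1)). (\<beta> (n + n1) k)\<^sup>2)"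
        unfolding t_def real_norm_def by (rule abs_Re_le_cmod)
      also have "\<dots> \<le> (\<Sum>k<length (ys (n + n1)). (norm (\<beta> (n + n1) k))\<^sup>2)"
        by (rule order_trans[OF norm_sum]) (simp add: norm_power)
      finally show ?thesis using \<beta>sum[of "n + n1"] by simp
    qed
    \<comment> \<open>The sums of squares are only bounded, since mass may escape to infinity with
      the zeros; a further subsequence is needed for them to converge.\<close>
    then have "bounded (range t)" unfolding bounded_iff by blast
    from bounded_imp_convergent_subsequence[OF this]
    obtain s \<sigma>2 where \<sigma>2: "strict_mono (\<sigma>2 :: nat \<Rightarrow> nat)" "(t \<circ> \<sigma>2) \<longlonglongrightarrow> s" by auto
    note sub = LIMSEQ_subseq_LIMSEQ[OF _ \<sigma>2(1), unfolded o_def]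
    show ?thesis
    proof (rule LP_of_limit_products[OF F z0, where q = "\<lambda>n. q (\<sigma>2 n + n1)" and c = "\<lambda>n. c (\<sigma>2 n + n1)"
          and \<beta> = "\<lambda>n. \<beta> (\<sigma>2 n + n1)" and d = "\<lambda>n. length (ys (\<sigma>2 n + n1))" and m = "card Z" and b = b and D = D
          and C = "C / \<delta>\<^sup>2" and s = s])
      show "(\<lambda>n. q (\<sigma>2 n + n1) z * (c (\<sigma>2 n + n1) * (\<Prod>k<length (ys (\<sigma>2 n + n1)). 1 - \<beta> (\<sigma>2 n + n1) k * z))) \<longlonglongrightarrow> F z" for z
        using sub[OF LIMSEQ_ignore_initial_segment[OF Pconv, of n1]] by (simp add: poly_eq)
      show "(\<lambda>n. q (\<sigma>2 n + n1) z) \<longlonglongrightarrow> z ^ card Z" for z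
        by (rule sub[OF qlim])
      show "(\<lambda>n. \<beta> (\<sigma>2 n + n1) k) \<longlonglongrightarrow> b k" for k
        by (rule sub[OF \<beta>lim])
      show "\<bar>Im (1 / \<beta> (\<sigma>2 n + n1) k)\<bar> \<le> r" if "\<beta> (\<sigma>2 n + n1) k \<noteq> 0" for n k
      proof -
        have "k < length (ys (\<sigma>2 n + n1))" "1 / \<beta> (\<sigma>2 n + n1) k = ys (\<sigma>2 n + n1) ! k"
          using that by (auto simp: \<beta>_def h_def split: if_splits)
        then show ?thesis using root(1)[OF nth_mem, of k "\<sigma>2 n + n1"] by simp
      qed
      show "(\<lambda>n. Re (\<Sum>k<length (ys (\<sigma>2 n + n1)). (\<beta> (\<sigma>2 n + n1) k)\<^sup>2)) \<longlonglongrightarrow> s"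
        using \<sigma>2(2) by (simp add: t_def o_def)
    qed (use creal \<beta>D \<beta>sum \<beta>real1 \<beta>real2 r in \<open>auto simp: \<beta>_def\<close>)
  qed
qed

section \<open>Convergence of the operator series\<close>

text \<open>Dominated convergence in Cauchy's integral over the unit circle about \<open>w\<close>:
  pointwise convergence and a local bound replace locally uniform convergence.\<close>

lemma higher_deriv_tendsto_bounded:
  assumes hol: "\<And>n. f n holomorphic_on UNIV" and holg: "g holomorphic_on UNIV"
    and conv: "\<And>z. (\<lambda>n. f n z) \<longlonglongrightarrow> g z" and bound: "\<And>n z. norm (z - w) \<le> 1 \<Longrightarrow> norm (f n z) \<le> M"
  shows "(\<lambda>n. (deriv ^^ k) (f n) w) \<longlonglongrightarrow> (deriv ^^ k) g w"
proof -
  define c where "c = (\<lambda>t. circlepath w 1 t)"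
  define E where "E = (\<lambda>h t. h (c t) / (c t - w) ^ Suc k * vector_derivative (circlepath w 1) (at t))"
  have c: "norm (c t - w) = 1" for t
    by (simp add: c_def circlepath norm_mult)
  have cauchy: "E h integrable_on {0..1}" "(deriv ^^ k) h w = fact k / (2 * pi * \<i>) * integral {0..1} (E h)"
    if "h holomorphic_on UNIV" for h
  proof -
    have cont: "continuous_on (cball w 1) h" and hol: "h holomorphic_on ball w 1"
      using that by (auto intro: holomorphic_on_imp_continuous_on holomorphic_on_subset)
    have w: "w \<in> ball w 1" by simp
    note * = Cauchy_higher_derivative_integral_circlepath[OF cont hol w, of k]
    show "E h integrable_on {0..1}" using *(1) by (simp add: contour_integrable_on E_def c_def)
    show "(deriv ^^ k) h w = fact k / (2 * pi * \<i>) * integral {0..1} (E h)"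
      using *(2) by (simp add: contour_integral_integral E_def c_def)
  qed
  have "(\<lambda>n. integral {0..1} (E (f n))) \<longlonglongrightarrow> integral {0..1} (E g)"
  proof (rule dominated_convergence(2))
    show "E (f n) integrable_on {0..1}" for n by (rule cauchy[OF hol])
    show "(\<lambda>t. M * (2 * pi)) integrable_on {0..1::real}" by (rule integrable_const_ivl)
    show "norm (E (f n) t) \<le> M * (2 * pi)" for n t
    proof -
      have "norm (E (f n) t) = norm (f n (c t)) * (2 * pi)"
        using c[of t] by (simp add: E_def norm_mult norm_divide norm_power vector_derivative_circlepath)
      then show ?thesis using bound[of "c t" n] c[of t] by simp
    qed
    show "(\<lambda>n. E (f n) t) \<longlonglongrightarrow> E g t" for t
      unfolding E_def using c[of t] by (intro tendsto_intros conv) auto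
  qed
  then show ?thesis
    unfolding cauchy(2)[OF hol] cauchy(2)[OF holg] by (intro tendsto_intros)
qed

text \<open>The constant is part of the predicate, so that a whole sequence can share it. The type
  of a limit is inherited, and products of types below 1/4 make the operator series
  converge.\<close>

definition gauss_bounded :: "real \<Rightarrow> real \<Rightarrow> (complex \<Rightarrow> complex) \<Rightarrow> bool" where
  "gauss_bounded C \<beta> f \<longleftrightarrow> f holomorphic_on UNIV \<and> (\<forall>z. norm (f z) \<le> C * exp (\<beta> * (norm z)\<^sup>2))"

lemma gauss_bounded_limit:
  assumes "\<And>n. gauss_bounded C \<beta> (f n)" "\<And>z. (\<lambda>n. f n z) \<longlonglongrightarrow> g z" "g holomorphic_on UNIV"
  shows "gauss_bounded C \<beta> g"
  unfolding gauss_bounded_def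
proof (intro conjI allI assms(3))
  show "norm (g z) \<le> C * exp (\<beta> * (norm z)\<^sup>2)" for z
    by (rule LIMSEQ_le_const2[OF tendsto_norm[OF assms(2)]]) (use assms(1) in \<open>auto simp: gauss_bounded_def\<close>)
qed

lemma higher_deriv_le:
  assumes "f holomorphic_on UNIV" "R > 0" "\<And>w. norm w = R \<Longrightarrow> norm (f (z + w)) \<le> B"
  shows "norm ((deriv ^^ k) f z) \<le> fact k * B / R ^ k"
proof (rule Cauchy_inequality)
  show "norm (f x) \<le> B" if "norm (z - x) = R" for x
    using assms(3)[of "x - z"] that by (simp add: norm_minus_commute)
qed (use assms in \<open>auto intro: holomorphic_on_imp_continuous_on holomorphic_on_subset\<close>)

text \<open>A weak Stirling bound by induction, from (1 - 1/(k+1))^(k+1) <= 1/e. The factor k in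
  place of sqrt k is harmless against a geometric sequence.\<close>

lemma fact_le_exp_bound: "k > 0 \<Longrightarrow> fact k \<le> exp 1 * real k * (real k / exp 1) ^ k"
proof (induction k)
  case (Suc k)
  show ?case
  proof (cases "k = 0")
    case False
    define x where "x = real k"
    have x: "x > 0" using False by (simp add: x_def)
    have IH: "fact k \<le> exp 1 * x * (x / exp 1) ^ k" using Suc False by (simp add: x_def)
    have "(1 + (- 1) / real (Suc k)) ^ Suc k \<le> exp (- 1)"
      by (rule exp_ge_one_plus_x_over_n_power_n) auto
    moreover have "1 + (- 1) / real (Suc k) = x / (x + 1)" using x by (simp add: x_def field_simps)
    ultimately have "(x / (x + 1)) ^ Suc k * exp 1 \<le> exp (- 1) * exp 1"
      by (intro mult_right_mono) auto
    then have "x ^ Suc k * exp 1 \<le> (x + 1) ^ Suc k"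
      using x by (simp add: power_divide divide_le_eq flip: exp_add)
    then have "exp 1 * (x * x ^ k) / exp 1 ^ k \<le> (x + 1) ^ Suc k / exp 1 ^ k"
      by (intro divide_right_mono) (auto simp: mult.commute)
    then have "fact k \<le> (x + 1) ^ Suc k / exp 1 ^ k"
      using IH by (simp add: power_divide mult.assoc)
    then have "(x + 1) * fact k \<le> (x + 1) * ((x + 1) ^ Suc k / exp 1 ^ k)"
      using x by (intro mult_left_mono) auto
    also have "\<dots> = exp 1 * (x + 1) * ((x + 1) / exp 1) ^ Suc k"
      by (simp add: power_divide)
    finally show ?thesis by (simp add: x_def add.commute)
  qed simp
qed simp

text \<open>The cross term 2 \<delta> M R is at most (\<delta> M)^2 / \<epsilon> + \<epsilon> R^2
  for \<epsilon> = \<delta>' - \<delta>, so recentring at \<open>z\<close> costs an arbitrarily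
  small increase of the type.\<close>

lemma gauss_bounded_translate:
  assumes f: "gauss_bounded C \<delta> f" and "\<delta> \<ge> 0" "\<delta> < \<delta>'" "norm z \<le> M" "C \<ge> 0"
  shows "norm (f (z + w)) \<le> C * exp (\<delta> * M\<^sup>2 + (\<delta> * M)\<^sup>2 / (\<delta>' - \<delta>)) * exp (\<delta>' * (norm w)\<^sup>2)"
proof -
  define \<epsilon> where "\<epsilon> = \<delta>' - \<delta>"
  have \<epsilon>: "\<epsilon> > 0" using assms by (simp add: \<epsilon>_def)
  define R where "R = norm w"
  have "norm (z + w) \<le> M + R" using norm_triangle_ineq[of z w] assms(4) by (simp add: R_def)
  then have "(norm (z + w))\<^sup>2 \<le> (M + R)\<^sup>2" by (intro power_mono) auto
  then have "\<delta> * (norm (z + w))\<^sup>2 \<le> \<delta> * (M + R)\<^sup>2" by (rule mult_left_mono) fact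
  also have "\<dots> \<le> \<delta> * M\<^sup>2 + (\<delta> * M)\<^sup>2 / \<epsilon> + (\<delta> + \<epsilon>) * R\<^sup>2"
  proof -
    have "0 \<le> (\<delta> * M - \<epsilon> * R)\<^sup>2 / \<epsilon>" using \<epsilon> by simp
    also have "\<dots> = (\<delta> * M)\<^sup>2 / \<epsilon> - 2 * \<delta> * M * R + \<epsilon> * R\<^sup>2"
      using \<epsilon> by (simp add: power2_eq_square field_simps)
    finally show ?thesis by (simp add: power2_sum algebra_simps)
  qed
  finally have "\<delta> * (norm (z + w))\<^sup>2 \<le> \<delta> * M\<^sup>2 + (\<delta> * M)\<^sup>2 / (\<delta>' - \<delta>) + \<delta>' * (norm w)\<^sup>2"
    by (simp add: \<epsilon>_def R_def)
  then have "exp (\<delta> * (norm (z + w))\<^sup>2) \<le> exp (\<delta> * M\<^sup>2 + (\<delta> * M)\<^sup>2 / (\<delta>' - \<delta>)) * exp (\<delta>' * (norm w)\<^sup>2)"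
    by (simp flip: exp_add)
  then have "C * exp (\<delta> * (norm (z + w))\<^sup>2) \<le> C * (exp (\<delta> * M\<^sup>2 + (\<delta> * M)\<^sup>2 / (\<delta>' - \<delta>)) * exp (\<delta>' * (norm w)\<^sup>2))"
    by (rule mult_left_mono) fact
  moreover have "norm (f (z + w)) \<le> C * exp (\<delta> * (norm (z + w))\<^sup>2)"
    using f by (simp add: gauss_bounded_def)
  ultimately show ?thesis by (simp add: mult.assoc)
qed

text \<open>
  Cauchy's inequality on circles of radii \<open>sqrt (k / (2 \<beta>))\<close> and \<open>sqrt (k / (2 \<delta>'))\<close>, the minimisers of the two bounds.
\<close>
lemma op_D_term_bound:
  assumes "\<beta> > 0" "\<delta> \<ge> 0" "4 * \<beta> * \<delta> < 1" "C \<ge> 0" "C' \<ge> 0"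
  obtains B where "summable B"
    "\<And>\<phi> f z k. gauss_bounded C \<beta> \<phi> \<Longrightarrow> gauss_bounded C' \<delta> f \<Longrightarrow> norm z \<le> M \<Longrightarrow>
       norm ((deriv ^^ k) \<phi> 0 / fact k * (deriv ^^ k) f z) \<le> B k"
proof -
  have "\<delta> < 1 / (4 * \<beta>)" using assms by (simp add: field_simps)
  then obtain \<delta>' where \<delta>': "\<delta> < \<delta>'" "\<delta>' < 1 / (4 * \<beta>)" using dense by blast
  have "\<delta>' > 0" using \<delta>' assms by linarith
  \<comment> \<open>The ratio left after optimising both radii: the terms are O(k q^k) with q^2 = 4
    \<beta> \<delta>', below 1 by the choice of \<delta>'.\<close>
  define q where "q = 2 * sqrt (\<beta> * \<delta>')"
  have "4 * (\<beta> * \<delta>') < 1" using \<delta>'(2) assms(1) by (simp add: field_simps)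
  then have "sqrt (4 * (\<beta> * \<delta>')) < 1" by simp
  then have q: "q < 1" "q > 0" using \<open>\<delta>' > 0\<close> assms(1) by (auto simp: q_def real_sqrt_mult)
  define K where "K = C' * exp (\<delta> * M\<^sup>2 + (\<delta> * M)\<^sup>2 / (\<delta>' - \<delta>))"
  have K: "K \<ge> 0" using assms by (simp add: K_def)
  \<comment> \<open>The summand with 0^k is nonzero only for k = 0, where the optimal radii would be
    0 and both radii are taken to be 1.\<close>
  define B where "B = (\<lambda>k. C * exp \<beta> * (K * exp \<delta>') * (real (Suc k) * 0 ^ k) + C * K * exp 1 * (real (Suc k) * q ^ k))"
  show ?thesis
  proof (rule that[of B])
    have "summable (\<lambda>k. real (Suc k) * y ^ k)" if "norm y < 1" for y :: real
      using geometric_deriv_sums[OF that] by (simp add: sums_iff)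
    from this[of 0] this[of q] show "summable B"
      unfolding B_def using q by (intro summable_add summable_mult) auto
  next
    fix \<phi> f and z :: complex and k
    assume \<phi>: "gauss_bounded C \<beta> \<phi>" and f: "gauss_bounded C' \<delta> f" and z: "norm z \<le> M"
    have bnd: "norm ((deriv ^^ k) \<phi> 0 / fact k * (deriv ^^ k) f z)
        \<le> C * exp (\<beta> * R\<^sup>2) / R ^ k * (fact k * (K * exp (\<delta>' * S\<^sup>2)) / S ^ k)" if "R > 0" "S > 0" for R S
    proof -
      have "norm ((deriv ^^ k) \<phi> 0) \<le> fact k * (C * exp (\<beta> * R\<^sup>2)) / R ^ k"
        by (rule higher_deriv_le) (use \<phi> that in \<open>auto simp: gauss_bounded_def\<close>)
      then have 1: "norm ((deriv ^^ k) \<phi> 0 / fact k) \<le> C * exp (\<beta> * R\<^sup>2) / R ^ k"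
        by (simp add: norm_divide divide_le_eq mult_ac)
      have 2: "norm ((deriv ^^ k) f z) \<le> fact k * (K * exp (\<delta>' * S\<^sup>2)) / S ^ k"
      proof (rule higher_deriv_le)
        show "norm (f (z + w)) \<le> K * exp (\<delta>' * S\<^sup>2)" if "norm w = S" for w
          using gauss_bounded_translate[OF f assms(2) \<delta>'(1) z assms(5), of w] that by (simp add: K_def)
      qed (use f that in \<open>auto simp: gauss_bounded_def\<close>)
      show ?thesis unfolding norm_mult
        using 1 2 by (intro mult_mono) (auto intro: order_trans[OF norm_ge_zero])
    qed
    show "norm ((deriv ^^ k) \<phi> 0 / fact k * (deriv ^^ k) f z) \<le> B k"
    proof (cases "k = 0")
      case True
      have "C * K * exp 1 \<ge> 0" using assms K by simp
      then show ?thesis using bnd[of 1 1] True by (simp add: B_def)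
    next
      case False
      define x where "x = real k"
      have x: "x > 0" using False by (simp add: x_def)
      define R S where "R = sqrt (x / (2 * \<beta>))" and "S = sqrt (x / (2 * \<delta>'))"
      have RS: "R > 0" "S > 0" "\<beta> * R\<^sup>2 = x / 2" "\<delta>' * S\<^sup>2 = x / 2"
        using x assms(1) \<open>\<delta>' > 0\<close> by (auto simp: R_def S_def)
      have "R * S = x / q"
        using x assms(1) \<open>\<delta>' > 0\<close> by (simp add: R_def S_def q_def real_sqrt_mult real_sqrt_divide)
      then have RSk: "R ^ k * S ^ k = (x / q) ^ k" by (simp flip: power_mult_distrib)
      have ek: "exp (x / 2) * exp (x / 2) = exp 1 ^ k"
        by (simp add: x_def flip: exp_add exp_of_nat_mult)
      have "norm ((deriv ^^ k) \<phi> 0 / fact k * (deriv ^^ k) f z)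
          \<le> C * exp (x / 2) / R ^ k * (fact k * (K * exp (x / 2)) / S ^ k)"
        using bnd[OF RS(1,2)] RS(3,4) by simp
      also have "\<dots> = C * K * (exp (x / 2) * exp (x / 2)) / (R ^ k * S ^ k) * fact k"
        by simp
      also have "\<dots> = C * K * (exp 1 ^ k / (x / q) ^ k) * fact k"
        by (simp add: RSk ek)
      also have "\<dots> \<le> C * K * (exp 1 ^ k / (x / q) ^ k) * (exp 1 * x * (x / exp 1) ^ k)"
        using fact_le_exp_bound[of k] False assms K x q
        by (intro mult_left_mono) (auto simp: x_def)
      also have "\<dots> = C * K * exp 1 * (x * q ^ k)"
        using x q by (simp add: power_divide)
      also have "\<dots> \<le> B k"
      proof -
        have "x * q ^ k \<le> real (Suc k) * q ^ k"
          using q by (intro mult_right_mono) (auto simp: x_def)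
        then have "C * K * exp 1 * (x * q ^ k) \<le> C * K * exp 1 * (real (Suc k) * q ^ k)"
          using assms K by (intro mult_left_mono) auto
        moreover have "(0::real) ^ k = 0" using False by simp
        ultimately show ?thesis by (simp add: B_def zero_power)
      qed
      finally show ?thesis .
    qed
  qed
qed

lemma op_D_tendsto:
  assumes "\<beta> > 0" "\<delta> \<ge> 0" "4 * \<beta> * \<delta> < 1" "C \<ge> 0" "C' \<ge> 0"
    and \<phi>: "\<And>n. gauss_bounded C \<beta> (\<phi> n)" "\<And>z. (\<lambda>n. \<phi> n z) \<longlonglongrightarrow> \<phi>' z" "\<phi>' holomorphic_on UNIV"
    and f: "\<And>n. gauss_bounded C' \<delta> (f n)" "\<And>z. (\<lambda>n. f n z) \<longlonglongrightarrow> f' z" "f' holomorphic_on UNIV"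
  shows "(\<lambda>n. op_D (\<phi> n) (f n) z) \<longlonglongrightarrow> op_D \<phi>' f' z"
proof -
  obtain B where B: "summable B" "\<And>\<phi> f w k. gauss_bounded C \<beta> \<phi> \<Longrightarrow> gauss_bounded C' \<delta> f \<Longrightarrow> norm w \<le> norm z \<Longrightarrow>
       norm ((deriv ^^ k) \<phi> 0 / fact k * (deriv ^^ k) f w) \<le> B k"
    by (rule op_D_term_bound[OF assms(1-5), of "norm z"]) (use that in blast)
  have loc: "norm (g u) \<le> A * exp (b * (norm w + 1)\<^sup>2)" if "gauss_bounded A b g" "norm (u - w) \<le> 1" "A \<ge> 0" "b \<ge> 0" for A b g u w
  proof -
    have "norm u \<le> norm w + 1" using that(2) norm_triangle_sub[of u w] by linarith
    then have "A * exp (b * (norm u)\<^sup>2) \<le> A * exp (b * (norm w + 1)\<^sup>2)"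
      using that by (intro mult_left_mono iffD2[OF exp_le_cancel_iff] power_mono) auto
    then show ?thesis using that(1) by (auto simp: gauss_bounded_def intro: order_trans)
  qed
  show ?thesis unfolding op_D_def
  proof (rule tendsto_suminf_dominated)
    show "(\<lambda>n. (deriv ^^ k) (\<phi> n) 0 / fact k * (deriv ^^ k) (f n) z) \<longlonglongrightarrow> (deriv ^^ k) \<phi>' 0 / fact k * (deriv ^^ k) f' z" for k
    proof (intro tendsto_intros)
      show "(\<lambda>n. (deriv ^^ k) (\<phi> n) 0) \<longlonglongrightarrow> (deriv ^^ k) \<phi>' 0"
        using \<phi> assms by (intro higher_deriv_tendsto_bounded[where M = "C * exp (\<beta> * (norm (0::complex) + 1)\<^sup>2)"] loc)
          (auto simp: gauss_bounded_def)
      show "(\<lambda>n. (deriv ^^ k) (f n) z) \<longlonglongrightarrow> (deriv ^^ k) f' z"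
        using f assms by (intro higher_deriv_tendsto_bounded[where M = "C' * exp (\<delta> * (norm z + 1)\<^sup>2)"] loc)
          (auto simp: gauss_bounded_def)
    qed simp
    show "norm ((deriv ^^ k) (\<phi> n) 0 / fact k * (deriv ^^ k) (f n) z) \<le> B k" for n k
      by (rule B(2)[OF \<phi>(1) f(1)]) simp
  qed (rule B(1))
qed

lemma op_D_holomorphic:
  assumes "\<beta> > 0" "\<delta> \<ge> 0" "4 * \<beta> * \<delta> < 1" "C \<ge> 0" "C' \<ge> 0"
    and \<phi>: "gauss_bounded C \<beta> \<phi>" and f: "gauss_bounded C' \<delta> f"
  shows "op_D \<phi> f holomorphic_on UNIV"
proof (rule holomorphic_uniform_sequence[OF open_UNIV])
  fix n
  show "(\<lambda>z. \<Sum>k<n. (deriv ^^ k) \<phi> 0 / fact k * (deriv ^^ k) f z) holomorphic_on UNIV"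
    using f by (intro holomorphic_intros) (auto simp: gauss_bounded_def)
next
  fix x :: complex
  obtain B where B: "summable B" "\<And>\<phi> f w k. gauss_bounded C \<beta> \<phi> \<Longrightarrow> gauss_bounded C' \<delta> f \<Longrightarrow> norm w \<le> norm x + 1 \<Longrightarrow>
       norm ((deriv ^^ k) \<phi> 0 / fact k * (deriv ^^ k) f w) \<le> B k"
    by (rule op_D_term_bound[OF assms(1-5), of "norm x + 1"]) (use that in blast)
  have "uniform_limit (cball x 1) (\<lambda>n z. \<Sum>k<n. (deriv ^^ k) \<phi> 0 / fact k * (deriv ^^ k) f z) (op_D \<phi> f) sequentially"
    unfolding op_D_def[abs_def]
  proof (rule Weierstrass_m_test[OF _ B(1)])
    fix k w assume "w \<in> cball x 1"
    then have "norm w \<le> norm x + 1" using norm_triangle_sub[of w x] by (simp add: dist_norm norm_minus_commute)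
    then show "norm ((deriv ^^ k) \<phi> 0 / fact k * (deriv ^^ k) f w) \<le> B k" by (rule B(2)[OF \<phi> f])
  qed
  then show "\<exists>d. 0 < d \<and> cball x d \<subseteq> UNIV \<and>
      uniform_limit (cball x d) (\<lambda>n z. \<Sum>k<n. (deriv ^^ k) \<phi> 0 / fact k * (deriv ^^ k) f z) (op_D \<phi> f) sequentially"
    by (intro exI[of _ 1]) auto
qed

section \<open>Polynomial approximation in the Laguerre--Polya classes\<close>

text \<open>Schwarz reflection: both sides are entire and agree on the real line, which accumulates
  at 0.\<close>

lemma real_entire_cnj:
  assumes "real_entire g"
  shows "g (cnj z) = cnj (g z)"
proof -
  have hol: "g holomorphic_on UNIV" and real: "\<And>x. x \<in> \<real> \<Longrightarrow> g x \<in> \<real>"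
    using assms by (auto simp: real_entire_def)
  have "(cnj \<circ> g \<circ> cnj) holomorphic_on UNIV"
    by (rule holomorphic_on_compose_cnj_cnj) (use hol in \<open>auto intro: holomorphic_on_subset\<close>)
  then have d: "(\<lambda>z. g z - (cnj \<circ> g \<circ> cnj) z) holomorphic_on UNIV"
    using hol by (intro holomorphic_intros)
  have lim: "(0::complex) islimpt \<real>"
    unfolding islimpt_sequential
  proof (intro exI conjI allI)
    show "of_real (1 / real (Suc n)) \<in> \<real> - {0::complex}" for n by (simp del: of_real_divide of_nat_Suc)
    have "(\<lambda>n. of_real (1 / real (Suc n)) :: complex) \<longlonglongrightarrow> of_real 0"
      by (intro tendsto_of_real LIMSEQ_Suc[OF lim_1_over_n])
    then show "(\<lambda>n. of_real (1 / real (Suc n)) :: complex) \<longlonglongrightarrow> 0" by simp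
  qed
  have "g (cnj z) - (cnj \<circ> g \<circ> cnj) (cnj z) = 0"
    by (rule analytic_continuation[OF d open_UNIV connected_UNIV subset_UNIV UNIV_I lim _ UNIV_I])
      (use real in \<open>auto simp: Reals_cnj_iff[THEN iffD1]\<close>)
  then show ?thesis by simp
qed

lemma LP1_E:
  assumes "g \<in> LP1 r"
  obtains c a :: real and m :: nat and \<beta> :: "nat \<Rightarrow> complex" where
    "real_entire g" "\<And>k. \<beta> k \<noteq> 0 \<Longrightarrow> \<bar>Im (1 / \<beta> k)\<bar> \<le> max 0 r" "summable (\<lambda>k. (norm (\<beta> k))\<^sup>2)"
    "\<And>z. g z = of_real c * z ^ m * exp (of_real a * z) * (\<Prod>k. weierstrass_factor 1 (\<beta> k * z))"
proof -
  from assms obtain c a :: real and m I and \<alpha> :: "nat \<Rightarrow> complex" where g: "real_entire g"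
    and \<alpha>: "\<forall>k\<in>I. \<alpha> k \<noteq> 0 \<and> \<alpha> k \<in> strip r" and sum: "(\<lambda>k. 1 / (cmod (\<alpha> k))\<^sup>2) summable_on I"
    and eq: "\<forall>z. g z = of_real c * z ^ m * exp (of_real a * z - of_real 0 * z\<^sup>2) *
               (\<Prod>k. if k \<in> I then (1 - z / \<alpha> k) * exp (z / \<alpha> k) else 1)"
    unfolding LP1_def LP_rep_def by blast
  define \<beta> where "\<beta> = (\<lambda>k. if k \<in> I then 1 / \<alpha> k else 0)"
  show ?thesis
  proof (rule that[OF g])
    show "\<bar>Im (1 / \<beta> k)\<bar> \<le> max 0 r" if "\<beta> k \<noteq> 0" for k
      using that \<alpha> by (auto simp: \<beta>_def strip_eq split: if_splits)
    have "(\<lambda>k. (norm (\<beta> k))\<^sup>2) summable_on UNIV \<longleftrightarrow> (\<lambda>k. 1 / (cmod (\<alpha> k))\<^sup>2) summable_on I"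
      by (rule summable_on_cong_neutral) (auto simp: \<beta>_def norm_divide power_divide)
    with sum show "summable (\<lambda>k. (norm (\<beta> k))\<^sup>2)"
      by (intro summable_on_imp_summable) simp
    have "(if k \<in> I then (1 - z / \<alpha> k) * exp (z / \<alpha> k) else 1) = weierstrass_factor 1 (\<beta> k * z)" for k z
      by (auto simp: \<beta>_def weierstrass_factor_one[unfolded One_nat_def])
    then show "g z = of_real c * z ^ m * exp (of_real a * z) * (\<Prod>k. weierstrass_factor 1 (\<beta> k * z))" for z
      using eq by simp
  qed
qed

lemma summable_sq_imp:
  fixes \<beta> :: "nat \<Rightarrow> complex"
  assumes "summable (\<lambda>k. (norm (\<beta> k))\<^sup>2)"
  shows "\<beta> \<longlonglongrightarrow> 0"
proof -
  have "(\<lambda>k. sqrt ((norm (\<beta> k))\<^sup>2)) \<longlonglongrightarrow> sqrt 0"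
    by (intro tendsto_intros summable_LIMSEQ_zero[OF assms])
  then show ?thesis by (simp add: tendsto_norm_zero_iff)
qed

text \<open>Truncation by modulus rather than by index keeps conjugate zeros together, so the
  partial products stay real.\<close>

definition cutoff :: "(nat \<Rightarrow> complex) \<Rightarrow> nat \<Rightarrow> nat set" where
  "cutoff \<beta> n = {k. norm (\<beta> k) \<ge> 1 / real (Suc n)}"

lemma finite_norm_ge:
  fixes \<beta> :: "nat \<Rightarrow> complex"
  assumes "summable (\<lambda>k. (norm (\<beta> k))\<^sup>2)" "e > 0"
  shows "finite {k. norm (\<beta> k) \<ge> e}"
proof -
  have "eventually (\<lambda>k. norm (\<beta> k) < e) sequentially"
    using order_tendstoD(2)[OF tendsto_norm[OF summable_sq_imp[OF assms(1)]], of e] assms(2) by simp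
  then obtain N where "\<And>k. k \<ge> N \<Longrightarrow> norm (\<beta> k) < e" by (auto simp: eventually_sequentially)
  then have "{k. norm (\<beta> k) \<ge> e} \<subseteq> {..<N}" by (auto simp: not_less[symmetric])
  then show ?thesis using finite_subset by blast
qed

lemma finite_cutoff: "summable (\<lambda>k. (norm (\<beta> k))\<^sup>2) \<Longrightarrow> finite (cutoff \<beta> n)"
  unfolding cutoff_def by (rule finite_norm_ge) auto

lemma prodinf_weierstrass_one_convergent:
  fixes \<beta> :: "nat \<Rightarrow> complex"
  assumes "summable (\<lambda>k. (norm (\<beta> k))\<^sup>2)"
  shows "convergent_prod (\<lambda>k. weierstrass_factor 1 (\<beta> k * z))"
proof (rule convergent_prod_weierstrass)
  show "summable (\<lambda>k. norm (\<beta> k * z) ^ Suc 1)"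
    using summable_mult2[OF assms, of "(norm z)\<^sup>2"] by (simp add: norm_mult power_mult_distrib numeral_2_eq_2 mult_ac)
qed

text \<open>The evaluation point moves too, so the same statement gives convergence of truncated
  products and continuity of the full product in \<open>z\<close>.\<close>

lemma prodinf_weierstrass_one_tendsto:
  fixes \<beta> :: "nat \<Rightarrow> complex" and b :: "nat \<Rightarrow> nat \<Rightarrow> complex"
  assumes sum: "summable (\<lambda>k. (norm (\<beta> k))\<^sup>2)"
    and bound: "\<And>n k. norm (b n k) \<le> norm (\<beta> k)" and lim: "\<And>k. (\<lambda>n. b n k) \<longlonglongrightarrow> b' k" and z: "u \<longlonglongrightarrow> z"
  shows "(\<lambda>n. \<Prod>k. weierstrass_factor 1 (b n k * u n)) \<longlonglongrightarrow> (\<Prod>k. weierstrass_factor 1 (b' k * z))"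
proof -
  have "Bseq u" using z by (rule convergent_imp_Bseq[OF convergentI])
  then obtain M where M: "M > 0" "\<And>n. norm (u n) \<le> M" by (auto simp: Bseq_def)
  have "Bseq \<beta>" using summable_sq_imp[OF sum] by (rule convergent_imp_Bseq[OF convergentI])
  then obtain R where R: "R > 0" "\<And>n. norm (\<beta> n) \<le> R" by (auto simp: Bseq_def)
  show ?thesis
  proof (rule prodinf_weierstrass_tendsto)
    show "(\<lambda>n. b n k * u n) \<longlonglongrightarrow> b' k * z" for k by (intro tendsto_intros lim z)
    show "norm (b n k * u n) \<le> norm (\<beta> k) * M" for n k
      unfolding norm_mult using bound M by (intro mult_mono) auto
    show "summable (\<lambda>k. (norm (\<beta> k) * M) ^ Suc 1)"
      using summable_mult2[OF sum, of "M\<^sup>2"] by (simp add: power_mult_distrib numeral_2_eq_2 mult_ac)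
    show "norm (\<beta> k) * M \<le> R * M" for k using R M by (simp add: mult_right_mono)
  qed
qed

definition lp1_trunc :: "real \<Rightarrow> real \<Rightarrow> nat \<Rightarrow> (nat \<Rightarrow> complex) \<Rightarrow> nat \<Rightarrow> complex \<Rightarrow> complex" where
  "lp1_trunc c a m \<beta> n z = of_real c * z ^ m * exp (of_real a * z) * (\<Prod>k\<in>cutoff \<beta> n. weierstrass_factor 1 (\<beta> k * z))"

lemma lp1_trunc_tendsto:
  assumes "summable (\<lambda>k. (norm (\<beta> k))\<^sup>2)"
  shows "(\<lambda>n. lp1_trunc c a m \<beta> n z) \<longlonglongrightarrow> of_real c * z ^ m * exp (of_real a * z) * (\<Prod>k. weierstrass_factor 1 (\<beta> k * z))"
proof -
  define b where "b = (\<lambda>n k. if k \<in> cutoff \<beta> n then \<beta> k else 0)"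
  have "(\<lambda>n. \<Prod>k. weierstrass_factor 1 (b n k * z)) \<longlonglongrightarrow> (\<Prod>k. weierstrass_factor 1 (\<beta> k * z))"
  proof (rule prodinf_weierstrass_one_tendsto[OF assms])
    show "(\<lambda>n. b n k) \<longlonglongrightarrow> \<beta> k" for k
    proof (cases "\<beta> k = 0")
      case False
      have "eventually (\<lambda>n. inverse (real (Suc n)) < norm (\<beta> k)) sequentially"
        by (rule order_tendstoD(2)[OF LIMSEQ_inverse_real_of_nat]) (use False in simp)
      then have "eventually (\<lambda>n. b n k = \<beta> k) sequentially"
        by eventually_elim (auto simp: b_def cutoff_def inverse_eq_divide)
      then show ?thesis by (rule tendsto_eventually)
    next
      case True
      then have "(\<lambda>n. b n k) = (\<lambda>n. 0)" by (auto simp: b_def)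
      then show ?thesis using True by simp
    qed
  qed (auto simp: b_def)
  moreover have "(\<Prod>k. weierstrass_factor 1 (b n k * z)) = (\<Prod>k\<in>cutoff \<beta> n. weierstrass_factor 1 (\<beta> k * z))" for n
  proof -
    have "(\<Prod>k. weierstrass_factor 1 (b n k * z)) = (\<Prod>k\<in>cutoff \<beta> n. weierstrass_factor 1 (b n k * z))"
      by (rule prodinf_finite[OF finite_cutoff[OF assms]]) (auto simp: b_def)
    then show ?thesis by (simp add: b_def)
  qed
  ultimately show ?thesis unfolding lp1_trunc_def by (intro tendsto_intros) simp
qed

lemma lp1_trunc_holomorphic: "lp1_trunc c a m \<beta> n holomorphic_on UNIV"
  unfolding lp1_trunc_def[abs_def] by (intro holomorphic_intros)

text \<open>Cut at \<open>N\<close> so that the remaining squares sum to less than \<epsilon>: the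
  tail costs \<epsilon>/2 in the type, and everything else is at most exp (L |z|). Completing the
  square absorbs L |z| into the other \<epsilon>/2, at the price of the constant exp (L^2 / (2
  \<epsilon>)). None of this depends on the truncation.\<close>

lemma lp1_trunc_growth:
  fixes \<beta> :: "nat \<Rightarrow> complex"
  assumes sum: "summable (\<lambda>k. (norm (\<beta> k))\<^sup>2)" and \<epsilon>: "\<epsilon> > 0"
  obtains C where "C \<ge> 0" "\<And>n z. norm (lp1_trunc c a m \<beta> n z) \<le> C * exp (\<epsilon> * (norm z)\<^sup>2)"
proof -
  from suminf_exist_split[OF \<epsilon> sum] obtain N where N: "norm (\<Sum>i. (norm (\<beta> (i + N)))\<^sup>2) < \<epsilon>" by blast
  define L where "L = real m + \<bar>a\<bar> + 2 * (\<Sum>k<N. norm (\<beta> k))"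
  define C where "C = \<bar>c\<bar> * exp (L\<^sup>2 / (2 * \<epsilon>))"
  have tail: "(\<Sum>k\<in>A. (norm (\<beta> k))\<^sup>2) \<le> \<epsilon>" if "finite A" "A \<inter> {..<N} = {}" for A
  proof -
    have "(\<Sum>k\<in>A. (norm (\<beta> k))\<^sup>2) = (\<Sum>i\<in>(\<lambda>k. k - N) ` A. (norm (\<beta> (i + N)))\<^sup>2)"
      using that(2) by (intro sum.reindex_bij_witness[of _ "\<lambda>i. i + N" "\<lambda>k. k - N"]) (auto simp: disjoint_iff)
    also have "\<dots> \<le> (\<Sum>i. (norm (\<beta> (i + N)))\<^sup>2)"
      using that(1) sum by (intro sum_le_suminf) (auto simp: summable_iff_shift[of "\<lambda>k. (norm (\<beta> k))\<^sup>2" N])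
    finally show ?thesis using N by simp
  qed
  show ?thesis
  proof (rule that[of C])
    show "C \<ge> 0" by (simp add: C_def)
    fix n and z :: complex
    define t where "t = norm z"
    define A where "A = cutoff \<beta> n"
    have A: "finite A" unfolding A_def by (rule finite_cutoff[OF sum])
    have "norm (\<Prod>k\<in>A. weierstrass_factor 1 (\<beta> k * z))
        = (\<Prod>k\<in>A \<inter> {..<N}. norm (weierstrass_factor 1 (\<beta> k * z))) * (\<Prod>k\<in>A - {..<N}. norm (weierstrass_factor 1 (\<beta> k * z)))"
      by (subst prod.Int_Diff[OF A, of _ "{..<N}"]) (simp add: norm_mult prod_norm)
    also have "\<dots> \<le> exp (2 * (\<Sum>k<N. norm (\<beta> k)) * t) * exp (\<epsilon> / 2 * t\<^sup>2)"
    proof (rule mult_mono)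
      have "(\<Prod>k\<in>A \<inter> {..<N}. norm (weierstrass_factor 1 (\<beta> k * z))) \<le> (\<Prod>k\<in>A \<inter> {..<N}. exp (2 * norm (\<beta> k * z)))"
        by (intro prod_mono) (use norm_weierstrass_factor_one_le_linear in auto)
      also have "\<dots> = exp (\<Sum>k\<in>A \<inter> {..<N}. 2 * norm (\<beta> k * z))" using A by (simp add: exp_sum)
      also have "\<dots> \<le> exp (\<Sum>k<N. 2 * norm (\<beta> k * z))"
        by (subst exp_le_cancel_iff) (intro sum_mono2, auto)
      also have "(\<Sum>k<N. 2 * norm (\<beta> k * z)) = 2 * (\<Sum>k<N. norm (\<beta> k)) * t"
        by (simp add: norm_mult t_def sum_distrib_left sum_distrib_right mult.assoc)
      finally show "(\<Prod>k\<in>A \<inter> {..<N}. norm (weierstrass_factor 1 (\<beta> k * z))) \<le> exp (2 * (\<Sum>k<N. norm (\<beta> k)) * t)" .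
      have "(\<Prod>k\<in>A - {..<N}. norm (weierstrass_factor 1 (\<beta> k * z))) \<le> (\<Prod>k\<in>A - {..<N}. exp ((norm (\<beta> k * z))\<^sup>2 / 2))"
        by (intro prod_mono) (use norm_weierstrass_factor_one_le in auto)
      also have "\<dots> = exp (\<Sum>k\<in>A - {..<N}. (norm (\<beta> k * z))\<^sup>2 / 2)" using A by (simp add: exp_sum)
      also have "(\<Sum>k\<in>A - {..<N}. (norm (\<beta> k * z))\<^sup>2 / 2) = (\<Sum>k\<in>A - {..<N}. (norm (\<beta> k))\<^sup>2) / 2 * t\<^sup>2"
        by (simp add: norm_mult power_mult_distrib t_def sum_distrib_right sum_divide_distrib)
      also have "exp \<dots> \<le> exp (\<epsilon> / 2 * t\<^sup>2)"
        using tail[of "A - {..<N}"] A by (subst exp_le_cancel_iff) (intro mult_right_mono divide_right_mono, auto)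
      finally show "(\<Prod>k\<in>A - {..<N}. norm (weierstrass_factor 1 (\<beta> k * z))) \<le> exp (\<epsilon> / 2 * t\<^sup>2)" .
    qed (auto intro: prod_nonneg)
    finally have 1: "norm (\<Prod>k\<in>A. weierstrass_factor 1 (\<beta> k * z)) \<le> exp (2 * (\<Sum>k<N. norm (\<beta> k)) * t) * exp (\<epsilon> / 2 * t\<^sup>2)" .
    have 2: "norm (z ^ m) \<le> exp (real m * t)"
    proof -
      have "t \<le> exp t" using exp_ge_add_one_self[of t] by linarith
      then have "t ^ m \<le> exp t ^ m" by (intro power_mono) (auto simp: t_def)
      then show ?thesis by (simp add: norm_power t_def exp_of_nat_mult)
    qed
    have 3: "norm (exp (of_real a * z)) \<le> exp (\<bar>a\<bar> * t)"
      using norm_exp[of "of_real a * z"] by (simp add: norm_mult t_def)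
    have "norm (lp1_trunc c a m \<beta> n z) = \<bar>c\<bar> * (norm (z ^ m) * (norm (exp (of_real a * z)) * norm (\<Prod>k\<in>A. weierstrass_factor 1 (\<beta> k * z))))"
      by (simp add: lp1_trunc_def A_def norm_mult)
    also have "\<dots> \<le> \<bar>c\<bar> * (exp (real m * t) * (exp (\<bar>a\<bar> * t) * (exp (2 * (\<Sum>k<N. norm (\<beta> k)) * t) * exp (\<epsilon> / 2 * t\<^sup>2))))"
      by (intro mult_left_mono mult_mono 1 2 3) auto
    also have "\<dots> = \<bar>c\<bar> * exp (L * t + \<epsilon> / 2 * t\<^sup>2)"
      by (simp add: L_def distrib_right flip: exp_add)
    also have "\<dots> \<le> \<bar>c\<bar> * exp (L\<^sup>2 / (2 * \<epsilon>) + \<epsilon> * t\<^sup>2)"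
    proof -
      have "0 \<le> (L - \<epsilon> * t)\<^sup>2 / (2 * \<epsilon>)" using \<epsilon> by simp
      also have "\<dots> = L\<^sup>2 / (2 * \<epsilon>) + \<epsilon> / 2 * t\<^sup>2 - L * t"
        using \<epsilon> by (simp add: power2_eq_square field_simps)
      finally show ?thesis by (intro mult_left_mono) auto
    qed
    also have "\<dots> = C * exp (\<epsilon> * (norm z)\<^sup>2)" by (simp add: C_def t_def exp_add)
    finally show "norm (lp1_trunc c a m \<beta> n z) \<le> C * exp (\<epsilon> * (norm z)\<^sup>2)" .
  qed
qed

section \<open>Conjugate symmetry of the zeros of a canonical product\<close>

lemma linear_power_unique:
  fixes G H :: "complex \<Rightarrow> complex"
  assumes "isCont G z0" "isCont H z0" "G z0 \<noteq> 0" "H z0 \<noteq> 0" "b * z0 = 1"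
    and eq: "\<And>z. (1 - b * z) ^ n * G z = (1 - b * z) ^ n' * H z"
  shows "n = n'"
proof -
  have *: False if "n < n'" "isCont G z0" "isCont H z0" "G z0 \<noteq> 0"
    "\<And>z. (1 - b * z) ^ n * G z = (1 - b * z) ^ n' * H z" for n n' and G H :: "complex \<Rightarrow> complex"
  proof -
    have b: "b \<noteq> 0" using assms(5) by auto
    \<comment> \<open>Cancelling the smaller power away from \<open>z0\<close> and letting z tend to
      \<open>z0\<close> forces G z0 = 0. Continuity suffices, so the cofactors need not be shown
      holomorphic.\<close>
    have ev: "eventually (\<lambda>z. (1 - b * z) ^ (n' - n) * H z = G z) (at z0)"
      unfolding eventually_at_filter
    proof (intro always_eventually allI impI)
      fix z assume "z \<noteq> z0"
      then have "1 - b * z \<noteq> 0" using assms(5) b by (metis eq_iff_diff_eq_0 mult_cancel_left)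
      moreover have "(1 - b * z) ^ n' = (1 - b * z) ^ n * (1 - b * z) ^ (n' - n)"
        using that(1) by (simp flip: power_add)
      ultimately show "(1 - b * z) ^ (n' - n) * H z = G z" using that(5)[of z] by simp
    qed
    have "((\<lambda>z. (1 - b * z) ^ (n' - n) * H z) \<longlongrightarrow> (1 - b * z0) ^ (n' - n) * H z0) (at z0)"
      using that(3) unfolding isCont_def by (intro tendsto_intros)
    moreover have "(1 - b * z0) ^ (n' - n) * H z0 = 0" using that(1) assms(5) by simp
    ultimately have "(G \<longlongrightarrow> 0) (at z0)" using Lim_transform_eventually[OF _ ev] by simp
    then show False using that(2,4) unfolding isCont_def by (metis LIM_unique)
  qed
  show ?thesis
  proof (rule linorder_cases[of n n'])
    assume "n < n'" then show ?thesis using *[of n n' G H] assms by blast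
  next
    assume "n' < n" then show ?thesis using *[of n' n H G] assms by metis
  qed
qed

lemma lp1_factor_at_zero:
  assumes sum: "summable (\<lambda>k. (norm (\<beta> k))\<^sup>2)" and b: "b \<noteq> 0" and c: "c \<noteq> 0"
    and g: "\<And>z. g z = of_real c * z ^ m * exp (of_real a * z) * (\<Prod>k. weierstrass_factor 1 (\<beta> k * z))"
  obtains G where "continuous_on UNIV G" "G (1 / b) \<noteq> 0" "\<And>z. g z = (1 - b * z) ^ card {k. \<beta> k = b} * G z"
proof -
  define K where "K = {k. \<beta> k = b}"
  have "finite K"
    by (rule finite_subset[OF _ finite_norm_ge[OF sum, of "norm b"]]) (use b in \<open>auto simp: K_def\<close>)
  define b' where "b' = (\<lambda>k. if k \<in> K then 0 else \<beta> k)"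
  have sum': "summable (\<lambda>k. (norm (b' k))\<^sup>2)"
    by (rule summable_comparison_test'[OF sum]) (auto simp: b'_def)
  define R where "R = (\<lambda>z. \<Prod>k. weierstrass_factor 1 (b' k * z))"
  have contR: "continuous_on UNIV R"
    unfolding continuous_on_sequentially R_def o_def
  proof (intro allI ballI impI)
    fix u and z :: complex assume "(\<forall>n. u n \<in> UNIV) \<and> u \<longlonglongrightarrow> z"
    then show "(\<lambda>n. \<Prod>k. weierstrass_factor 1 (b' k * u n)) \<longlonglongrightarrow> (\<Prod>k. weierstrass_factor 1 (b' k * z))"
      by (intro prodinf_weierstrass_one_tendsto[OF sum']) auto
  qed
  have split: "(\<Prod>k. weierstrass_factor 1 (\<beta> k * z)) = weierstrass_factor 1 (b * z) ^ card K * R z" for z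
  proof -
    define e where "e = (\<lambda>k. if k \<in> K then weierstrass_factor 1 (\<beta> k * z) else 1)"
    have e: "convergent_prod e" unfolding e_def by (rule convergent_prod_If_finite_set[OF \<open>finite K\<close>])
    have "(\<Prod>k. weierstrass_factor 1 (\<beta> k * z)) = (\<Prod>k. e k * weierstrass_factor 1 (b' k * z))"
      by (rule prodinf_cong) (auto simp: e_def b'_def)
    also have "\<dots> = prodinf e * R z"
      unfolding R_def by (rule prodinf_mult[symmetric, OF e prodinf_weierstrass_one_convergent[OF sum']])
    also have "prodinf e = (\<Prod>k\<in>K. e k)"
      by (rule prodinf_finite[OF \<open>finite K\<close>]) (simp add: e_def)
    also have "\<dots> = weierstrass_factor 1 (b * z) ^ card K"
      by (simp add: e_def K_def)
    finally show ?thesis .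
  qed
  define G where "G = (\<lambda>z. of_real c * z ^ m * exp (of_real a * z) * exp (b * z) ^ card K * R z)"
  show ?thesis
  proof (rule that[of G])
    show "continuous_on UNIV G" unfolding G_def by (intro continuous_intros contR)
    have "R (1 / b) \<noteq> 0"
      unfolding R_def
    proof (rule prodinf_nonzero[OF prodinf_weierstrass_one_convergent[OF sum']])
      show "weierstrass_factor 1 (b' k * (1 / b)) \<noteq> 0" for k
        using b by (auto simp: b'_def K_def)
    qed
    then show "G (1 / b) \<noteq> 0" using b c by (simp add: G_def)
    show "g z = (1 - b * z) ^ card {k. \<beta> k = b} * G z" for z
      unfolding g split G_def by (simp only: weierstrass_factor_one power_mult_distrib K_def mult_ac)
  qed
qed

text \<open>Reality of \<open>g\<close> turns the factorisation at 1 / cnj b into one at 1 / b by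
  conjugation; comparing exponents with the factorisation there gives equal multiplicities.\<close>

lemma lp1_zeros_symmetric:
  assumes re: "real_entire g" and sum: "summable (\<lambda>k. (norm (\<beta> k))\<^sup>2)" and b: "b \<noteq> 0" and c: "c \<noteq> 0"
    and g: "\<And>z. g z = of_real c * z ^ m * exp (of_real a * z) * (\<Prod>k. weierstrass_factor 1 (\<beta> k * z))"
  shows "card {k. \<beta> k = b} = card {k. \<beta> k = cnj b}"
proof -
  obtain G where G: "continuous_on UNIV G" "G (1 / b) \<noteq> 0" "\<And>z. g z = (1 - b * z) ^ card {k. \<beta> k = b} * G z"
    by (rule lp1_factor_at_zero[OF sum b c g]) (use that in blast)
  have b': "cnj b \<noteq> 0" using b by simp
  obtain H where H: "continuous_on UNIV H" "H (1 / cnj b) \<noteq> 0" "\<And>z. g z = (1 - cnj b * z) ^ card {k. \<beta> k = cnj b} * H z"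
    by (rule lp1_factor_at_zero[OF sum b' c g]) (use that in blast)
  show ?thesis
  proof (rule linear_power_unique)
    show "isCont G (1 / b)" using G(1) by (simp add: continuous_on_eq_continuous_at)
    have "continuous_on UNIV (\<lambda>z. cnj (H (cnj z)))"
      by (intro continuous_intros continuous_on_compose2[OF H(1)]) auto
    then show "isCont (\<lambda>z. cnj (H (cnj z))) (1 / b)" by (simp add: continuous_on_eq_continuous_at)
    show "G (1 / b) \<noteq> 0" by (rule G(2))
    show "cnj (H (cnj (1 / b))) \<noteq> 0" using H(2) by simp
    show "b * (1 / b) = 1" using b by simp
    show "(1 - b * z) ^ card {k. \<beta> k = b} * G z = (1 - b * z) ^ card {k. \<beta> k = cnj b} * cnj (H (cnj z))" for z
    proof -
      have "g z = cnj (g (cnj z))" by (simp add: real_entire_cnj[OF re])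
      also have "\<dots> = (1 - b * z) ^ card {k. \<beta> k = cnj b} * cnj (H (cnj z))"
        by (subst H(3)) simp
      finally show ?thesis by (simp add: G(3))
    qed
  qed
qed

lemma cutoff_symmetric:
  assumes re: "real_entire g" and sum: "summable (\<lambda>k. (norm (\<beta> k))\<^sup>2)" and c: "c \<noteq> 0"
    and g: "\<And>z. g z = of_real c * z ^ m * exp (of_real a * z) * (\<Prod>k. weierstrass_factor 1 (\<beta> k * z))"
  shows "image_mset cnj (image_mset \<beta> (mset_set (cutoff \<beta> n))) = image_mset \<beta> (mset_set (cutoff \<beta> n))"
proof (rule multiset_eqI)
  fix b
  have fin: "finite (cutoff \<beta> n)" by (rule finite_cutoff[OF sum])
  have cnt: "count (image_mset f (mset_set (cutoff \<beta> n))) b = card {k \<in> cutoff \<beta> n. f k = b}" for f :: "nat \<Rightarrow> complex"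
    using fin by (simp add: count_image_mset' eq_commute[of b] flip: sum.inter_filter)
  have "{k \<in> cutoff \<beta> n. cnj (\<beta> k) = b} = {k \<in> cutoff \<beta> n. \<beta> k = cnj b}"
    by (metis complex_cnj_cnj)
  moreover have "card {k \<in> cutoff \<beta> n. \<beta> k = cnj b} = card {k \<in> cutoff \<beta> n. \<beta> k = b}"
  proof (cases "norm b \<ge> 1 / real (Suc n)")
    case True
    then have "b \<noteq> 0" by (auto simp: divide_le_0_iff)
    have "{k \<in> cutoff \<beta> n. \<beta> k = cnj b} = {k. \<beta> k = cnj b}" "{k \<in> cutoff \<beta> n. \<beta> k = b} = {k. \<beta> k = b}"
      using True by (auto simp: cutoff_def)
    then show ?thesis using lp1_zeros_symmetric[OF re sum \<open>b \<noteq> 0\<close> c g] by simp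
  next
    case False
    then have "{k \<in> cutoff \<beta> n. \<beta> k = cnj b} = {}" "{k \<in> cutoff \<beta> n. \<beta> k = b} = {}"
      by (auto simp: cutoff_def)
    then show ?thesis by (simp only:)
  qed
  ultimately show "count (image_mset cnj (image_mset \<beta> (mset_set (cutoff \<beta> n)))) b
      = count (image_mset \<beta> (mset_set (cutoff \<beta> n))) b"
    by (simp add: image_mset.compositionality o_def cnt)
qed

section \<open>Exponentials and Gaussians as limits of powers\<close>

lemma weierstrass_factor_one_power_tendsto:
  assumes "(\<lambda>n. real (q n) * (norm (w n))\<^sup>2) \<longlonglongrightarrow> 0" "\<And>n. q n > 0"
  shows "(\<lambda>n. weierstrass_factor 1 (w n) ^ q n) \<longlonglongrightarrow> 1"
proof (rule Lim_null[THEN iffD2], rule Lim_null_comparison)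
  have "eventually (\<lambda>n. real (q n) * (norm (w n))\<^sup>2 < 1 / 4) sequentially"
    by (rule order_tendstoD(2)[OF assms(1)]) simp
  then show "eventually (\<lambda>n. norm (weierstrass_factor 1 (w n) ^ q n - 1) \<le> exp (3 * (real (q n) * (norm (w n))\<^sup>2)) - 1) sequentially"
  proof eventually_elim
    case (elim n)
    define u where "u = weierstrass_factor 1 (w n) - 1"
    have "1 * (norm (w n))\<^sup>2 \<le> real (q n) * (norm (w n))\<^sup>2"
      using assms(2)[of n] by (intro mult_right_mono) auto
    then have "(norm (w n))\<^sup>2 < (1 / 2)\<^sup>2" using elim by (simp add: power2_eq_square)
    then have "norm (w n) < 1 / 2" by (rule power_less_imp_less_base) simp
    \<comment> \<open>A genus 1 factor deviates from 1 only quadratically, so \<open>q n\<close> of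
      them deviate by an amount governed by q |w|^2, which tends to 0.\<close>
    then have u: "norm u \<le> 3 * (norm (w n))\<^sup>2"
      using weierstrass_factor_bound[of "w n" 1] by (simp add: u_def numeral_2_eq_2)
    have "norm (weierstrass_factor 1 (w n) ^ q n - 1) = norm ((\<Prod>k<q n. 1 + u) - 1)"
      by (simp add: u_def)
    also have "\<dots> \<le> exp (\<Sum>k<q n. norm u) - 1" by (rule norm_prod_minus_one_le_exp)
    also have "\<dots> \<le> exp (3 * (real (q n) * (norm (w n))\<^sup>2)) - 1"
      using mult_left_mono[OF u, of "real (q n)"] by (simp add: mult_ac)
    finally show ?case .
  qed
  have "(\<lambda>n. exp (3 * (real (q n) * (norm (w n))\<^sup>2)) - 1) \<longlonglongrightarrow> exp (3 * 0) - 1"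
    by (intro tendsto_intros assms(1))
  then show "(\<lambda>n. exp (3 * (real (q n) * (norm (w n))\<^sup>2)) - 1) \<longlonglongrightarrow> 0" by simp
qed

text \<open>Dividing by exp (v n) turns the power into that of a genus 1 factor at - v n / (n + 1),
  which tends to 1. No logarithm is involved, and \<open>v\<close> may vary with
  \<open>n\<close>.\<close>

lemma tendsto_one_plus_power_exp:
  fixes v :: "nat \<Rightarrow> complex"
  assumes "v \<longlonglongrightarrow> x"
  shows "(\<lambda>n. (1 + v n / of_nat (Suc n)) ^ Suc n) \<longlonglongrightarrow> exp x"
proof -
  define w where "w = (\<lambda>n. - v n / of_nat (Suc n))"
  have "(\<lambda>n. (norm (v n))\<^sup>2 * (1 / real (Suc n))) \<longlonglongrightarrow> (norm x)\<^sup>2 * 0"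
    by (intro tendsto_intros assms LIMSEQ_Suc[OF lim_1_over_n])
  moreover have "(norm (v n))\<^sup>2 * (1 / real (Suc n)) = real (Suc n) * (norm (w n))\<^sup>2" for n
    unfolding w_def norm_divide norm_of_nat norm_minus_cancel by (simp add: power2_eq_square del: of_nat_Suc)
  ultimately have "(\<lambda>n. weierstrass_factor 1 (w n) ^ Suc n) \<longlonglongrightarrow> 1"
    by (intro weierstrass_factor_one_power_tendsto) simp_all
  then have "(\<lambda>n. weierstrass_factor 1 (w n) ^ Suc n * exp (v n)) \<longlonglongrightarrow> 1 * exp x"
    by (intro tendsto_intros assms)
  moreover have "weierstrass_factor 1 (w n) ^ Suc n * exp (v n) = (1 + v n / of_nat (Suc n)) ^ Suc n" for n
  proof -
    have "exp (w n) ^ Suc n = exp (- v n)"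
      unfolding w_def exp_of_nat_mult[symmetric] by (simp del: of_nat_Suc)
    moreover have "1 - w n = 1 + v n / of_nat (Suc n)" by (simp add: w_def)
    ultimately show ?thesis
      by (simp only: weierstrass_factor_one power_mult_distrib mult.assoc) (simp flip: exp_add)
  qed
  ultimately show ?thesis by simp
qed

text \<open>By the half-angle formula, cos (h x) = 1 - 2 sin^2 (h x / 2) with h^2 = 1 / (n + 1),
  which is 1 + v / (n + 1) with \<open>v\<close> tending to - x^2 / 2.\<close>

lemma cos_power_tendsto:
  "(\<lambda>n. cos (x / of_real (sqrt (real (Suc n)))) ^ Suc n) \<longlonglongrightarrow> exp (- (x\<^sup>2) / 2 :: complex)"
proof -
  define h :: "nat \<Rightarrow> complex" where "h = (\<lambda>n. of_real (sqrt (1 / real (Suc n))))"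
  have h0: "h \<longlonglongrightarrow> 0"
  proof -
    have "h \<longlonglongrightarrow> of_real (sqrt 0)"
      unfolding h_def by (intro tendsto_of_real tendsto_real_sqrt LIMSEQ_Suc[OF lim_1_over_n])
    then show ?thesis by simp
  qed
  have hn: "h n \<noteq> 0" "(h n)\<^sup>2 = 1 / of_nat (Suc n)" for n
    by (auto simp: h_def simp del: of_nat_Suc simp flip: of_real_power)
  have "((\<lambda>y. sin (y * (x / 2))) has_field_derivative cos (0 * (x / 2)) * (x / 2)) (at 0)"
    by (auto intro!: derivative_eq_intros)
  then have "((\<lambda>y. sin (y * (x / 2)) / y) \<longlongrightarrow> x / 2) (at 0)"
    by (simp add: has_field_derivative_iff)
  then have s: "(\<lambda>n. sin (h n * (x / 2)) / h n) \<longlonglongrightarrow> x / 2"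
    by (rule filterlim_compose) (auto simp: filterlim_at h0 hn)
  define v where "v = (\<lambda>n. - 2 * (sin (h n * (x / 2)) / h n)\<^sup>2)"
  have "v \<longlonglongrightarrow> - 2 * (x / 2)\<^sup>2"
    unfolding v_def by (intro tendsto_intros s)
  then have "(\<lambda>n. (1 + v n / of_nat (Suc n)) ^ Suc n) \<longlonglongrightarrow> exp (- 2 * (x / 2)\<^sup>2)"
    by (rule tendsto_one_plus_power_exp)
  moreover have "1 + v n / of_nat (Suc n) = cos (x / of_real (sqrt (real (Suc n))))" for n
  proof -
    have "v n / of_nat (Suc n) = v n * (h n)\<^sup>2" by (simp only: hn) simp
    also have "\<dots> = - 2 * (sin (h n * (x / 2)))\<^sup>2" using hn(1)[of n] by (simp add: v_def power_divide)
    finally have "v n / of_nat (Suc n) = - 2 * (sin (h n * (x / 2)))\<^sup>2" .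
    then have "1 + v n / of_nat (Suc n) = cos (2 * (h n * (x / 2)))" unfolding cos_double_sin by simp
    also have "2 * (h n * (x / 2)) = x / of_real (sqrt (real (Suc n)))" by (simp add: h_def real_sqrt_divide)
    finally show ?thesis .
  qed
  moreover have "- 2 * (x / 2)\<^sup>2 = - (x\<^sup>2) / 2" by (simp add: power_divide)
  ultimately show ?thesis by (simp only:)
qed

text \<open>The difference y^2 / 2 - ln (cosh y) has derivative y - tanh y, which is nonnegative for
  y >= 0; evenness does the rest.\<close>

lemma cosh_le_exp_half_square: "cosh (y::real) \<le> exp (y\<^sup>2 / 2)"
proof -
  have tanh_le: "tanh x \<le> x" if "x \<ge> 0" for x :: real
  proof -
    have "0 - tanh 0 \<le> x - tanh x"
    proof (rule DERIV_nonneg_imp_nondecreasing[OF that])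
      fix t :: real
      have "((\<lambda>t. t - tanh t) has_real_derivative (1 - (1 - tanh t ^ 2))) (at t)"
        by (auto intro!: derivative_eq_intros)
      then show "\<exists>y. ((\<lambda>t. t - tanh t) has_real_derivative y) (at t) \<and> 0 \<le> y" by force
    qed
    then show ?thesis by simp
  qed
  have pos: "cosh x \<le> exp (x\<^sup>2 / 2)" if "x \<ge> 0" for x :: real
  proof -
    have "0\<^sup>2 / 2 - ln (cosh 0) \<le> x\<^sup>2 / 2 - ln (cosh x)"
    proof (rule DERIV_nonneg_imp_nondecreasing[OF that])
      fix t :: real assume "0 \<le> t"
      have "((\<lambda>t. t\<^sup>2 / 2 - ln (cosh t)) has_real_derivative (t - tanh t)) (at t)"
        by (auto intro!: derivative_eq_intros simp: tanh_def cosh_real_pos)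
      then show "\<exists>y. ((\<lambda>t. t\<^sup>2 / 2 - ln (cosh t)) has_real_derivative y) (at t) \<and> 0 \<le> y"
        using tanh_le[OF \<open>0 \<le> t\<close>] by force
    qed
    then have "ln (cosh x) \<le> x\<^sup>2 / 2" by simp
    then show ?thesis by (metis cosh_real_pos exp_le_cancel_iff exp_ln)
  qed
  show ?thesis using pos[of "\<bar>y\<bar>"] by simp
qed

text \<open>The constant 1/2 is what gives the powers of cosines the type \<alpha>^2 / 2 of their
  limit; a larger one would break the condition 4 \<beta> \<delta> < 1.\<close>

lemma norm_cos_le_exp: "norm (cos (z::complex)) \<le> exp ((norm z)\<^sup>2 / 2)"
proof -
  have "(norm (cos z))\<^sup>2 = (cos (Re z))\<^sup>2 + (sinh (Im z))\<^sup>2"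
    by (simp add: norm_cos_squared sinh_def exp_minus power_divide)
  also have "\<dots> \<le> 1 + (sinh (Im z))\<^sup>2" by (simp add: abs_square_le_1)
  also have "\<dots> = (cosh (Im z))\<^sup>2" by (simp add: cosh_square_eq add.commute)
  finally have "norm (cos z) \<le> cosh (Im z)" by (rule power2_le_imp_le) simp
  also have "\<dots> \<le> exp ((Im z)\<^sup>2 / 2)" by (rule cosh_le_exp_half_square)
  also have "\<dots> \<le> exp ((norm z)\<^sup>2 / 2)" by (simp add: cmod_power2)
  finally show ?thesis .
qed

lemma real_strip_poly_mult:
  assumes "real_strip_poly r p" "real_strip_poly r q"
  shows "real_strip_poly r (p * q)"
  using assms unfolding real_strip_poly_def real_coeffs_iff_poly_cnj by auto

lemma real_strip_poly_one: "real_strip_poly r 1"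
  unfolding real_strip_poly_def real_coeffs_iff_poly_cnj by auto

lemma real_strip_poly_power: "real_strip_poly r p \<Longrightarrow> real_strip_poly r (p ^ n)"
  by (induction n) (simp_all add: real_strip_poly_one real_strip_poly_mult)

lemma real_strip_poly_linear:
  assumes "r \<ge> 0"
  shows "real_strip_poly r [:of_real x, of_real y:]"
proof -
  have "\<bar>Im z\<bar> \<le> r" if "[:of_real x, of_real y :: complex:] \<noteq> 0" "poly [:of_real x, of_real y:] z = 0" for z
  proof -
    have "Im (of_real x + z * of_real y) = 0" "Re (of_real x + z * of_real y) = 0" using that(2) by simp_all
    then show ?thesis using that(1) assms by auto
  qed
  then show ?thesis unfolding real_strip_poly_def real_coeffs_iff_poly_cnj by auto
qed

lemma real_strip_poly_quadratic:
  assumes "r \<ge> 0" "y \<ge> 0"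
  shows "real_strip_poly r [:1, 0, - of_real y:]"
proof -
  have "[:1, 0, - of_real y :: complex:] = [:of_real 1, of_real (sqrt y):] * [:of_real 1, of_real (- sqrt y):]"
    using assms(2) by (simp flip: of_real_mult)
  then show ?thesis using real_strip_poly_mult[OF real_strip_poly_linear real_strip_poly_linear] assms(1) by metis
qed

lemma real_strip_poly_prod_cutoff:
  assumes sym: "image_mset cnj (image_mset \<beta> (mset_set F)) = image_mset \<beta> (mset_set F)" and F: "finite F"
    and strip: "\<And>k. \<beta> k \<noteq> 0 \<Longrightarrow> \<bar>Im (1 / \<beta> k)\<bar> \<le> r"
  shows "real_strip_poly r (\<Prod>k\<in>F. [:1, - \<beta> k:])"
proof -
  have eval: "poly (\<Prod>k\<in>F. [:1, - \<beta> k:]) z = (\<Prod>b\<in>#image_mset \<beta> (mset_set F). 1 - b * z)" for z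
    by (simp only: poly_prod) (simp add: prod_unfold_prod_mset image_mset.compositionality o_def mult.commute)
  have "poly (\<Prod>k\<in>F. [:1, - \<beta> k:]) (cnj z) = cnj (poly (\<Prod>k\<in>F. [:1, - \<beta> k:]) z)" for z
  proof -
    have "cnj (\<Prod>b\<in>#B. 1 - b * z) = (\<Prod>b\<in>#image_mset cnj B. 1 - b * cnj z)" for B
      by (induction B) auto
    then show ?thesis by (simp only: eval sym)
  qed
  moreover have "\<bar>Im z\<bar> \<le> r" if "poly (\<Prod>k\<in>F. [:1, - \<beta> k:]) z = 0" for z
  proof -
    have "\<exists>k\<in>F. poly [:1, - \<beta> k:] z = 0" using that F by (simp only: poly_prod prod_zero_iff)
    then obtain k where k: "z * \<beta> k = 1" by auto
    then have "\<beta> k \<noteq> 0" by auto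
    moreover from this k have "z = 1 / \<beta> k" by (simp add: eq_divide_eq)
    ultimately show ?thesis using strip by simp
  qed
  ultimately show ?thesis unfolding real_strip_poly_def real_coeffs_iff_poly_cnj by auto
qed

text \<open>
  The exponential \<open>exp (t z)\<close> left over from the Weierstrass factors is replaced by \<open>(1 + t z / q) ^ q\<close>. As \<open>t\<close> may be unbounded, \<open>q\<close> has to
  grow with \<open>t\<close> in order to keep the Gaussian bound uniform.
\<close>
lemma LP1_gauss_poly_approx:
  assumes f1: "f1 \<in> LP1 r" and \<gamma>: "\<gamma> \<ge> 0" and \<epsilon>: "\<epsilon> > 0" and r: "r \<ge> 0"
  obtains P C where "C \<ge> 0" "\<And>n. real_strip_poly r (P n)" "\<And>n. gauss_bounded C (\<gamma> + \<epsilon>) (poly (P n))"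
    "\<And>z. (\<lambda>n. poly (P n) z) \<longlonglongrightarrow> exp (- of_real \<gamma> * z\<^sup>2) * f1 z"
proof -
  obtain c a m \<beta> where re: "real_entire f1" and strip: "\<And>k. \<beta> k \<noteq> 0 \<Longrightarrow> \<bar>Im (1 / \<beta> k)\<bar> \<le> max 0 r"
    and sum: "summable (\<lambda>k. (norm (\<beta> k))\<^sup>2)"
    and eq: "\<And>z. f1 z = of_real c * z ^ m * exp (of_real a * z) * (\<Prod>k. weierstrass_factor 1 (\<beta> k * z))"
    by (rule LP1_E[OF f1]) (use that in blast)
  show ?thesis
  \<comment> \<open>For c = 0 the function does not determine the listed zeros, which may then fail
    to be symmetric under conjugation.\<close>
  proof (cases "c = 0")
    case True
    then have "f1 z = 0" for z by (simp add: eq)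
    then show ?thesis
      by (intro that[of 0 "\<lambda>_. 0"]) (auto simp: real_strip_poly_def gauss_bounded_def intro!: holomorphic_intros)
  next
    case False
    have fin: "finite (cutoff \<beta> n)" for n by (rule finite_cutoff[OF sum])
    note sym = cutoff_symmetric[OF re sum False eq]
    define t where "t = (\<lambda>n. a + Re (\<Sum>k\<in>cutoff \<beta> n. \<beta> k))"
    have t: "of_real (t n) = of_real a + (\<Sum>k\<in>cutoff \<beta> n. \<beta> k)" for n
    proof -
      have "(\<Sum>b\<in>#image_mset \<beta> (mset_set (cutoff \<beta> n)). b) \<in> \<real>"
        by (rule sum_mset_cnj_real[OF sym]) simp
      then have "(\<Sum>k\<in>cutoff \<beta> n. \<beta> k) \<in> \<real>" by (simp add: sum_unfold_sum_mset)
      then have "of_real (Re (\<Sum>k\<in>cutoff \<beta> n. \<beta> k)) = (\<Sum>k\<in>cutoff \<beta> n. \<beta> k)" by (rule of_real_Re)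
      then show ?thesis by (simp only: t_def of_real_add)
    qed
    \<comment> \<open>Chosen so that t^2 / q <= \<epsilon> / (n + 1): at most \<epsilon> for the
      uniform bound, tending to 0 for the limit. The summand 1 keeps \<open>q n\<close> positive
      when \<open>t n\<close> is 0.\<close>
    define q where "q = (\<lambda>n. nat \<lceil>real (Suc n) * (1 + (t n)\<^sup>2) / \<epsilon>\<rceil>)"
    have q: "real (q n) \<ge> real (Suc n) * (1 + (t n)\<^sup>2) / \<epsilon>" for n
      unfolding q_def by (rule real_nat_ceiling_ge)
    have "real (Suc n) * (1 + (t n)\<^sup>2) / \<epsilon> > 0" for n
      using \<epsilon> by (intro divide_pos_pos mult_pos_pos) (auto intro: add_pos_nonneg)
    then have qpos: "q n > 0" for n by (metis q less_le_trans of_nat_0_less_iff)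
    have qt: "(t n)\<^sup>2 / real (q n) \<le> \<epsilon> / real (Suc n)" for n
    proof -
      have "(t n)\<^sup>2 * real (Suc n) \<le> real (Suc n) * (1 + (t n)\<^sup>2)" by (simp add: algebra_simps)
      also have "\<dots> \<le> \<epsilon> * real (q n)" using q[of n] \<epsilon> by (simp add: divide_le_eq mult.commute)
      finally show ?thesis using qpos[of n] by (simp add: field_simps)
    qed
    define w where "w = (\<lambda>n z. - of_real (t n) * z / of_nat (q n) :: complex)"
    have wq: "real (q n) * (norm (w n z))\<^sup>2 = (t n)\<^sup>2 / real (q n) * (norm z)\<^sup>2" for n z
      using qpos[of n] by (simp add: w_def norm_divide norm_mult power_divide power_mult_distrib power2_eq_square)
    have wq_le: "real (q n) * (norm (w n z))\<^sup>2 \<le> \<epsilon> / real (Suc n) * (norm z)\<^sup>2" for n z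
      unfolding wq by (intro mult_right_mono qt) simp
    define P where "P = (\<lambda>n. [:1, 0, - of_real (\<gamma> / real (Suc n)):] ^ Suc n * ([:of_real c, of_real 0:] * [:of_real 0, of_real 1:] ^ m
        * ((\<Prod>k\<in>cutoff \<beta> n. [:1, - \<beta> k:]) * [:of_real 1, of_real (t n / real (q n)):] ^ q n)))"
    have P_eq: "poly (P n) z = (1 + (- of_real \<gamma> * z\<^sup>2) / of_nat (Suc n)) ^ Suc n * (lp1_trunc c a m \<beta> n z * weierstrass_factor 1 (w n z) ^ q n)" for n z
    proof -
      \<comment> \<open>Since \<open>t n\<close> is exactly \<open>a\<close> plus the sum of the
        retained reciprocals, the q-th power of exp (w n z) removes every exponential and a
        polynomial remains.\<close>
      have "exp (of_real a * z) * (\<Prod>k\<in>cutoff \<beta> n. exp (\<beta> k * z)) * exp (w n z) ^ q n = 1"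
      proof -
        have "exp (w n z) ^ q n = exp (- (of_real (t n) * z))"
          unfolding exp_of_nat_mult[symmetric] using qpos[of n] by (simp add: w_def)
        moreover have "(\<Prod>k\<in>cutoff \<beta> n. exp (\<beta> k * z)) = exp ((\<Sum>k\<in>cutoff \<beta> n. \<beta> k) * z)"
          using fin by (simp add: exp_sum sum_distrib_right)
        ultimately show ?thesis by (simp add: t distrib_right flip: exp_add)
      qed
      moreover have "lp1_trunc c a m \<beta> n z * weierstrass_factor 1 (w n z) ^ q n
          = (of_real c * z ^ m * (\<Prod>k\<in>cutoff \<beta> n. 1 - \<beta> k * z) * (1 - w n z) ^ q n)
            * (exp (of_real a * z) * (\<Prod>k\<in>cutoff \<beta> n. exp (\<beta> k * z)) * exp (w n z) ^ q n)"
        unfolding lp1_trunc_def weierstrass_factor_one prod.distrib power_mult_distrib by (simp only: mult_ac)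
      ultimately have "lp1_trunc c a m \<beta> n z * weierstrass_factor 1 (w n z) ^ q n
          = of_real c * z ^ m * (\<Prod>k\<in>cutoff \<beta> n. 1 - \<beta> k * z) * (1 - w n z) ^ q n"
        by (simp only: mult_1_right)
      moreover have "1 - w n z = 1 + of_real (t n / real (q n)) * z" by (simp add: w_def)
      moreover have "1 + (- of_real \<gamma> * z\<^sup>2) / of_nat (Suc n) = 1 - of_real (\<gamma> / real (Suc n)) * z\<^sup>2"
        by (simp del: of_nat_Suc)
      ultimately show ?thesis
        by (simp only: P_def poly_mult poly_power poly_prod)
          (simp add: mult_ac power2_eq_square del: of_nat_Suc power_Suc)
    qed
    obtain C where C: "C \<ge> 0" "\<And>n z. norm (lp1_trunc c a m \<beta> n z) \<le> C * exp (\<epsilon> / 2 * (norm z)\<^sup>2)"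
      by (rule lp1_trunc_growth[OF sum, of "\<epsilon> / 2" c a m]) (use that \<epsilon> in auto)
    show ?thesis
    proof (rule that[OF C(1), of P])
      show "real_strip_poly r (P n)" for n
      proof -
        have "max 0 r = r" using r by simp
        with strip have strip': "\<And>k. \<beta> k \<noteq> 0 \<Longrightarrow> \<bar>Im (1 / \<beta> k)\<bar> \<le> r" by simp
        have "\<gamma> / real (Suc n) \<ge> 0" using \<gamma> by simp
        then show ?thesis
          unfolding P_def using r
          by (intro real_strip_poly_mult real_strip_poly_power real_strip_poly_linear real_strip_poly_quadratic
              real_strip_poly_prod_cutoff[OF sym fin strip'])
      qed
      show "gauss_bounded C (\<gamma> + \<epsilon>) (poly (P n))" for n
        unfolding gauss_bounded_def
      proof (intro conjI allI)
        show "poly (P n) holomorphic_on UNIV" by (intro holomorphic_intros)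
        fix z :: complex
        have 1: "norm ((1 + (- of_real \<gamma> * z\<^sup>2) / of_nat (Suc n)) ^ Suc n) \<le> exp (\<gamma> * (norm z)\<^sup>2)"
        proof -
          have "norm (1 + (- of_real \<gamma> * z\<^sup>2) / of_nat (Suc n)) \<le> 1 + norm ((- of_real \<gamma> * z\<^sup>2) / of_nat (Suc n))"
            by (metis norm_one norm_triangle_ineq)
          also have "norm ((- of_real \<gamma> * z\<^sup>2) / of_nat (Suc n)) = \<gamma> * (norm z)\<^sup>2 / real (Suc n)"
            using \<gamma> by (simp add: norm_divide norm_mult norm_power del: of_nat_Suc)
          finally have "norm (1 + (- of_real \<gamma> * z\<^sup>2) / of_nat (Suc n)) ^ Suc n \<le> (1 + \<gamma> * (norm z)\<^sup>2 / real (Suc n)) ^ Suc n"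
            by (rule power_mono) simp
          also have "\<dots> \<le> exp (\<gamma> * (norm z)\<^sup>2)"
            by (rule exp_ge_one_plus_x_over_n_power_n) (use \<gamma> in \<open>auto intro: order_trans[of _ 0]\<close>)
          finally show ?thesis by (simp only: norm_power)
        qed
        have 2: "norm (weierstrass_factor 1 (w n z) ^ q n) \<le> exp (\<epsilon> / 2 * (norm z)\<^sup>2)"
        proof -
          have "norm (weierstrass_factor 1 (w n z)) ^ q n \<le> exp ((norm (w n z))\<^sup>2 / 2) ^ q n"
            by (intro power_mono norm_weierstrass_factor_one_le) simp
          also have "\<dots> = exp (real (q n) * (norm (w n z))\<^sup>2 / 2)"
            by (simp flip: exp_of_nat_mult)
          also have "\<dots> \<le> exp (\<epsilon> / 2 * (norm z)\<^sup>2)"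
          proof (subst exp_le_cancel_iff)
            have "\<epsilon> / real (Suc n) \<le> \<epsilon> / 1" using \<epsilon> by (intro divide_left_mono) auto
            then have "\<epsilon> / real (Suc n) * (norm z)\<^sup>2 \<le> \<epsilon> * (norm z)\<^sup>2" by (intro mult_right_mono) auto
            then show "real (q n) * (norm (w n z))\<^sup>2 / 2 \<le> \<epsilon> / 2 * (norm z)\<^sup>2" using wq_le[of n z] by simp
          qed
          finally show ?thesis by (simp only: norm_power)
        qed
        have "norm (poly (P n) z) \<le> exp (\<gamma> * (norm z)\<^sup>2) * (C * exp (\<epsilon> / 2 * (norm z)\<^sup>2) * exp (\<epsilon> / 2 * (norm z)\<^sup>2))"
          unfolding P_eq norm_mult using C(1) by (intro mult_mono 1 2 C(2)) auto
        also have "\<dots> = C * (exp (\<gamma> * (norm z)\<^sup>2) * (exp (\<epsilon> / 2 * (norm z)\<^sup>2) * exp (\<epsilon> / 2 * (norm z)\<^sup>2)))"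
          by (simp only: mult_ac)
        also have "\<dots> = C * exp ((\<gamma> + \<epsilon>) * (norm z)\<^sup>2)"
          by (simp add: distrib_right flip: exp_add)
        finally show "norm (poly (P n) z) \<le> C * exp ((\<gamma> + \<epsilon>) * (norm z)\<^sup>2)" .
      qed
      show "(\<lambda>n. poly (P n) z) \<longlonglongrightarrow> exp (- of_real \<gamma> * z\<^sup>2) * f1 z" for z
      proof -
        have "(\<lambda>n. (1 + (- of_real \<gamma> * z\<^sup>2) / of_nat (Suc n)) ^ Suc n) \<longlonglongrightarrow> exp (- of_real \<gamma> * z\<^sup>2)"
          by (rule tendsto_one_plus_power_exp[OF tendsto_const])
        moreover have "(\<lambda>n. weierstrass_factor 1 (w n z) ^ q n) \<longlonglongrightarrow> 1"
        proof (rule weierstrass_factor_one_power_tendsto[OF _ qpos])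
          have "(\<lambda>n. \<epsilon> * (1 / real (Suc n)) * (norm z)\<^sup>2) \<longlonglongrightarrow> \<epsilon> * 0 * (norm z)\<^sup>2"
            by (intro tendsto_intros LIMSEQ_Suc[OF lim_1_over_n])
          then have lim: "(\<lambda>n. \<epsilon> / real (Suc n) * (norm z)\<^sup>2) \<longlonglongrightarrow> 0" by simp
          show "(\<lambda>n. real (q n) * (norm (w n z))\<^sup>2) \<longlonglongrightarrow> 0"
            by (rule Lim_null_comparison[OF _ lim]) (use wq_le in auto)
        qed
        ultimately have "(\<lambda>n. poly (P n) z) \<longlonglongrightarrow> exp (- of_real \<gamma> * z\<^sup>2) *
            (of_real c * z ^ m * exp (of_real a * z) * (\<Prod>k. weierstrass_factor 1 (\<beta> k * z)) * 1)"
          unfolding P_eq by (intro tendsto_mult lp1_trunc_tendsto[OF sum])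
        then show ?thesis by (simp add: eq)
      qed
    qed
  qed
qed

text \<open>The approximants are not polynomials: an exponential factor can stay, since it acts as a
  translation. With l = \<alpha> / sqrt (n + 1) and n + 1 cosines, the total decrease of the squared
  width is \<alpha>^2 for every \<open>n\<close>, so the polynomials produced share one
  strip.\<close>

lemma LP1_cos_approx:
  assumes \<phi>1: "\<phi>1 \<in> LP1 0" and \<epsilon>: "\<epsilon> > 0" and \<alpha>: "\<alpha> > 0"
  obtains \<Phi> C where "C \<ge> 0" "\<And>n. gauss_bounded C (\<alpha>\<^sup>2 / 2 + \<epsilon>) (\<Phi> n)"
    "\<And>z. (\<lambda>n. \<Phi> n z) \<longlonglongrightarrow> exp (- of_real (\<alpha>\<^sup>2 / 2) * z\<^sup>2) * \<phi>1 z"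
    "\<And>n r p. r \<ge> 0 \<Longrightarrow> real_strip_poly r p \<Longrightarrow>
       \<exists>q. real_strip_poly (sqrt (max 0 (r\<^sup>2 - \<alpha>\<^sup>2))) q \<and> op_D (\<Phi> n) (poly p) = poly q"
proof -
  obtain c a m \<beta> where strip: "\<And>k. \<beta> k \<noteq> 0 \<Longrightarrow> \<bar>Im (1 / \<beta> k)\<bar> \<le> max 0 0"
    and sum: "summable (\<lambda>k. (norm (\<beta> k))\<^sup>2)"
    and eq: "\<And>z. \<phi>1 z = of_real c * z ^ m * exp (of_real a * z) * (\<Prod>k. weierstrass_factor 1 (\<beta> k * z))"
    by (rule LP1_E[OF \<phi>1]) (use that in blast)
  have real: "\<beta> k \<in> \<real>" for k
  proof (cases "\<beta> k = 0")
    case False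
    then have "1 / \<beta> k \<in> \<real>" using strip[of k] by (simp add: complex_is_Real_iff)
    then have "inverse (1 / \<beta> k) \<in> \<real>" by (rule Reals_inverse)
    then show ?thesis by (simp only: inverse_eq_divide divide_divide_eq_right mult_1_left div_by_1)
  qed simp
  have fin: "finite (cutoff \<beta> n)" for n by (rule finite_cutoff[OF sum])
  define b where "b = (\<lambda>n. a + Re (\<Sum>k\<in>cutoff \<beta> n. \<beta> k))"
  have b: "of_real (b n) = of_real a + (\<Sum>k\<in>cutoff \<beta> n. \<beta> k)" for n
  proof -
    have "(\<Sum>k\<in>cutoff \<beta> n. \<beta> k) \<in> \<real>" using real by (intro sum_in_Reals) auto
    then have "of_real (Re (\<Sum>k\<in>cutoff \<beta> n. \<beta> k)) = (\<Sum>k\<in>cutoff \<beta> n. \<beta> k)" by (rule of_real_Re)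
    then show ?thesis by (simp only: b_def of_real_add)
  qed
  have trunc: "lp1_trunc c a m \<beta> n = lp1_approx c m (b n) (cutoff \<beta> n) \<beta>" for n
    unfolding lp1_trunc_def[abs_def] lp1_approx_def[abs_def] b weierstrass_factor_one using fin
    by (simp add: fun_eq_iff prod.distrib exp_add distrib_right exp_sum sum_distrib_right)
  define l where "l = (\<lambda>n. \<alpha> / sqrt (real (Suc n)))"
  have l: "l n > 0" "real (Suc n) * (l n)\<^sup>2 = \<alpha>\<^sup>2" for n
    using \<alpha> by (auto simp: l_def power_divide simp del: of_nat_Suc)
  define \<Phi> where "\<Phi> = (\<lambda>n z. cos (of_real (l n) * z) ^ Suc n * lp1_trunc c a m \<beta> n z)"
  obtain C where C: "C \<ge> 0" "\<And>n z. norm (lp1_trunc c a m \<beta> n z) \<le> C * exp (\<epsilon> * (norm z)\<^sup>2)"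
    by (rule lp1_trunc_growth[OF sum \<epsilon>, of c a m]) (use that in blast)
  show ?thesis
  proof (rule that[OF C(1), of \<Phi>])
    show "gauss_bounded C (\<alpha>\<^sup>2 / 2 + \<epsilon>) (\<Phi> n)" for n
      unfolding gauss_bounded_def
    proof (intro conjI allI)
      show "\<Phi> n holomorphic_on UNIV"
        unfolding \<Phi>_def by (intro holomorphic_intros lp1_trunc_holomorphic)
      fix z :: complex
      have "norm (cos (of_real (l n) * z)) ^ Suc n \<le> exp ((norm (of_real (l n) * z))\<^sup>2 / 2) ^ Suc n"
        by (intro power_mono norm_cos_le_exp) simp
      also have "\<dots> = exp (real (Suc n) * ((norm (of_real (l n) * z))\<^sup>2 / 2))"
        by (rule exp_of_nat_mult[symmetric])
      also have "real (Suc n) * ((norm (of_real (l n) * z))\<^sup>2 / 2) = real (Suc n) * (l n)\<^sup>2 / 2 * (norm z)\<^sup>2"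
        by (simp add: norm_mult power_mult_distrib del: of_nat_Suc)
      also have "\<dots> = \<alpha>\<^sup>2 / 2 * (norm z)\<^sup>2" by (simp only: l(2))
      finally have "norm (\<Phi> n z) \<le> exp (\<alpha>\<^sup>2 / 2 * (norm z)\<^sup>2) * (C * exp (\<epsilon> * (norm z)\<^sup>2))"
        unfolding \<Phi>_def norm_mult norm_power by (intro mult_mono C(2)) auto
      also have "\<dots> = C * exp ((\<alpha>\<^sup>2 / 2 + \<epsilon>) * (norm z)\<^sup>2)"
        by (simp add: distrib_right exp_add)
      finally show "norm (\<Phi> n z) \<le> C * exp ((\<alpha>\<^sup>2 / 2 + \<epsilon>) * (norm z)\<^sup>2)" .
    qed
    show "(\<lambda>n. \<Phi> n z) \<longlonglongrightarrow> exp (- of_real (\<alpha>\<^sup>2 / 2) * z\<^sup>2) * \<phi>1 z" for z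
    proof -
      have "(\<lambda>n. cos (of_real \<alpha> * z / of_real (sqrt (real (Suc n)))) ^ Suc n) \<longlonglongrightarrow> exp (- ((of_real \<alpha> * z)\<^sup>2) / 2)"
        by (rule cos_power_tendsto)
      moreover have "of_real \<alpha> * z / of_real (sqrt (real (Suc n))) = of_real (l n) * z" for n
        by (simp add: l_def)
      moreover have "- ((of_real \<alpha> * z)\<^sup>2) / 2 = - of_real (\<alpha>\<^sup>2 / 2) * z\<^sup>2"
        by (simp add: power_mult_distrib)
      ultimately have "(\<lambda>n. cos (of_real (l n) * z) ^ Suc n) \<longlonglongrightarrow> exp (- of_real (\<alpha>\<^sup>2 / 2) * z\<^sup>2)"
        by (simp only:)
      then show ?thesis
        unfolding \<Phi>_def eq by (intro tendsto_mult lp1_trunc_tendsto[OF sum])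
    qed
    fix n r p assume r: "(r::real) \<ge> 0" and p: "real_strip_poly r p"
    obtain q where "real_strip_poly (sqrt (max 0 (r\<^sup>2 - of_nat (Suc n) * (l n)\<^sup>2))) q"
      "op_D (\<lambda>z. cos (of_real (l n) * z) ^ Suc n * lp1_approx c m (b n) (cutoff \<beta> n) \<beta> z) (poly p) = poly q"
      by (rule op_D_approx_poly[OF p l(1) r fin real])
    then show "\<exists>q. real_strip_poly (sqrt (max 0 (r\<^sup>2 - \<alpha>\<^sup>2))) q \<and> op_D (\<Phi> n) (poly p) = poly q"
      unfolding l(2) \<Phi>_def trunc by blast
  qed
qed

lemma op_D_LP_sup:
  assumes \<alpha>: "\<alpha> > 0" and \<phi>1: "\<phi>1 \<in> LP1 0" and r: "r \<ge> 0" and f: "f \<in> LP_sup (\<alpha>\<^sup>2 / 2) r"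
  shows "op_D (\<lambda>z. exp (- of_real (\<alpha>\<^sup>2 / 2) * z\<^sup>2) * \<phi>1 z) f \<in> LP (sqrt (r\<^sup>2 - \<alpha>\<^sup>2))"
proof -
  define \<phi> where "\<phi> = (\<lambda>z. exp (- of_real (\<alpha>\<^sup>2 / 2) * z\<^sup>2) * \<phi>1 z)"
  obtain \<gamma> f1 where f1: "f1 \<in> LP1 r" and \<gamma>: "\<gamma> \<ge> 0" "\<alpha>\<^sup>2 / 2 * \<gamma> < 1 / 4"
    and feq: "f = (\<lambda>z. exp (- of_real \<gamma> * z\<^sup>2) * f1 z)"
    using f by (auto simp: LP_sup_def)
  have hol1: "\<phi>1 holomorphic_on UNIV" "f1 holomorphic_on UNIV"
    using \<phi>1 f1 by (auto simp: LP1_def LP_rep_def real_entire_def)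
  have hol\<phi>: "\<phi> holomorphic_on UNIV" unfolding \<phi>_def by (intro holomorphic_intros hol1)
  have holf: "f holomorphic_on UNIV" unfolding feq by (intro holomorphic_intros hol1)
  define B where "B = \<alpha>\<^sup>2 / 2"
  have B: "B > 0" using \<alpha> by (simp add: B_def)
  \<comment> \<open>The strict inequality defining \<open>LP_sup\<close> leaves room to enlarge both
    types by the same \<epsilon>.\<close>
  obtain \<epsilon> where \<epsilon>: "\<epsilon> > 0" "4 * (B + \<epsilon>) * (\<gamma> + \<epsilon>) < 1"
  proof -
    have "((\<lambda>e. 4 * (B + e) * (\<gamma> + e)) \<longlongrightarrow> 4 * (B + 0) * (\<gamma> + 0)) (at_right 0)"
      by (intro tendsto_intros)
    moreover have "4 * (B + 0) * (\<gamma> + 0) < 1" using \<gamma>(2) by (simp add: B_def mult_ac)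
    ultimately have "eventually (\<lambda>e. 4 * (B + e) * (\<gamma> + e) < 1) (at_right 0)"
      by (rule order_tendstoD(2))
    then obtain d where d: "d > 0" "\<forall>y>0. y < d \<longrightarrow> 4 * (B + y) * (\<gamma> + y) < 1"
      by (auto simp: eventually_at_right_field)
    have "d / 2 > 0" "d / 2 < d" using d(1) by auto
    then show ?thesis using d(2) that[of "d / 2"] by blast
  qed
  obtain \<Phi> C where \<Phi>: "C \<ge> 0" "\<And>n. gauss_bounded C (\<alpha>\<^sup>2 / 2 + \<epsilon>) (\<Phi> n)"
    "\<And>z. (\<lambda>n. \<Phi> n z) \<longlonglongrightarrow> \<phi> z"
    "\<And>n r p. r \<ge> 0 \<Longrightarrow> real_strip_poly r p \<Longrightarrow>
       \<exists>q. real_strip_poly (sqrt (max 0 (r\<^sup>2 - \<alpha>\<^sup>2))) q \<and> op_D (\<Phi> n) (poly p) = poly q"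
    unfolding \<phi>_def by (rule LP1_cos_approx[OF \<phi>1 \<epsilon>(1) \<alpha>]) (use that in blast)
  obtain P C' where P: "C' \<ge> 0" "\<And>n. real_strip_poly r (P n)" "\<And>n. gauss_bounded C' (\<gamma> + \<epsilon>) (poly (P n))"
    "\<And>z. (\<lambda>n. poly (P n) z) \<longlonglongrightarrow> f z"
    unfolding feq by (rule LP1_gauss_poly_approx[OF f1 \<gamma>(1) \<epsilon>(1) r]) (use that in blast)
  have pos: "\<alpha>\<^sup>2 / 2 + \<epsilon> > 0" "\<gamma> + \<epsilon> \<ge> 0" "4 * (\<alpha>\<^sup>2 / 2 + \<epsilon>) * (\<gamma> + \<epsilon>) < 1"
    using B[unfolded B_def] \<epsilon>[unfolded B_def] \<gamma> by linarith+
  have "\<forall>n. \<exists>q. real_strip_poly (sqrt (max 0 (r\<^sup>2 - \<alpha>\<^sup>2))) q \<and> op_D (\<Phi> n) (poly (P n)) = poly q"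
    using \<Phi>(4)[OF r P(2)] by blast
  from choice[OF this] obtain q where q: "\<forall>n. real_strip_poly (sqrt (max 0 (r\<^sup>2 - \<alpha>\<^sup>2))) (q n) \<and> op_D (\<Phi> n) (poly (P n)) = poly (q n)"
    by (rule exE)
  have "op_D \<phi> f \<in> LP (sqrt (max 0 (r\<^sup>2 - \<alpha>\<^sup>2)))"
  proof (rule LP_closed_under_polynomial_limits)
    show "real_strip_poly (sqrt (max 0 (r\<^sup>2 - \<alpha>\<^sup>2))) (q n)" for n using q by simp
    have "(\<lambda>n. op_D (\<Phi> n) (poly (P n)) z) \<longlonglongrightarrow> op_D \<phi> f z" for z
      by (rule op_D_tendsto[OF pos \<Phi>(1) P(1) \<Phi>(2) \<Phi>(3) hol\<phi> P(3) P(4) holf])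
    then show "(\<lambda>n. poly (q n) z) \<longlonglongrightarrow> op_D \<phi> f z" for z using q by simp
    show "op_D \<phi> f holomorphic_on UNIV"
      by (rule op_D_holomorphic[OF pos \<Phi>(1) P(1) gauss_bounded_limit[OF \<Phi>(2) \<Phi>(3) hol\<phi>] gauss_bounded_limit[OF P(3) P(4) holf]])
  qed simp
  moreover have "sqrt (max 0 (r\<^sup>2 - \<alpha>\<^sup>2)) = max 0 (sqrt (r\<^sup>2 - \<alpha>\<^sup>2))"
    by (auto simp: max_def)
  ultimately show ?thesis by (simp add: LP_max_0 \<phi>_def)
qed

theorem theorem1p5:
  fixes \<alpha> :: real and \<phi> \<phi>\<^sub>1 :: "complex \<Rightarrow> complex"
  assumes "\<alpha> > 0"
    and "\<phi>\<^sub>1 \<in> LP1 0"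
    and "\<And>z. \<phi> z = exp (- of_real (\<alpha>\<^sup>2 / 2) * z\<^sup>2) * \<phi>\<^sub>1 z"
  shows "(\<forall>r\<ge>0. \<forall>f\<in>LP_sup (\<alpha>\<^sup>2 / 2) r. op_D \<phi> f \<in> LP (sqrt (r\<^sup>2 - \<alpha>\<^sup>2)))
         \<and> CZSDO (\<alpha>\<^sup>2 / 2) \<phi>"
proof -
  have \<phi>: "\<phi> = (\<lambda>z. exp (- of_real (\<alpha>\<^sup>2 / 2) * z\<^sup>2) * \<phi>\<^sub>1 z)"
    using assms(3) by blast
  have main: "op_D \<phi> f \<in> LP (sqrt (r\<^sup>2 - \<alpha>\<^sup>2))" if "r \<ge> 0" "f \<in> LP_sup (\<alpha>\<^sup>2 / 2) r" for r f
    unfolding \<phi> by (rule op_D_LP_sup[OF assms(1,2) that])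
  have shrink: "\<exists>r1. 0 \<le> r1 \<and> r1 < r \<and> (\<forall>f\<in>LP_sup (\<alpha>\<^sup>2 / 2) r. op_D \<phi> f \<in> LP r1)" if "r > 0" for r
  proof (intro exI conjI ballI)
    \<comment> \<open>The witness is the square root clipped at 0: a strip decreasing operator
      requires a nonnegative width, and clipping does not change the class.\<close>
    show "0 \<le> max 0 (sqrt (r\<^sup>2 - \<alpha>\<^sup>2))" by simp
    have "sqrt (r\<^sup>2 - \<alpha>\<^sup>2) < sqrt (r\<^sup>2)" using assms(1) by (intro real_sqrt_less_mono) simp
    then show "max 0 (sqrt (r\<^sup>2 - \<alpha>\<^sup>2)) < r" using that by simp
    show "op_D \<phi> f \<in> LP (max 0 (sqrt (r\<^sup>2 - \<alpha>\<^sup>2)))" if "f \<in> LP_sup (\<alpha>\<^sup>2 / 2) r" for f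
      unfolding LP_max_0 by (rule main) (use \<open>r > 0\<close> that in auto)
  qed
  have "CZSDO (\<alpha>\<^sup>2 / 2) \<phi>"
    unfolding CZSDO_def
  proof (intro conjI allI impI bexI)
    show "0 \<le> \<alpha>\<^sup>2 / 2" by simp
    show "\<phi> = (\<lambda>z. exp (- of_real (\<alpha>\<^sup>2 / 2) * z\<^sup>2) * \<phi>\<^sub>1 z)" by (rule \<phi>)
    show "\<phi>\<^sub>1 \<in> LP1 0" by (rule assms(2))
  qed (rule shrink)
  with main show ?thesis by blast
qed

end
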